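(* Let ${\bf B}=(v_1,v_2,v_3,v_4)\subset\mathbb C[\lambda_1,\dots,\lambda_6]$ be the Bautin ideal of the Kapteyn normal form of quadratic vector fields, where $$v_1=\lambda_1,\quad v_2=\lambda_5(\lambda_3-\lambda_6),\quad v_3=\lambda_2\lambda_4(\lambda_3-\lambda_6)(\lambda_4+5\lambda_3-5\lambda_6),$$ $$v_4=\lambda_2\lambda_4(\lambda_3-\lambda_6)^2(\lambda_3\lambda_6-2\lambda_6^2-\lambda_2^2),$$ and let $B_{\bf B}\mathbb C^6$ be the blowup of $\mathbb C^6$ with center ${\bf B}$, with exceptional divisor $E$. Then a complete set of essential perturbations (i.e. an essential set of irreducible components of the Nash arc space $Arc(B_{\bf B}\mathbb C^6,E)$) is given by exactly five irreducible components, $$Arc(I_1),\ Arc(I_2),\ Arc(I_3),\ Arc(I_4),\ Arc(I_1\cap I_3),$$ where $Arc(I_j)$ is the irreducible component containing, as a dense subset, the arcs centered over the points of $I_j$ that lie on no other $I_i$, and $Arc(I_1\cap I_3)$ is the irreducible component which is the closure of the family of arcs with $\lambda(0)=\lambda^*\in I_1\cap I_3$, $\lambda^*\notin I_2$, of the form $$\lambda_1=\varepsilon^3\lambda_{1,3}+O(\varepsilon^4),\quad \lambda_5=\varepsilon^2\lambda_{5,2}+O(\varepsilon^3),\quad \lambda_3-\lambda_6=\varepsilon(\lambda_{3,1}-\lambda_{6,1})+O(\varepsilon^2),\quad \lambda_4=\varepsilon\lambda_{4,1}+O(\varepsilon^2)$$ with general coefficients.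
   Context: The Kapteyn normal form is the family of quadratic vector fields $$\dot x=\lambda_1x-y-\lambda_3x^2+(2\lambda_2+\lambda_5)xy+\lambda_6y^2,\qquad \dot y=x+\lambda_1y+\lambda_2x^2+(2\lambda_3+\lambda_4)xy-\lambda_2y^2 .$$ Its center set $Z({\bf B})\subset\mathbb C^6$ has the irreducible components $I_1:\lambda_1=0,\ \lambda_3-\lambda_6=0$; $I_2:\lambda_1=\lambda_2=\lambda_5=0$; $I_3:\lambda_1=\lambda_4=\lambda_5=0$; $I_4:\lambda_1=\lambda_5=0,\ \lambda_4+5\lambda_3-5\lambda_6=0,\ \lambda_3\lambda_6-2\lambda_6^2-\lambda_2^2=0$. The blowup $B_{\bf B}\mathbb C^6\subset\mathbb C^6\times\mathbb P^3$ is the Zariski closure of the graph of $\mathbb C^6\setminus Z({\bf B})\to\mathbb P^3$, $\lambda\mapsto[v_1(\lambda):v_2(\lambda):v_3(\lambda):v_4(\lambda)]$, with projection $\pi$ to $\mathbb C^6$, and $E=\pi^{-1}(Z({\bf B}))$. $Arc(B_{\bf B}\mathbb C^6,E)$ is the space of formal arcs $\varepsilon\mapsto\alpha(\varepsilon)\in B_{\bf B}\mathbb C^6$ with center $\alpha(0)\in E$, with its structure of a proalgebraic variety (projective limit of the spaces of $k$-jets of such arcs, with the induced Zariski topology). An arc not contained in $E$ is identified with its projection $\lambda(\varepsilon)=\pi(\alpha(\varepsilon))$. An arc is centered over $\lambda^*$ if $\lambda(0)=\lambda^*$. Let $\pi_I:Arc(B_{\bf B}\mathbb C^6,E)\to E$,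 $\alpha\mapsto\alpha(0)$. A set $\mathcal M$ of irreducible components of $Arc(B_{\bf B}\mathbb C^6,E)$ is called essential if the $\pi_I$-images of its members cover $E$ and $\mathcal M$ is minimal under inclusion with this property. A complete set of essential perturbations is an essential set of irreducible components; each of its members is called an essential perturbation. *)

theory Defs
  imports
    "HOL-Analysis.Analysis"
    "HOL-Computational_Algebra.Formal_Power_Series"
    "HOL-Library.Poly_Mapping"
begin

text \<open>Polynomials over the complex numbers in variables indexed by a type, and their
  evaluation in an algebra with structure map \<open>h\<close>.\<close>

type_synonym 'v cpoly = "('v \<Rightarrow>\<^sub>0 nat) \<Rightarrow>\<^sub>0 complex"

definition poly_eval :: "(complex \<Rightarrow> 'r::comm_ring_1) \<Rightarrow> ('v \<Rightarrow> 'r) \<Rightarrow> 'v cpoly \<Rightarrow> 'r" where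
  "poly_eval h x F =
     (\<Sum>m\<in>Poly_Mapping.keys F. h (Poly_Mapping.lookup F m) *
        (\<Prod>i\<in>Poly_Mapping.keys m. x i ^ Poly_Mapping.lookup m i))"

text \<open>The Zariski topology on a set \<open>S\<close> of points of an affine space, \<open>c\<close> being the coordinates.\<close>

definition zariski_on :: "'a set \<Rightarrow> ('a \<Rightarrow> 'v \<Rightarrow> complex) \<Rightarrow> 'a topology" where
  "zariski_on S c = topology_generated_by {{x \<in> S. poly_eval id (c x) F \<noteq> 0} | F. True}"

definition quotient_topology :: "'a topology \<Rightarrow> ('a \<Rightarrow> 'b) \<Rightarrow> 'b topology" where
  "quotient_topology X f =
     topology (\<lambda>U. U \<subseteq> f ` topspace X \<and> openin X {x \<in> topspace X. f x \<in> U})"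

lemma openin_quotient_topology:
  "openin (quotient_topology X f) U \<longleftrightarrow>
     U \<subseteq> f ` topspace X \<and> openin X {x \<in> topspace X. f x \<in> U}"
proof -
  have "istopology (\<lambda>U. U \<subseteq> f ` topspace X \<and> openin X {x \<in> topspace X. f x \<in> U})"
    unfolding istopology_def
  proof (intro conjI allI impI)
    fix S T
    assume S: "S \<subseteq> f ` topspace X \<and> openin X {x \<in> topspace X. f x \<in> S}"
      and T: "T \<subseteq> f ` topspace X \<and> openin X {x \<in> topspace X. f x \<in> T}"
    have "{x \<in> topspace X. f x \<in> S \<inter> T} =
        {x \<in> topspace X. f x \<in> S} \<inter> {x \<in> topspace X. f x \<in> T}" by blast
    then show "openin X {x \<in> topspace X. f x \<in> S \<inter> T}"
      using openin_Int[OF conjunct2[OF S] conjunct2[OF T]] by (simp only:)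
    show "S \<inter> T \<subseteq> f ` topspace X" using S by blast
  next
    fix K
    assume K: "\<forall>S\<in>K. S \<subseteq> f ` topspace X \<and> openin X {x \<in> topspace X. f x \<in> S}"
    have "openin X (\<Union>((\<lambda>S. {x \<in> topspace X. f x \<in> S}) ` K))"
      by (rule openin_Union) (use K in blast)
    moreover have "{x \<in> topspace X. f x \<in> \<Union>K} = \<Union>((\<lambda>S. {x \<in> topspace X. f x \<in> S}) ` K)"
      by blast
    ultimately show "openin X {x \<in> topspace X. f x \<in> \<Union>K}"
      by (simp only:)
    show "\<Union>K \<subseteq> f ` topspace X" using K by blast
  qed
  then show ?thesis
    unfolding quotient_topology_def by (simp add: topology_inverse')
qed

definition irreducible_in :: "'a topology \<Rightarrow> 'a set \<Rightarrow> bool" where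
  "irreducible_in X S \<longleftrightarrow> S \<subseteq> topspace X \<and> S \<noteq> {} \<and>
     (\<forall>C D. closedin X C \<and> closedin X D \<and> S \<subseteq> C \<union> D \<longrightarrow> S \<subseteq> C \<or> S \<subseteq> D)"

definition irreducible_components_of :: "'a topology \<Rightarrow> 'a set set" where
  "irreducible_components_of X =
     {S. irreducible_in X S \<and> (\<forall>T. irreducible_in X T \<and> S \<subseteq> T \<longrightarrow> T = S)}"

text \<open>Points of \<open>\<P>\<^sup>3\<close> over a local ring \<open>R\<close> (here the complex numbers or the formal power series)
  are the classes modulo units of vectors having at least one unit coordinate.\<close>

definition unimodular :: "'r::comm_ring_1 ^ 4 \<Rightarrow> bool" where
  "unimodular y \<longleftrightarrow> (\<exists>j. y $ j dvd 1)"

definition proj_class :: "'r::comm_ring_1 ^ 4 \<Rightarrow> ('r ^ 4) set" where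
  "proj_class y = {u *s y | u. u dvd 1}"

definition coords :: "'r ^ 6 \<Rightarrow> 'r ^ 4 \<Rightarrow> 6 + 4 \<Rightarrow> 'r" where
  "coords l y = case_sum (\<lambda>i. l $ i) (\<lambda>j. y $ j)"

definition homogeneous_snd :: "(6 + 4) cpoly \<Rightarrow> bool" where
  "homogeneous_snd F \<longleftrightarrow>
     (\<exists>d. \<forall>m\<in>Poly_Mapping.keys F. (\<Sum>j\<in>UNIV. Poly_Mapping.lookup m (Inr j)) = d)"

type_synonym point = "(complex ^ 6) \<times> (complex ^ 4) set"

definition zariski_C6P3 :: "point topology" where
  "zariski_C6P3 = topology_generated_by
     {{(l, proj_class y) | l y. unimodular y \<and> poly_eval id (coords l y) F \<noteq> 0} | F.
        homogeneous_snd F}"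

text \<open>The parameter \<open>\<lambda>\<^sub>6\<close> is \<open>l $ 6\<close>, where \<open>6 = 0\<close> in the index type.\<close>

definition bautin :: "complex ^ 6 \<Rightarrow> complex ^ 4" where
  "bautin l = vector
     [l$1,
      l$5 * (l$3 - l$6),
      l$2 * l$4 * (l$3 - l$6) * (l$4 + 5 * l$3 - 5 * l$6),
      l$2 * l$4 * (l$3 - l$6)^2 * (l$3 * l$6 - 2 * (l$6)^2 - (l$2)^2)]"

definition center_set :: "(complex ^ 6) set" where
  "center_set = {l. \<forall>j. bautin l $ j = 0}"

definition I1 :: "(complex ^ 6) set" where
  "I1 = {l. l$1 = 0 \<and> l$3 - l$6 = 0}"

definition I2 :: "(complex ^ 6) set" where
  "I2 = {l. l$1 = 0 \<and> l$2 = 0 \<and> l$5 = 0}"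

definition I3 :: "(complex ^ 6) set" where
  "I3 = {l. l$1 = 0 \<and> l$4 = 0 \<and> l$5 = 0}"

definition I4 :: "(complex ^ 6) set" where
  "I4 = {l. l$1 = 0 \<and> l$5 = 0 \<and> l$4 + 5 * l$3 - 5 * l$6 = 0 \<and>
            l$3 * l$6 - 2 * (l$6)^2 - (l$2)^2 = 0}"

definition blowup :: "point set" where
  "blowup = zariski_C6P3 closure_of {(l, proj_class (bautin l)) | l. l \<notin> center_set}"

definition exc_divisor :: "point set" where
  "exc_divisor = {x \<in> blowup. fst x \<in> center_set}"

type_synonym arc = "(complex fps ^ 6) \<times> (complex fps ^ 4) set"

definition const_term :: "complex fps ^ 'n \<Rightarrow> complex ^ 'n" where
  "const_term v = (\<chi> i. fps_nth (v $ i) 0)"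

definition trunc :: "nat \<Rightarrow> complex fps ^ 'n \<Rightarrow> complex fps ^ 'n" where
  "trunc k v = (\<chi> i. fps_cutoff (Suc k) (v $ i))"

definition arc_center :: "arc \<Rightarrow> point" where
  "arc_center a = (const_term (fst a), const_term ` snd a)"

text \<open>A formal arc of \<open>\<complex>\<^sup>6 \<times> \<P>\<^sup>3\<close> lies in a closed subvariety iff it satisfies all its equations.\<close>

definition arc_in :: "arc \<Rightarrow> point set \<Rightarrow> bool" where
  "arc_in a V \<longleftrightarrow> (\<exists>y. unimodular y \<and> snd a = proj_class y) \<and>
     (\<forall>F. homogeneous_snd F \<and> (\<forall>(l, P)\<in>V. \<forall>z\<in>P. poly_eval id (coords l z) F = 0) \<longrightarrow>
        (\<forall>y\<in>snd a. poly_eval fps_const (coords (fst a) y) F = 0))"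

definition arcs :: "arc set" where
  "arcs = {a. arc_in a blowup \<and> arc_center a \<in> exc_divisor}"

text \<open>A \<open>k\<close>-jet is represented by power series cut off after degree \<open>k\<close>. The Zariski topology on
  the \<open>k\<close>-jets of \<open>\<complex>\<^sup>6 \<times> \<P>\<^sup>3\<close> is the quotient topology from the \<open>k\<close>-jets of
  \<open>\<complex>\<^sup>6 \<times> (\<complex>\<^sup>4 - {0})\<close>, an open subset of an affine space whose coordinates are the Taylor
  coefficients, modulo multiplication of the second factor by \<open>k\<close>-jets of units.\<close>

definition jet :: "nat \<Rightarrow> arc \<Rightarrow> arc" where
  "jet k a = (trunc k (fst a), trunc k ` snd a)"

definition cone_jets :: "nat \<Rightarrow> ((complex fps ^ 6) \<times> (complex fps ^ 4)) set" where
  "cone_jets k = {(l, y). trunc k l = l \<and> trunc k y = y \<and> unimodular y}"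

definition zariski_jets :: "nat \<Rightarrow> arc topology" where
  "zariski_jets k = quotient_topology
     (zariski_on (cone_jets k) (\<lambda>(l, y) (i, n). fps_nth (coords l y i) n))
     (\<lambda>(l, y). jet k (l, proj_class y))"

text \<open>Compatible sequences of \<open>k\<close>-jets of arcs correspond to arcs, so the projective limit is the
  set of arcs with the initial topology for the maps to the \<open>k\<close>-jets.\<close>

definition arc_space :: "arc topology" where
  "arc_space = topology_generated_by
     {{a \<in> arcs. jet k a \<in> U} | k U. openin (zariski_jets k) U}"

definition covers_exc :: "arc set set \<Rightarrow> bool" where
  "covers_exc M \<longleftrightarrow> (\<Union>A\<in>M. arc_center ` A) = exc_divisor"

definition essential :: "arc set set \<Rightarrow> bool" where
  "essential M \<longleftrightarrow> M \<subseteq> irreducible_components_of arc_space \<and> covers_exc M \<and>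
     (\<forall>M'. M' \<subset> M \<longrightarrow> \<not> covers_exc M')"

definition Arc :: "(complex ^ 6) set \<Rightarrow> arc set" where
  "Arc I = arc_space closure_of
     {a \<in> arcs. fst (arc_center a) \<in> I \<and> fst (arc_center a) \<notin> \<Union>({I1, I2, I3, I4} - {I})}"

text \<open>The arcs of the family over \<open>I1 \<inter> I3\<close> whose leading coefficients
  \<open>\<lambda>\<^bsub>1,3\<^esub>\<close>, \<open>\<lambda>\<^bsub>5,2\<^esub>\<close>, \<open>\<lambda>\<^bsub>3,1\<^esub> - \<lambda>\<^bsub>6,1\<^esub>\<close>, \<open>\<lambda>\<^bsub>4,1\<^esub>\<close> belong to \<open>G\<close>.\<close>

definition family13 :: "(complex ^ 4) set \<Rightarrow> arc set" where
  "family13 G = {a \<in> arcs. let l = fst a in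
     const_term l \<in> I1 \<inter> I3 \<and> const_term l \<notin> I2 \<and>
     (\<forall>n<3. fps_nth (l$1) n = 0) \<and>
     (\<forall>n<2. fps_nth (l$5) n = 0) \<and>
     (\<forall>n<1. fps_nth (l$3 - l$6) n = 0) \<and>
     (\<forall>n<1. fps_nth (l$4) n = 0) \<and>
     vector [fps_nth (l$1) 3, fps_nth (l$5) 2, fps_nth (l$3 - l$6) 1, fps_nth (l$4) 1] \<in> G}"

text \<open>\<open>A\<close> is the closure of the family with general coefficients: it is the closure of the
  subfamily given by any sufficiently small nonempty Zariski open set of leading coefficients.
  There is at most one such \<open>A\<close>, since nonempty Zariski open sets meet.\<close>

definition closure_general_family13 :: "arc set \<Rightarrow> bool" where
  "closure_general_family13 A \<longleftrightarrow>
     (let Z = zariski_on UNIV (\<lambda>(c :: complex ^ 4) i. c $ i) in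
      \<exists>G0. openin Z G0 \<and> G0 \<noteq> {} \<and>
        (\<forall>G. openin Z G \<and> G \<noteq> {} \<and> G \<subseteq> G0 \<longrightarrow> A = arc_space closure_of (family13 G)))"

end

theory Submission
  imports Defs "HOL-Computational_Algebra.Polynomial_FPS"
begin

text \<open>Write \<open>a = \<lambda>\<^sub>1\<close>, \<open>b = \<lambda>\<^sub>2\<close>, \<open>x = \<lambda>\<^sub>3 - \<lambda>\<^sub>6\<close>, \<open>d = \<lambda>\<^sub>4\<close>, \<open>e = \<lambda>\<^sub>5\<close>,
  \<open>c = \<lambda>\<^sub>6\<close>, \<open>f = d + 5x\<close> and \<open>g = xc - c\<^sup>2 - b\<^sup>2\<close>. The Bautin ideal is
  \<open>(a, ex, bdxf, bdx\<^sup>2g)\<close>, and on the blowup the homogeneous coordinates \<open>[p:q:r:s]\<close> are not only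
  proportional to its generators but also satisfy the syzygies \<open>er = bdfq\<close>, \<open>es = bdxgq\<close> and
  \<open>fs = xgr\<close> (\<open>coord_arc_relations\<close>).

  Near a point of \<open>I\<^sub>j\<close> on no other component the ideal is generated by local equations of \<open>I\<^sub>j\<close>,
  which is smooth there; so the blowup is that of a smooth centre, and the arcs are given freely by
  homogeneous coordinates on the exceptional projective space, the common factor \<open>h\<close> of the equations
  of \<open>I\<^sub>j\<close> along the arc (with \<open>h(0) = 0\<close>) and coordinates along \<open>I\<^sub>j\<close>: these are the charts
  \<open>chart1\<close> to \<open>chart4\<close>. Over \<open>I\<^sub>1 \<inter> I\<^sub>3\<close> the weights \<open>3, 2, 1, 1\<close> of \<open>a, e, x, d\<close> give all four
  generators the weight 3, and the fibre of the exceptional divisor is a whole \<open>\<P>\<^sup>3\<close>: a fifth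
  component. Where \<open>s\<close>, \<open>b\<close>, \<open>g\<close> and \<open>5s - gr\<close> do not vanish, the syzygies express \<open>d\<close>, \<open>e\<close> and
  \<open>a\<close> through \<open>x, b, c, p/s, q/s, r/s\<close>, so the blowup is a graph over an affine space; this is
  \<open>chart13\<close>.

  Thus there are five sets of arcs, each defined by an open condition on the centre and each the
  image of an open subset of a linear parameter space. Two members are joined by a line almost all
  of which lies in that subset, and a path with polynomial coefficients is a continuous map from the
  cofinite topology on the complex line; hence the five sets are irreducible (\<open>irreducible_by_paths\<close>). The closure of an open irreducible set is an
  irreducible component (\<open>open_irreducible_component\<close>). The five sets are disjoint unions of fibres
  of the centre map, so a centre of an arc in one of them is not the centre of an arc in the closure
  of another, and no component can be omitted (\<open>essential_strata\<close>). For the covering, a point of the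
  exceptional divisor is the centre of a constant arc; the syzygies show which of the five sets
  contains it or contains a path of constant arcs tending to it (\<open>const_arc_in_closure\<close>). Paths of
  the same kind identify the fifth component with the closure of the family
  (\<open>stratum13_in_closure_family\<close>, \<open>family_in_closure_stratum13\<close>).

  Two facts give membership in the arc space. An arc with \<open>v(\<lambda>(\<epsilon>)) = H y\<close> and \<open>H \<noteq> 0\<close> lies in the
  blowup, since its truncations, evaluated at complex numbers, are points of the graph
  (\<open>nondegenerate_arc\<close>). An arc inside the exceptional divisor is reached by a path of such arcs, and
  lying in the blowup is preserved in limits of paths (\<open>limit_arc\<close>).\<close>

section \<open>Evaluation of polynomials\<close>

definition mon :: "('v \<Rightarrow> 'r::comm_ring_1) \<Rightarrow> ('v \<Rightarrow>\<^sub>0 nat) \<Rightarrow> 'r" where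
  "mon x m = (\<Prod>i\<in>Poly_Mapping.keys m. x i ^ Poly_Mapping.lookup m i)"

lemma mon_superset:
  assumes "finite K" "Poly_Mapping.keys m \<subseteq> K"
  shows "mon x m = (\<Prod>i\<in>K. x i ^ Poly_Mapping.lookup m i)"
  unfolding mon_def
  by (rule prod.mono_neutral_left) (use assms in \<open>auto simp: in_keys_iff\<close>)

lemma mon_add: "mon x (m + n) = mon x m * mon x n"
proof -
  let ?K = "Poly_Mapping.keys m \<union> Poly_Mapping.keys n"
  have "mon x (m + n) = (\<Prod>i\<in>?K. x i ^ Poly_Mapping.lookup (m + n) i)"
    by (rule mon_superset) (simp_all add: keys_add)
  also have "\<dots> = (\<Prod>i\<in>?K. x i ^ Poly_Mapping.lookup m i) * (\<Prod>i\<in>?K. x i ^ Poly_Mapping.lookup n i)"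
    by (simp add: lookup_add power_add prod.distrib)
  also have "\<dots> = mon x m * mon x n"
    by (simp add: mon_superset[of ?K])
  finally show ?thesis .
qed

lemma poly_eval_mon:
  "poly_eval h x F = (\<Sum>m\<in>Poly_Mapping.keys F. h (Poly_Mapping.lookup F m) * mon x m)"
  by (simp add: poly_eval_def mon_def)

lemma poly_eval_superset:
  assumes "finite K" "Poly_Mapping.keys F \<subseteq> K" "h 0 = 0"
  shows "poly_eval h x F = (\<Sum>m\<in>K. h (Poly_Mapping.lookup F m) * mon x m)"
  unfolding poly_eval_mon
  by (rule sum.mono_neutral_left) (use assms in \<open>auto simp: in_keys_iff\<close>)

text \<open>Every compatibility of \<^const>\<open>poly_eval\<close> with a change of rings or with a class of
  functions of one variable is an instance of this: a relation respected by the ring operations is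
  respected by polynomials.\<close>

lemma poly_eval_rel:
  assumes c: "\<And>c. R (h c) (k c)" and z: "R 0 0" and one: "R 1 1"
    and add: "\<And>a b a' b'. R a a' \<Longrightarrow> R b b' \<Longrightarrow> R (a + b) (a' + b')"
    and mul: "\<And>a b a' b'. R a a' \<Longrightarrow> R b b' \<Longrightarrow> R (a * b) (a' * b')"
    and x: "\<And>i. R (x i) (x' i)"
  shows "R (poly_eval h x F) (poly_eval k x' F)"
proof -
  have pow: "R (x i ^ n) (x' i ^ n)" for i n
    by (induct n) (simp_all add: one mul x)
  have "R (mon x m) (mon x' m)" for m
  proof -
    have "R (\<Prod>i\<in>K. x i ^ Poly_Mapping.lookup m i) (\<Prod>i\<in>K. x' i ^ Poly_Mapping.lookup m i)"
      if "finite K" for K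
      using that by (induct K rule: finite_induct) (simp_all add: one mul pow)
    then show ?thesis by (simp add: mon_def)
  qed
  then have R: "R (h (Poly_Mapping.lookup F m) * mon x m) (k (Poly_Mapping.lookup F m) * mon x' m)" for m
    by (rule mul[OF c])
  have "R (\<Sum>m\<in>K. h (Poly_Mapping.lookup F m) * mon x m)
               (\<Sum>m\<in>K. k (Poly_Mapping.lookup F m) * mon x' m)" if "finite K" for K
    using that by (induct K rule: finite_induct) (simp_all add: z add R)
  then show ?thesis by (simp add: poly_eval_mon)
qed

locale coeff_hom =
  fixes h :: "complex \<Rightarrow> 'r::comm_ring_1"
  assumes h0 [simp]: "h 0 = 0" and h1 [simp]: "h 1 = 1"
    and hadd: "h (a + b) = h a + h b" and hmult: "h (a * b) = h a * h b"
begin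

lemma eval_add: "poly_eval h x (F + G) = poly_eval h x F + poly_eval h x G"
proof -
  let ?K = "Poly_Mapping.keys F \<union> Poly_Mapping.keys G"
  have "poly_eval h x (F + G) = (\<Sum>m\<in>?K. h (Poly_Mapping.lookup (F + G) m) * mon x m)"
    by (rule poly_eval_superset) (simp_all add: keys_add)
  also have "\<dots> = (\<Sum>m\<in>?K. h (Poly_Mapping.lookup F m) * mon x m) +
      (\<Sum>m\<in>?K. h (Poly_Mapping.lookup G m) * mon x m)"
    by (simp add: lookup_add hadd distrib_right sum.distrib)
  also have "\<dots> = poly_eval h x F + poly_eval h x G"
    by (simp add: poly_eval_superset[of ?K])
  finally show ?thesis .
qed

lemma eval_0 [simp]: "poly_eval h x 0 = 0"
  by (simp add: poly_eval_def)

lemma eval_single: "poly_eval h x (Poly_Mapping.single m c) = h c * mon x m"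
proof -
  have "poly_eval h x (Poly_Mapping.single m c) =
      (\<Sum>n\<in>{m}. h (Poly_Mapping.lookup (Poly_Mapping.single m c) n) * mon x n)"
    by (rule poly_eval_superset) auto
  then show ?thesis by simp
qed

lemma eval_sum: "poly_eval h x (\<Sum>i\<in>A. F i) = (\<Sum>i\<in>A. poly_eval h x (F i))"
  by (induction A rule: infinite_finite_induct) (auto simp: eval_add)

lemma eval_mult: "poly_eval h x (F * G) = poly_eval h x F * poly_eval h x G"
proof -
  have dec: "F = (\<Sum>m\<in>Poly_Mapping.keys F. Poly_Mapping.single m (Poly_Mapping.lookup F m))"
    for F :: "'b cpoly"
    by (rule poly_mapping_eqI) (simp add: lookup_sum lookup_single when_def in_keys_iff)
  have "F * G = (\<Sum>m\<in>Poly_Mapping.keys F. Poly_Mapping.single m (Poly_Mapping.lookup F m)) *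
     (\<Sum>m\<in>Poly_Mapping.keys G. Poly_Mapping.single m (Poly_Mapping.lookup G m))"
    using dec[of F] dec[of G] by simp
  also have "\<dots> = (\<Sum>m\<in>Poly_Mapping.keys F. \<Sum>n\<in>Poly_Mapping.keys G.
      Poly_Mapping.single (m + n) (Poly_Mapping.lookup F m * Poly_Mapping.lookup G n))"
    by (simp add: sum_product mult_single)
  finally have "poly_eval h x (F * G) = (\<Sum>m\<in>Poly_Mapping.keys F. \<Sum>n\<in>Poly_Mapping.keys G.
      (h (Poly_Mapping.lookup F m) * mon x m) * (h (Poly_Mapping.lookup G n) * mon x n))"
    by (simp add: eval_sum eval_single mon_add hmult algebra_simps)
  then show ?thesis by (simp add: poly_eval_mon sum_product)
qed

end

interpretation cplx: coeff_hom "id :: complex \<Rightarrow> complex"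
  by unfold_locales auto

interpretation fpsc: coeff_hom "fps_const :: complex \<Rightarrow> complex fps"
  by unfold_locales auto

lemma mon_single [simp]: "mon x (Poly_Mapping.single i (Suc 0)) = x i"
  by (simp add: mon_def)

lemma mon_0 [simp]: "mon x 0 = 1"
  by (simp add: mon_def)

definition weight_snd :: "((6 + 4) \<Rightarrow>\<^sub>0 nat) \<Rightarrow> nat" where
  "weight_snd m = (\<Sum>j\<in>UNIV. Poly_Mapping.lookup m (Inr j))"

lemma weight_snd_add: "weight_snd (m + n) = weight_snd m + weight_snd n"
  by (simp add: weight_snd_def lookup_add sum.distrib)

text \<open>This makes the vanishing of a homogeneous polynomial a property of the projective
  class; the factor \<open>u\<close> need not be a unit, which is used to cancel the common factor of an arc.\<close>

lemma poly_eval_scale: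
  assumes "\<forall>m\<in>Poly_Mapping.keys F. weight_snd m = d"
  shows "poly_eval h (coords l (u *s y)) F = u ^ d * poly_eval h (coords l y) F"
proof -
  have "mon (coords l (u *s y)) m = u ^ weight_snd m * mon (coords l y) m" for m
  proof -
    have mon_split: "mon x m = (\<Prod>i\<in>UNIV. x (Inl i) ^ Poly_Mapping.lookup m (Inl i)) *
        (\<Prod>j\<in>UNIV. x (Inr j) ^ Poly_Mapping.lookup m (Inr j))" for x :: "6 + 4 \<Rightarrow> 'a"
      using prod.Plus[of UNIV UNIV "\<lambda>i. x i ^ Poly_Mapping.lookup m i"]
      by (simp add: mon_superset[of UNIV])
    show ?thesis
      by (simp add: mon_split coords_def power_mult_distrib prod.distrib power_sum weight_snd_def)
  qed
  then show ?thesis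
    using assms by (simp add: poly_eval_mon sum_distrib_left mult.left_commute)
qed

text \<open>A bihomogeneous expression is used with complex arguments (points) and with power series
  (arcs). Recording both readings of one polynomial lets an identity between the generators, checked
  at points, be used along arcs.\<close>

definition hpoly :: "nat \<Rightarrow> (complex^6 \<Rightarrow> complex^4 \<Rightarrow> complex) \<Rightarrow>
    (complex fps^6 \<Rightarrow> complex fps^4 \<Rightarrow> complex fps) \<Rightarrow> bool" where
  "hpoly d e e' \<longleftrightarrow> (\<exists>F. (\<forall>m\<in>Poly_Mapping.keys F. weight_snd m = d) \<and>
     (\<forall>l y. poly_eval id (coords l y) F = e l y) \<and>
     (\<forall>l y. poly_eval fps_const (coords l y) F = e' l y))"

lemma hpoly_const: "hpoly 0 (\<lambda>l y. c) (\<lambda>l y. fps_const c)"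
  unfolding hpoly_def
  by (rule exI[of _ "Poly_Mapping.single 0 c"])
     (simp add: cplx.eval_single fpsc.eval_single weight_snd_def)

lemma hpoly_numeral: "hpoly 0 (\<lambda>l y. numeral n) (\<lambda>l y. numeral n)"
  using hpoly_const[of "numeral n"] by (simp add: numeral_fps_const)

lemma hpoly_fst: "hpoly 0 (\<lambda>l y. l $ i) (\<lambda>l y. l $ i)"
  unfolding hpoly_def
  by (rule exI[of _ "Poly_Mapping.single (Poly_Mapping.single (Inl i) 1) 1"])
     (auto simp: cplx.eval_single fpsc.eval_single coords_def weight_snd_def lookup_single)

lemma hpoly_snd: "hpoly (Suc 0) (\<lambda>l y. y $ i) (\<lambda>l y. y $ i)"
  unfolding hpoly_def
  by (rule exI[of _ "Poly_Mapping.single (Poly_Mapping.single (Inr i) 1) 1"])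
     (simp add: cplx.eval_single fpsc.eval_single coords_def weight_snd_def lookup_single when_def)

lemma hpoly_mult:
  assumes "hpoly d e1 e1'" "hpoly d' e2 e2'" "d'' = d + d'"
  shows "hpoly d'' (\<lambda>l y. e1 l y * e2 l y) (\<lambda>l y. e1' l y * e2' l y)"
proof -
  obtain F G where
    F: "\<forall>m\<in>Poly_Mapping.keys F. weight_snd m = d" "\<forall>l y. poly_eval id (coords l y) F = e1 l y"
      "\<forall>l y. poly_eval fps_const (coords l y) F = e1' l y" and
    G: "\<forall>m\<in>Poly_Mapping.keys G. weight_snd m = d'" "\<forall>l y. poly_eval id (coords l y) G = e2 l y"
      "\<forall>l y. poly_eval fps_const (coords l y) G = e2' l y"
    using assms(1,2) unfolding hpoly_def by blast
  have "\<forall>m\<in>Poly_Mapping.keys (F * G). weight_snd m = d''"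
  proof
    fix m assume "m \<in> Poly_Mapping.keys (F * G)"
    then obtain a b where "m = a + b" "a \<in> Poly_Mapping.keys F" "b \<in> Poly_Mapping.keys G"
      using keys_mult[of F G] by auto
    then show "weight_snd m = d''" using F(1) G(1) assms(3) by (simp add: weight_snd_add)
  qed
  then show ?thesis unfolding hpoly_def
    by (intro exI[of _ "F * G"]) (use F G in \<open>simp add: cplx.eval_mult fpsc.eval_mult\<close>)
qed

lemma hpoly_add:
  assumes "hpoly d e1 e1'" "hpoly d e2 e2'"
  shows "hpoly d (\<lambda>l y. e1 l y + e2 l y) (\<lambda>l y. e1' l y + e2' l y)"
proof -
  obtain F G where
    F: "\<forall>m\<in>Poly_Mapping.keys F. weight_snd m = d" "\<forall>l y. poly_eval id (coords l y) F = e1 l y"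
      "\<forall>l y. poly_eval fps_const (coords l y) F = e1' l y" and
    G: "\<forall>m\<in>Poly_Mapping.keys G. weight_snd m = d" "\<forall>l y. poly_eval id (coords l y) G = e2 l y"
      "\<forall>l y. poly_eval fps_const (coords l y) G = e2' l y"
    using assms unfolding hpoly_def by blast
  have "\<forall>m\<in>Poly_Mapping.keys (F + G). weight_snd m = d"
    using F(1) G(1) keys_add[of F G] by blast
  then show ?thesis unfolding hpoly_def
    by (intro exI[of _ "F + G"]) (use F G in \<open>simp add: cplx.eval_add fpsc.eval_add\<close>)
qed

lemma hpoly_diff:
  assumes "hpoly d e1 e1'" "hpoly d e2 e2'"
  shows "hpoly d (\<lambda>l y. e1 l y - e2 l y) (\<lambda>l y. e1' l y - e2' l y)"
  using hpoly_add[OF assms(1) hpoly_mult[OF hpoly_const[of "-1"] assms(2), of d]]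
  by (simp flip: fps_const_neg)

lemma hpoly_power2:
  assumes "hpoly 0 e1 e1'"
  shows "hpoly 0 (\<lambda>l y. (e1 l y)\<^sup>2) (\<lambda>l y. (e1' l y)\<^sup>2)"
  using hpoly_mult[OF assms assms, of 0] by (simp add: power2_eq_square)

section \<open>Zariski topologies\<close>

lemma zariski_eval_open:
  "openin (zariski_on S c) {x \<in> S. poly_eval id (c x) F \<noteq> 0}"
  unfolding zariski_on_def by (rule topology_generated_by_Basis) blast

text \<open>Regular functions on a set of points with coordinates \<open>c\<close>.\<close>

definition polyfun :: "('a \<Rightarrow> 'v \<Rightarrow> complex) \<Rightarrow> ('a \<Rightarrow> complex) \<Rightarrow> bool" where
  "polyfun c f \<longleftrightarrow> (\<exists>F. \<forall>x. poly_eval id (c x) F = f x)"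

lemma polyfun_const: "polyfun c (\<lambda>x. a)"
  unfolding polyfun_def
  by (rule exI[of _ "Poly_Mapping.single 0 a"]) (simp add: cplx.eval_single)

lemma polyfun_coord: "polyfun c (\<lambda>x. c x i)"
  unfolding polyfun_def
  by (rule exI[of _ "Poly_Mapping.single (Poly_Mapping.single i (Suc 0)) 1"]) (simp add: cplx.eval_single)

lemma polyfun_add:
  assumes "polyfun c f" "polyfun c g" shows "polyfun c (\<lambda>x. f x + g x)"
  using assms cplx.eval_add unfolding polyfun_def by metis

lemma polyfun_mult:
  assumes "polyfun c f" "polyfun c g" shows "polyfun c (\<lambda>x. f x * g x)"
  using assms cplx.eval_mult unfolding polyfun_def by metis

lemma zariski_open:
  assumes "polyfun c f" shows "openin (zariski_on S c) {x \<in> S. f x \<noteq> 0}"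
proof -
  obtain F where "\<And>x. poly_eval id (c x) F = f x"
    using assms unfolding polyfun_def by blast
  then show ?thesis using zariski_eval_open[of S c F] by simp
qed

lemma topspace_zariski_on [simp]: "topspace (zariski_on S c) = S"
proof -
  have "openin (zariski_on S c) S"
    using zariski_open[OF polyfun_const[of c 1], of S] by simp
  then have "S \<subseteq> topspace (zariski_on S c)" by (rule openin_subset)
  then show ?thesis unfolding zariski_on_def by auto
qed

section \<open>Polynomial paths\<close>

definition poly_path :: "(complex \<Rightarrow> complex) \<Rightarrow> bool" where
  "poly_path f \<longleftrightarrow> (\<exists>P. \<forall>t. f t = poly P t)"

lemma poly_path_const [intro, simp]: "poly_path (\<lambda>t. c)"
  unfolding poly_path_def by (rule exI[of _ "[:c:]"]) simp

lemma poly_path_id [intro, simp]: "poly_path (\<lambda>t. t)"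
  unfolding poly_path_def by (rule exI[of _ "[:0, 1:]"]) simp

lemma poly_path_add [intro, simp]:
  assumes "poly_path f" "poly_path g" shows "poly_path (\<lambda>t. f t + g t)"
  using assms unfolding poly_path_def by (metis poly_add)

lemma poly_path_diff [intro, simp]:
  assumes "poly_path f" "poly_path g" shows "poly_path (\<lambda>t. f t - g t)"
  using assms unfolding poly_path_def by (metis poly_diff)

lemma poly_path_mult [intro, simp]:
  assumes "poly_path f" "poly_path g" shows "poly_path (\<lambda>t. f t * g t)"
  using assms unfolding poly_path_def by (metis poly_mult)

lemma poly_path_divide [intro, simp]: "poly_path f \<Longrightarrow> poly_path (\<lambda>t. f t / c)"
  using poly_path_mult[of f "\<lambda>t. 1 / c"] by simp

lemma poly_path_power [intro, simp]: "poly_path f \<Longrightarrow> poly_path (\<lambda>t. f t ^ n)"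
  by (induct n) simp_all

lemma poly_path_sum [intro, simp]:
  "(\<And>i. i \<in> A \<Longrightarrow> poly_path (f i)) \<Longrightarrow> poly_path (\<lambda>t. \<Sum>i\<in>A. f i t)"
  by (induct A rule: infinite_finite_induct) simp_all

text \<open>A nonzero polynomial has finitely many zeros: on the parameter line nonempty open
  conditions hold for almost all values. All genericity arguments below reduce to this.\<close>

lemma poly_path_nonzero:
  assumes "poly_path f" "f t0 \<noteq> 0"
  shows "eventually (\<lambda>t. f t \<noteq> 0) cofinite"
proof -
  obtain P where P: "\<And>t. f t = poly P t" using assms(1) unfolding poly_path_def by blast
  then have "P \<noteq> 0" using assms(2) by auto
  then show ?thesis by (simp add: eventually_cofinite P poly_roots_finite)
qed

lemma poly_path_zero:
  assumes "poly_path f" "eventually (\<lambda>t. f t = 0) cofinite"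
  shows "f t = 0"
proof (rule ccontr)
  assume "f t \<noteq> 0"
  then have "eventually (\<lambda>t. f t \<noteq> 0) cofinite" by (rule poly_path_nonzero[OF assms(1)])
  with assms(2) have "eventually (\<lambda>t::complex. False) cofinite" by eventually_elim simp
  then show False by (simp add: infinite_UNIV_char_0)
qed

lemma poly_path_eval:
  assumes "\<And>i. poly_path (\<lambda>t. x t i)"
  shows "poly_path (\<lambda>t. poly_eval id (x t) F)"
proof -
  obtain P where P: "\<And>i t. x t i = poly (P i) t"
    using assms unfolding poly_path_def by metis
  have "poly (poly_eval (\<lambda>c. [:c:]) P F) t = poly_eval id (x t) F" for t
    by (rule poly_eval_rel[where R = "\<lambda>p s. poly p t = s"]) (auto simp: P)
  then show ?thesis unfolding poly_path_def by metis
qed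

definition fps_path :: "(complex \<Rightarrow> complex fps) \<Rightarrow> bool" where
  "fps_path f \<longleftrightarrow> (\<forall>n. poly_path (\<lambda>t. fps_nth (f t) n))"

lemma fps_pathD: "fps_path f \<Longrightarrow> poly_path (\<lambda>t. fps_nth (f t) n)"
  by (simp add: fps_path_def)

lemma fps_path_const [intro, simp]: "fps_path (\<lambda>t. c)"
  by (simp add: fps_path_def)

lemma fps_path_fps_const [intro, simp]: "poly_path f \<Longrightarrow> fps_path (\<lambda>t. fps_const (f t))"
  unfolding fps_path_def
proof
  fix n assume "poly_path f"
  then show "poly_path (\<lambda>t. fps_nth (fps_const (f t)) n)" by (cases n) simp_all
qed

lemma fps_path_add [intro, simp]:
  "fps_path f \<Longrightarrow> fps_path g \<Longrightarrow> fps_path (\<lambda>t. f t + g t)"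
  by (simp add: fps_path_def)

lemma fps_path_diff [intro, simp]:
  "fps_path f \<Longrightarrow> fps_path g \<Longrightarrow> fps_path (\<lambda>t. f t - g t)"
  by (simp add: fps_path_def)

lemma fps_path_mult [intro, simp]:
  "fps_path f \<Longrightarrow> fps_path g \<Longrightarrow> fps_path (\<lambda>t. f t * g t)"
  by (simp add: fps_path_def fps_mult_nth)

lemma fps_path_power [intro, simp]: "fps_path f \<Longrightarrow> fps_path (\<lambda>t. f t ^ n)"
  by (induct n) simp_all

lemma fps_path_nonzero:
  assumes "fps_path f" "fps_nth (f t0) n \<noteq> 0"
  shows "eventually (\<lambda>t. fps_nth (f t) n \<noteq> 0) cofinite"
  using poly_path_nonzero[OF fps_pathD[OF assms(1)], of t0 n] assms(2) by simp

lemma fps_path_eval: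
  assumes "\<And>i. fps_path (\<lambda>t. x t i)"
  shows "fps_path (\<lambda>t. poly_eval fps_const (x t) F)"
proof -
  have "\<forall>i n. \<exists>P. \<forall>t. fps_nth (x t i) n = poly P t"
    using assms unfolding fps_path_def poly_path_def by blast
  then obtain P where P: "\<And>i n t. fps_nth (x t i) n = poly (P i n) t" by metis
  have "\<forall>n. poly (fps_nth (poly_eval (\<lambda>c. fps_const [:c:]) (\<lambda>i. Abs_fps (P i)) F) n) t =
      fps_nth (poly_eval fps_const (x t) F) n" for t
    by (rule poly_eval_rel[where R = "\<lambda>p s. \<forall>n. poly (fps_nth p n) t = fps_nth s n"])
       (auto simp: P fps_mult_nth poly_sum)
  then show ?thesis unfolding fps_path_def poly_path_def by metis
qed

section \<open>Units and projective classes\<close>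

lemma fps_dvd_1_iff: "(f :: complex fps) dvd 1 \<longleftrightarrow> fps_nth f 0 \<noteq> 0"
  by (simp add: fps_is_unit_iff)

lemma unimodular_fps: "unimodular (y :: complex fps ^ 4) \<longleftrightarrow> (\<exists>j. fps_nth (y $ j) 0 \<noteq> 0)"
  by (simp add: unimodular_def fps_dvd_1_iff)

lemma unimodular_complex: "unimodular (y :: complex ^ 4) \<longleftrightarrow> (\<exists>j. y $ j \<noteq> 0)"
  by (simp add: unimodular_def dvd_field_iff)

lemma self_in_proj_class: "y \<in> proj_class y"
  unfolding proj_class_def by (rule CollectI, rule exI[of _ 1]) simp

lemma unimodular_scale:
  assumes "u dvd 1" "unimodular y" shows "unimodular (u *s y)"
  using assms mult_dvd_mono[of u 1 _ 1] unfolding unimodular_def by fastforce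

lemma proj_class_eqD:
  assumes "proj_class y = proj_class y'"
  obtains u where "u dvd 1" "y = u *s y'"
  using self_in_proj_class[of y] assms unfolding proj_class_def by auto

lemma proj_class_scale_subset: "u dvd 1 \<Longrightarrow> proj_class (u *s y) \<subseteq> proj_class y"
  unfolding proj_class_def
proof
  fix z assume u: "u dvd 1" and "z \<in> {w *s (u *s y) |w. w dvd 1}"
  then obtain w where w: "w dvd 1" "z = w *s (u *s y)" by blast
  have "z = (w * u) *s y" "w * u dvd 1" using w u mult_dvd_mono[of w 1 u 1] by simp_all
  then show "z \<in> {w *s y |w. w dvd 1}" by blast
qed

lemma proj_class_eqI:
  assumes "u dvd 1" shows "proj_class (u *s y) = proj_class y"
proof
  obtain v where v: "1 = u * v" using assms by (rule dvdE)
  have v1: "v dvd 1" using dvd_triv_right[of v u] unfolding v[symmetric] .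
  have "y = v *s (u *s y)" using v by (simp add: mult.commute)
  then show "proj_class y \<subseteq> proj_class (u *s y)"
    using proj_class_scale_subset[OF v1, of "u *s y"] by simp
qed (rule proj_class_scale_subset[OF assms])

lemma unimodular_proj_class:
  "proj_class y = proj_class y' \<Longrightarrow> unimodular y' \<Longrightarrow> unimodular y"
  by (metis proj_class_eqD unimodular_scale)

lemma const_term_nth [simp]: "const_term v $ i = fps_nth (v $ i) 0"
  by (simp add: const_term_def)

lemma const_term_proj_class: "const_term ` proj_class y = proj_class (const_term y)"
proof
  show "const_term ` proj_class y \<subseteq> proj_class (const_term y)"
  proof
    fix z assume "z \<in> const_term ` proj_class y"
    then obtain u where u: "u dvd 1" "z = const_term (u *s y)"
      by (auto simp: proj_class_def)
    then have "z = fps_nth u 0 *s const_term y" "fps_nth u 0 dvd 1"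
      by (auto simp: vec_eq_iff fps_dvd_1_iff dvd_field_iff)
    then show "z \<in> proj_class (const_term y)" by (auto simp: proj_class_def)
  qed
  show "proj_class (const_term y) \<subseteq> const_term ` proj_class y"
  proof
    fix z assume "z \<in> proj_class (const_term y)"
    then obtain u where u: "u dvd 1" "z = u *s const_term y"
      by (auto simp: proj_class_def)
    then have "z = const_term (fps_const u *s y)" "fps_const u dvd 1"
      by (auto simp: vec_eq_iff fps_dvd_1_iff dvd_field_iff)
    then show "z \<in> const_term ` proj_class y" unfolding proj_class_def by blast
  qed
qed

lemma arc_center_class [simp]:
  "arc_center (l, proj_class y) = (const_term l, proj_class (const_term y))"
  by (simp add: arc_center_def const_term_proj_class)

lemma unimodular_const_term [simp]: "unimodular (const_term y) \<longleftrightarrow> unimodular y"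
  by (simp add: unimodular_fps unimodular_complex)

lemma homogeneous_weight: "homogeneous_snd F \<longleftrightarrow> (\<exists>d. \<forall>m\<in>Poly_Mapping.keys F. weight_snd m = d)"
  by (simp add: homogeneous_snd_def weight_snd_def)

lemma eval_scale_eq_0:
  assumes "homogeneous_snd F" "poly_eval h (coords l y) F = 0"
  shows "poly_eval h (coords l (u *s y)) F = 0"
proof -
  obtain d where d: "\<forall>m\<in>Poly_Mapping.keys F. weight_snd m = d"
    using assms(1) homogeneous_weight by blast
  show ?thesis unfolding poly_eval_scale[OF d] assms(2) by simp
qed

lemma eval_proj_class_0:
  assumes "homogeneous_snd F" "proj_class y = proj_class y'"
  shows "poly_eval h (coords l y) F = 0 \<longleftrightarrow> poly_eval h (coords l y') F = 0"
proof -
  obtain u where "y = u *s y'" using assms(2) by (rule proj_class_eqD)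
  moreover obtain v where "y' = v *s y" using assms(2)[symmetric] by (rule proj_class_eqD)
  ultimately show ?thesis using eval_scale_eq_0[OF assms(1)] by metis
qed

abbreviation basic_open :: "(6 + 4) cpoly \<Rightarrow> point set" where
  "basic_open F \<equiv> {(l, proj_class y) | l y. unimodular y \<and> poly_eval id (coords l y) F \<noteq> 0}"

lemma basic_open_iff:
  assumes "homogeneous_snd F"
  shows "(l, proj_class y) \<in> basic_open F \<longleftrightarrow> unimodular y \<and> poly_eval id (coords l y) F \<noteq> 0"
proof
  assume "(l, proj_class y) \<in> basic_open F"
  then obtain y' where "proj_class y = proj_class y'" "unimodular y'" "poly_eval id (coords l y') F \<noteq> 0"
    by blast
  then show "unimodular y \<and> poly_eval id (coords l y) F \<noteq> 0"
    using eval_proj_class_0[OF assms, of y y' id l] unimodular_proj_class[of y y'] by simp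
qed blast

lemma openin_basic_open: "homogeneous_snd F \<Longrightarrow> openin zariski_C6P3 (basic_open F)"
  unfolding zariski_C6P3_def by (rule topology_generated_by_Basis) blast

lemma topspace_C6P3: "topspace zariski_C6P3 = {(l, proj_class y) | l y. unimodular y}"
proof
  show "topspace zariski_C6P3 \<subseteq> {(l, proj_class y) | l y. unimodular y}"
    unfolding zariski_C6P3_def by auto
  have "homogeneous_snd (Poly_Mapping.single 0 1)"
    by (simp add: homogeneous_snd_def)
  from openin_subset[OF openin_basic_open[OF this]]
  show "{(l, proj_class y) | l y. unimodular y} \<subseteq> topspace zariski_C6P3"
    by (simp add: cplx.eval_single del: single_one)
qed

section \<open>Continuity of polynomial paths\<close>

text \<open>Continuity of a path at a point need only be tested on a subbasis, since the filter of
  almost all parameters is closed under finite intersections.\<close>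

lemma eventually_generated:
  assumes "openin (topology_generated_by \<B>) W" "\<gamma> t0 \<in> W"
    and "\<And>B. B \<in> \<B> \<Longrightarrow> \<gamma> t0 \<in> B \<Longrightarrow> eventually (\<lambda>t. \<gamma> t \<in> B) F"
  shows "eventually (\<lambda>t. \<gamma> t \<in> W) F"
  using openin_topology_generated_by[OF assms(1)] assms(2)
proof induct
  case (UN K)
  then obtain k where k: "k \<in> K" "\<gamma> t0 \<in> k" by blast
  with UN(2) have "eventually (\<lambda>t. \<gamma> t \<in> k) F" by blast
  then show ?case by (rule eventually_mono) (use k in blast)
qed (auto simp: eventually_conj_iff assms(3))

lemma zariski_path:
  assumes "openin (zariski_on S c) W" "\<gamma> t0 \<in> W"
    and "\<And>i. poly_path (\<lambda>t. c (\<gamma> t) i)" "eventually (\<lambda>t. \<gamma> t \<in> S) cofinite"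
  shows "eventually (\<lambda>t. \<gamma> t \<in> W) cofinite"
  using assms(1,2) unfolding zariski_on_def
proof (rule eventually_generated)
  fix B assume "B \<in> {{x \<in> S. poly_eval id (c x) F \<noteq> 0} |F. True}" "\<gamma> t0 \<in> B"
  then obtain F where F: "B = {x \<in> S. poly_eval id (c x) F \<noteq> 0}" "poly_eval id (c (\<gamma> t0)) F \<noteq> 0"
    by blast
  have "eventually (\<lambda>t. poly_eval id (c (\<gamma> t)) F \<noteq> 0) cofinite"
    using poly_path_nonzero[OF poly_path_eval[of "\<lambda>t. c (\<gamma> t)" F, OF assms(3)] F(2)] .
  then show "eventually (\<lambda>t. \<gamma> t \<in> B) cofinite"
    using assms(4) unfolding F(1) by eventually_elim simp
qed

lemma coords_poly_path:
  assumes "\<And>i. poly_path (\<lambda>t. l t $ i)" "\<And>j. poly_path (\<lambda>t. y t $ j)"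
  shows "poly_path (\<lambda>t. coords (l t) (y t) i)"
  by (cases i) (use assms in \<open>simp_all add: coords_def\<close>)

lemma coords_fps_path:
  assumes "\<And>i. fps_path (\<lambda>t. l t $ i)" "\<And>j. fps_path (\<lambda>t. y t $ j)"
  shows "fps_path (\<lambda>t. coords (l t) (y t) i)"
  by (cases i) (use assms in \<open>simp_all add: coords_def\<close>)

lemma C6P3_path:
  assumes "openin zariski_C6P3 W" "(l t0, proj_class (y t0)) \<in> W"
    and "\<And>i. poly_path (\<lambda>t. l t $ i)" "\<And>j. poly_path (\<lambda>t. y t $ j)"
  shows "eventually (\<lambda>t. (l t, proj_class (y t)) \<in> W) cofinite"
proof (rule eventually_generated[where \<gamma> = "\<lambda>t. (l t, proj_class (y t))"])
  show "openin (topology_generated_by {basic_open F | F. homogeneous_snd F}) W"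
    using assms(1) unfolding zariski_C6P3_def .
  show "(l t0, proj_class (y t0)) \<in> W" by fact
  fix B assume "B \<in> {basic_open F | F. homogeneous_snd F}" and t0: "(l t0, proj_class (y t0)) \<in> B"
  then obtain F where F: "homogeneous_snd F" "B = basic_open F" by blast
  with t0 have u: "unimodular (y t0)" and nz: "poly_eval id (coords (l t0) (y t0)) F \<noteq> 0"
    using basic_open_iff by blast+
  obtain j where "y t0 $ j \<noteq> 0" using u by (auto simp: unimodular_complex)
  from poly_path_nonzero[OF assms(4) this] have "eventually (\<lambda>t. unimodular (y t)) cofinite"
    by eventually_elim (auto simp: unimodular_complex)
  moreover have "eventually (\<lambda>t. poly_eval id (coords (l t) (y t)) F \<noteq> 0) cofinite"
    using poly_path_nonzero[OF poly_path_eval[of "\<lambda>t. coords (l t) (y t)", OF coords_poly_path] nz]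
      assms(3,4) by blast
  ultimately show "eventually (\<lambda>t. (l t, proj_class (y t)) \<in> B) cofinite"
    unfolding F(2) by eventually_elim (use basic_open_iff[OF F(1)] in blast)
qed

lemma fps_cutoff_mult_cutoff:
  "fps_cutoff n (u * fps_cutoff n f) = fps_cutoff n (u * f :: 'a::comm_ring_1 fps)"
  by (rule fps_ext) (auto simp: fps_mult_nth intro!: sum.cong)

lemma trunc_trunc [simp]: "trunc k (trunc k v) = trunc k v"
  by (simp add: trunc_def vec_eq_iff fps_eq_iff)

lemma unimodular_trunc [simp]: "unimodular (trunc k y) \<longleftrightarrow> unimodular y"
  by (simp add: trunc_def unimodular_fps)

lemma jet_trunc: "jet k (trunc k l, proj_class (trunc k y)) = jet k (l, proj_class y)"
proof -
  have "trunc k (u *s trunc k y) = trunc k (u *s y)" for u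
    by (simp add: trunc_def vec_eq_iff fps_cutoff_mult_cutoff)
  then have "trunc k ` proj_class (trunc k y) = trunc k ` proj_class y"
    unfolding proj_class_def setcompr_eq_image image_image by simp
  then show ?thesis by (simp add: jet_def)
qed

lemma arc_in_class_unimodular:
  assumes "arc_in (l, proj_class y) V" shows "unimodular y"
proof -
  obtain y' where "unimodular y'" "snd (l, proj_class y) = proj_class y'"
    using assms unfolding arc_in_def by blast
  then show ?thesis using unimodular_proj_class[of y y'] by simp
qed

lemma arc_unimodular: "(l, proj_class y) \<in> arcs \<Longrightarrow> unimodular y"
  unfolding arcs_def by (auto intro: arc_in_class_unimodular)

lemma trunc_in_cone_jets: "unimodular y \<Longrightarrow> (trunc k l, trunc k y) \<in> cone_jets k"
  by (simp add: cone_jets_def)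

lemma unimodular_path:
  assumes "\<And>j. fps_path (\<lambda>t. y t $ j)" "unimodular (y t0)"
  shows "eventually (\<lambda>t. unimodular (y t)) cofinite"
proof -
  obtain j where "fps_nth (y t0 $ j) 0 \<noteq> 0" using assms(2) by (auto simp: unimodular_fps)
  from fps_path_nonzero[OF assms(1) this] show ?thesis
    by eventually_elim (auto simp: unimodular_fps)
qed

text \<open>The topology of the arc space sees only finitely many Taylor coefficients at a time,
  and along a path each of these is a polynomial in the parameter. Jets are lifted to the affine cone,
  where the quotient topology is defined.\<close>

lemma arc_space_path:
  assumes "openin arc_space W" "(l t0, proj_class (y t0)) \<in> W"
    and l: "\<And>i. fps_path (\<lambda>t. l t $ i)" and y: "\<And>j. fps_path (\<lambda>t. y t $ j)"
    and arcs: "eventually (\<lambda>t. (l t, proj_class (y t)) \<in> arcs) cofinite"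
  shows "eventually (\<lambda>t. (l t, proj_class (y t)) \<in> W) cofinite"
proof (rule eventually_generated[where \<gamma> = "\<lambda>t. (l t, proj_class (y t))"])
  show "openin (topology_generated_by {{a \<in> arcs. jet k a \<in> U} | k U. openin (zariski_jets k) U}) W"
    using assms(1) unfolding arc_space_def .
  show "(l t0, proj_class (y t0)) \<in> W" by fact
  fix B assume "B \<in> {{a \<in> arcs. jet k a \<in> U} | k U. openin (zariski_jets k) U}"
    and t0: "(l t0, proj_class (y t0)) \<in> B"
  then obtain k U where U: "openin (zariski_jets k) U" and B: "B = {a \<in> arcs. jet k a \<in> U}" by blast
  let ?V = "{x \<in> cone_jets k. (\<lambda>(l, y). jet k (l, proj_class y)) x \<in> U}"
  let ?c = "\<lambda>(l, y) (i, n). fps_nth (coords l y i) n"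
  let ?g = "\<lambda>t. (trunc k (l t), trunc k (y t))"
  have open_V: "openin (zariski_on (cone_jets k) ?c) ?V"
    using U unfolding zariski_jets_def openin_quotient_topology by simp
  have u: "unimodular (y t0)" using t0 arc_unimodular unfolding B by blast
  have "eventually (\<lambda>t. ?g t \<in> ?V) cofinite"
  proof (rule zariski_path[OF open_V])
    show "?g t0 \<in> ?V"
      using t0 u by (simp add: B trunc_in_cone_jets jet_trunc)
    show "eventually (\<lambda>t. ?g t \<in> cone_jets k) cofinite"
      using unimodular_path[OF y u] by eventually_elim (rule trunc_in_cone_jets)
    fix i :: "(6 + 4) \<times> nat"
    obtain j n where i: "i = (j, n)" by (cases i)
    have cut: "poly_path (\<lambda>t. if n < Suc k then fps_nth (f t) n else 0)" if "fps_path f" for f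
      using that by (cases "n < Suc k") (simp_all add: fps_path_def)
    show "poly_path (\<lambda>t. ?c (?g t) i)"
      by (cases j) (use l y in \<open>simp_all add: i coords_def trunc_def cut\<close>)
  qed
  with arcs show "eventually (\<lambda>t. (l t, proj_class (y t)) \<in> B) cofinite"
    by eventually_elim (simp add: B jet_trunc)
qed

section \<open>Irreducible sets\<close>

lemma irreducible_closure:
  assumes "irreducible_in X S" shows "irreducible_in X (X closure_of S)"
  unfolding irreducible_in_def
proof (intro conjI allI impI)
  show "X closure_of S \<subseteq> topspace X" by (rule closure_of_subset_topspace)
  have S: "S \<subseteq> X closure_of S" using assms by (simp add: irreducible_in_def closure_of_subset)
  then show "X closure_of S \<noteq> {}" using assms by (auto simp: irreducible_in_def)
  fix C D assume CD: "closedin X C \<and> closedin X D \<and> X closure_of S \<subseteq> C \<union> D"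
  then have "S \<subseteq> C \<union> D" using S by blast
  then have "S \<subseteq> C \<or> S \<subseteq> D"
    using assms CD unfolding irreducible_in_def by blast
  then show "X closure_of S \<subseteq> C \<or> X closure_of S \<subseteq> D"
    using closure_of_minimal[of S _ X] CD by blast
qed

text \<open>An irreducible \<open>T\<close> containing the open set \<open>U\<close> is contained in its closure: otherwise
  the closure of \<open>U\<close> and the complement of \<open>U\<close> would split \<open>T\<close>.\<close>

lemma open_irreducible_component:
  assumes "openin X U" "irreducible_in X U"
  shows "X closure_of U \<in> irreducible_components_of X"
  unfolding irreducible_components_of_def
proof (intro CollectI conjI allI impI)
  show "irreducible_in X (X closure_of U)" by (rule irreducible_closure) fact
  fix T assume T: "irreducible_in X T \<and> X closure_of U \<subseteq> T"
  have U: "U \<subseteq> X closure_of U" "U \<noteq> {}"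
    using assms(2) by (simp_all add: irreducible_in_def closure_of_subset)
  have "closedin X (X closure_of U)" "closedin X (topspace X - U)"
    using assms(1) by auto
  moreover have "T \<subseteq> X closure_of U \<union> (topspace X - U)"
    using T U by (auto simp: irreducible_in_def)
  ultimately have "T \<subseteq> X closure_of U \<or> T \<subseteq> topspace X - U"
    using T unfolding irreducible_in_def by (elim conjE) (drule spec2, erule mp, blast)
  moreover have "\<not> T \<subseteq> topspace X - U" using T U by auto
  ultimately show "T = X closure_of U" using T by (simp add: subset_antisym)
qed

section \<open>Arcs in the blowup\<close>

text \<open>The generators of the Bautin ideal as polynomials over any ring: they are evaluated at
  points, at arcs, and at truncated arcs, which are vectors of polynomials.\<close>

definition bautin_gen :: "'r::comm_ring_1 ^ 6 \<Rightarrow> 'r ^ 4" where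
  "bautin_gen l = vector
     [l$1,
      l$5 * (l$3 - l$6),
      l$2 * l$4 * (l$3 - l$6) * (l$4 + 5 * l$3 - 5 * l$6),
      l$2 * l$4 * (l$3 - l$6)^2 * (l$3 * l$6 - 2 * (l$6)^2 - (l$2)^2)]"

lemma bautin_gen_complex: "bautin_gen = bautin"
  by (rule ext) (simp add: bautin_gen_def bautin_def)

lemma vector_4 [simp]:
  "(vector [a, b, c, d] :: 'a::zero ^ 4) $ 1 = a" "(vector [a, b, c, d] :: 'a ^ 4) $ 2 = b"
  "(vector [a, b, c, d] :: 'a ^ 4) $ 3 = c" "(vector [a, b, c, d] :: 'a ^ 4) $ 4 = d"
  unfolding vector_def by simp_all

lemma bautin_gen_rel:
  assumes z: "R 0 0" and num: "\<And>n. R (numeral n) (numeral n)"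
    and add: "\<And>a b a' b'. R a a' \<Longrightarrow> R b b' \<Longrightarrow> R (a + b) (a' + b')"
    and diff: "\<And>a b a' b'. R a a' \<Longrightarrow> R b b' \<Longrightarrow> R (a - b) (a' - b')"
    and mul: "\<And>a b a' b'. R a a' \<Longrightarrow> R b b' \<Longrightarrow> R (a * b) (a' * b')"
    and x: "\<And>i. R (x $ i) (x' $ i)"
  shows "R (bautin_gen x $ j) (bautin_gen x' $ j)"
proof -
  have "\<forall>j. R (bautin_gen x $ j) (bautin_gen x' $ j)"
    unfolding forall_4 bautin_gen_def vector_4 power2_eq_square
    by (intro conjI mul add diff x num)
  then show ?thesis ..
qed

lemma const_term_bautin: "const_term (bautin_gen l) = bautin (const_term l)"
proof -
  have "fps_nth (bautin_gen l $ j) 0 = bautin_gen (const_term l) $ j" for j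
    by (rule bautin_gen_rel[where R = "\<lambda>f s. fps_nth f 0 = s"]) (auto simp: numeral_fps_const)
  then show ?thesis by (simp add: vec_eq_iff bautin_gen_complex)
qed

definition graph :: "point set" where
  "graph = {(l, proj_class (bautin l)) | l. l \<notin> center_set}"

lemma graph_subset_blowup: "graph \<subseteq> blowup"
proof -
  have "graph \<subseteq> topspace zariski_C6P3"
    by (auto simp: graph_def topspace_C6P3 center_set_def unimodular_complex)
  then show ?thesis by (simp add: blowup_def graph_def closure_of_subset)
qed

lemma closedin_blowup: "closedin zariski_C6P3 blowup"
  by (simp add: blowup_def)

lemma blowup_cases:
  assumes "z \<in> blowup"
  obtains l y where "z = (l, proj_class y)" "unimodular y"
  using assms closedin_subset[OF closedin_blowup] topspace_C6P3 by blast

definition vanishes_on :: "(6 + 4) cpoly \<Rightarrow> point set \<Rightarrow> bool" where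
  "vanishes_on F V \<longleftrightarrow> (\<forall>(l, P)\<in>V. \<forall>z\<in>P. poly_eval id (coords l z) F = 0)"

lemma vanishes_onD:
  "vanishes_on F V \<Longrightarrow> (l, proj_class y) \<in> V \<Longrightarrow> poly_eval id (coords l y) F = 0"
  unfolding vanishes_on_def using self_in_proj_class by fastforce

text \<open>The blowup is the closure of the graph, so it satisfies the homogeneous equations of
  the graph.\<close>

lemma vanishes_on_graph_blowup:
  assumes F: "homogeneous_snd F" and "\<And>l. l \<notin> center_set \<Longrightarrow> poly_eval id (coords l (bautin l)) F = 0"
  shows "vanishes_on F blowup"
proof -
  have "blowup \<inter> basic_open F = {}"
  proof (rule ccontr)
    assume "blowup \<inter> basic_open F \<noteq> {}"
    then have "graph \<inter> basic_open F \<noteq> {}"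
      using openin_Int_closure_of_eq_empty[OF openin_basic_open[OF F], of graph]
      unfolding blowup_def graph_def by blast
    then obtain l where "l \<notin> center_set" "(l, proj_class (bautin l)) \<in> basic_open F"
      unfolding graph_def by blast
    then show False using basic_open_iff[OF F] assms(2) by blast
  qed
  moreover have "poly_eval id (coords l z) F = 0" if "(l, P) \<in> blowup" "z \<in> P" for l P z
  proof -
    obtain y where y: "P = proj_class y" "unimodular y"
      using \<open>(l, P) \<in> blowup\<close> blowup_cases by (metis Pair_inject)
    then obtain u where u: "z = u *s y" using \<open>z \<in> P\<close> by (auto simp: proj_class_def)
    have "poly_eval id (coords l y) F = 0"
      using calculation basic_open_iff[OF F, of l y] y that by blast
    then show ?thesis unfolding u by (rule eval_scale_eq_0[OF F])
  qed
  ultimately show ?thesis unfolding vanishes_on_def by blast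
qed

lemma arc_in_iff:
  assumes "unimodular y"
  shows "arc_in (l, proj_class y) V \<longleftrightarrow>
    (\<forall>F. homogeneous_snd F \<and> vanishes_on F V \<longrightarrow> poly_eval fps_const (coords l y) F = 0)"
proof -
  have "(\<forall>z\<in>proj_class y. poly_eval fps_const (coords l z) F = 0) \<longleftrightarrow>
      poly_eval fps_const (coords l y) F = 0" if "homogeneous_snd F" for F
  proof
    assume "poly_eval fps_const (coords l y) F = 0"
    then have "poly_eval fps_const (coords l (u *s y)) F = 0" for u
      by (rule eval_scale_eq_0[OF that])
    then show "\<forall>z\<in>proj_class y. poly_eval fps_const (coords l z) F = 0"
      by (auto simp: proj_class_def)
  qed (use self_in_proj_class in blast)
  moreover have "\<exists>y'. unimodular y' \<and> snd (l, proj_class y) = proj_class y'" using assms by auto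
  ultimately show ?thesis unfolding arc_in_def vanishes_on_def by (simp cong: imp_cong)
qed

lemma arcs_iff:
  assumes "unimodular y"
  shows "(l, proj_class y) \<in> arcs \<longleftrightarrow>
    (\<forall>F. homogeneous_snd F \<and> vanishes_on F blowup \<longrightarrow> poly_eval fps_const (coords l y) F = 0) \<and>
    (const_term l, proj_class (const_term y)) \<in> blowup \<and> const_term l \<in> center_set"
  using arc_in_iff[OF assms] by (auto simp: arcs_def exc_divisor_def)

lemma arc_cases:
  assumes "a \<in> arcs"
  obtains l y where "a = (l, proj_class y)" "unimodular y"
proof -
  obtain y where "unimodular y" "snd a = proj_class y"
    using assms unfolding arcs_def arc_in_def by blast
  then show ?thesis using that[of "fst a" y] by (cases a) simp
qed

text \<open>Each condition defining \<^const>\<open>arcs\<close> is the vanishing of polynomials in the Taylor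
  coefficients, or membership of the centre in a closed set; both persist at a missing parameter.\<close>

lemma limit_arc:
  assumes l: "\<And>i. fps_path (\<lambda>t. l t $ i)" and y: "\<And>j. fps_path (\<lambda>t. y t $ j)"
    and arcs: "eventually (\<lambda>t. (l t, proj_class (y t)) \<in> arcs) cofinite"
    and u: "unimodular (y t0)"
  shows "(l t0, proj_class (y t0)) \<in> arcs"
proof -
  have arcs': "eventually (\<lambda>t. unimodular (y t) \<and> (l t, proj_class (y t)) \<in> arcs) cofinite"
    using arcs by eventually_elim (simp add: arc_unimodular)
  have "poly_eval fps_const (coords (l t0) (y t0)) F = 0"
    if "homogeneous_snd F" "vanishes_on F blowup" for F
  proof (rule fps_ext)
    fix n
    have path: "poly_path (\<lambda>t. fps_nth (poly_eval fps_const (coords (l t) (y t)) F) n)"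
      using fps_pathD[OF fps_path_eval[of "\<lambda>t. coords (l t) (y t)", OF coords_fps_path]] l y by blast
    have "eventually (\<lambda>t. fps_nth (poly_eval fps_const (coords (l t) (y t)) F) n = 0) cofinite"
      using arcs' by eventually_elim (use that arcs_iff in auto)
    then show "fps_nth (poly_eval fps_const (coords (l t0) (y t0)) F) n = fps_nth 0 n"
      using poly_path_zero[OF path] by simp
  qed
  moreover have "(const_term (l t0), proj_class (const_term (y t0))) \<in> blowup"
  proof (rule ccontr)
    let ?W = "topspace zariski_C6P3 - blowup"
    assume "(const_term (l t0), proj_class (const_term (y t0))) \<notin> blowup"
    then have "(const_term (l t0), proj_class (const_term (y t0))) \<in> ?W"
      using u unfolding topspace_C6P3 by (auto simp: unimodular_const_term)
    moreover have "openin zariski_C6P3 ?W" using closedin_blowup by blast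
    ultimately have "eventually (\<lambda>t. (const_term (l t), proj_class (const_term (y t))) \<in> ?W) cofinite"
      by (intro C6P3_path[where l = "\<lambda>t. const_term (l t)" and y = "\<lambda>t. const_term (y t)"])
         (use l y in \<open>auto simp: fps_path_def\<close>)
    with arcs' have "eventually (\<lambda>t::complex. False) cofinite"
      by eventually_elim (use arcs_iff in auto)
    then show False by (simp add: infinite_UNIV_char_0)
  qed
  moreover have "bautin (const_term (l t0)) $ j = 0" for j
  proof -
    have "\<forall>j. poly_path (\<lambda>t. bautin (const_term (l t)) $ j)"
      unfolding forall_4 bautin_def vector_4 using l by (auto simp: fps_path_def)
    moreover have "eventually (\<lambda>t. bautin (const_term (l t)) $ j = 0) cofinite"
      using arcs' by eventually_elim (use arcs_iff in \<open>auto simp: center_set_def\<close>)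
    ultimately show ?thesis
      using poly_path_zero[of "\<lambda>t. bautin (const_term (l t)) $ j" t0] by blast
  qed
  ultimately show ?thesis using arcs_iff[OF u] by (simp add: center_set_def)
qed

text \<open>This relation is stable under ring operations, since the coefficients of a product up
  to degree \<open>N\<close> involve only those of the factors up to degree \<open>N\<close>.\<close>

definition agree :: "nat \<Rightarrow> complex fps \<Rightarrow> complex poly \<Rightarrow> bool" where
  "agree N f P \<longleftrightarrow> (\<forall>n\<le>N. fps_nth f n = coeff P n)"

lemma agree_mult: "agree N f P \<Longrightarrow> agree N g Q \<Longrightarrow> agree N (f * g) (P * Q)"
  by (auto simp: agree_def fps_mult_nth coeff_mult atLeast0AtMost intro!: sum.cong)

lemma agree_add: "agree N f P \<Longrightarrow> agree N g Q \<Longrightarrow> agree N (f + g) (P + Q)"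
  by (simp add: agree_def)

lemma agree_diff: "agree N f P \<Longrightarrow> agree N g Q \<Longrightarrow> agree N (f - g) (P - Q)"
  by (simp add: agree_def)

lemma agree_const: "agree N (fps_const c) [:c:]"
  by (auto simp: agree_def coeff_pCons split: nat.split)

lemma agree_0: "agree N 0 0" and agree_1: "agree N 1 1"
  using agree_const[of N 0] agree_const[of N 1] by (simp_all add: one_pCons)

lemma agree_numeral: "agree N (numeral n) (numeral n)"
  using agree_const[of N "numeral n"] by (simp add: numeral_fps_const numeral_poly)

lemma eval_poly_hom:
  "poly (poly_eval (\<lambda>c. [:c:]) P F) z = poly_eval id (\<lambda>i. poly (P i) z) F"
  by (rule poly_eval_rel[where R = "\<lambda>p s. poly p z = s"]) auto

lemma bautin_poly_hom:
  "poly (bautin_gen L $ j) z = bautin (\<chi> i. poly (L $ i) z) $ j"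
  unfolding bautin_gen_complex[symmetric]
  by (rule bautin_gen_rel[where R = "\<lambda>p s. poly p z = s"]) (auto)

text \<open>The power series of an arc need not converge, so its points cannot be used. Its
  truncations \<open>p N\<close> are polynomial curves; for large \<open>N\<close> almost all of their points are off the
  centre and lift to the graph. An equation of the blowup thus vanishes on these curves, and
  comparing coefficients up to degree \<open>N\<close> it vanishes on the arc. The lifted curves also meet every
  neighbourhood of the centre of the arc, whose second component is the limit of \<open>v / H\<close>.\<close>

lemma nondegenerate_arc_in_blowup:
  fixes l :: "complex fps ^ 6" and y :: "complex fps ^ 4"
  assumes u: "unimodular y" and H: "H \<noteq> 0" and v: "bautin_gen l = H *s y"
  shows "\<And>F. homogeneous_snd F \<Longrightarrow> vanishes_on F blowup \<Longrightarrow> poly_eval fps_const (coords l y) F = 0"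
    and "(const_term l, proj_class (const_term y)) \<in> blowup"
proof -
  define L where "L N = (\<chi> i. truncate_fps (Suc N) (l $ i))" for N
  define p where "p N z = (\<chi> i. poly (L N $ i) z)" for N z
  define FL where "FL F N = poly_eval (\<lambda>c. [:c:]) (coords (L N) (bautin_gen (L N))) F" for F N
  have L: "agree N (l $ i) (L N $ i)" for N i
    by (simp add: agree_def L_def coeff_truncate_fps)
  have vL: "agree N (bautin_gen l $ j) (bautin_gen (L N) $ j)" for N j
    by (rule bautin_gen_rel) (intro L agree_0 agree_add agree_diff agree_mult agree_numeral; assumption)+
  have FL: "agree N (poly_eval fps_const (coords l (bautin_gen l)) F) (FL F N)" for N F
    unfolding FL_def
  proof (rule poly_eval_rel)
    show "agree N (coords l (bautin_gen l) i) (coords (L N) (bautin_gen (L N)) i)" for i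
      by (cases i) (simp_all add: coords_def L vL)
  qed (rule agree_0 agree_1 agree_const agree_add agree_mult; assumption?)+
  have FLp: "poly (FL F N) z = poly_eval id (coords (p N z) (bautin (p N z))) F" for F N z
  proof -
    have "(\<lambda>i. poly (coords (L N) (bautin_gen (L N)) i) z) = coords (p N z) (bautin (p N z))"
      by (rule ext) (simp add: coords_def p_def bautin_poly_hom split: sum.split)
    then show ?thesis by (simp add: FL_def eval_poly_hom)
  qed
  have coeff_ev: "eventually (\<lambda>z. poly P z \<noteq> 0) cofinite" if "coeff P n \<noteq> 0" for P :: "complex poly" and n
  proof -
    have "P \<noteq> 0" using that by auto
    then show ?thesis by (simp add: eventually_cofinite poly_roots_finite)
  qed
  obtain j0 where "fps_nth (y $ j0) 0 \<noteq> 0" using u by (auto simp: unimodular_fps)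
  then have "bautin_gen l $ j0 \<noteq> 0" using H v by auto
  then obtain n0 where n0: "fps_nth (bautin_gen l $ j0) n0 \<noteq> 0" by (auto simp: fps_eq_iff)
  have generic: "eventually (\<lambda>z. p N z \<notin> center_set) cofinite" if "n0 \<le> N" for N
  proof -
    have "coeff (bautin_gen (L N) $ j0) n0 \<noteq> 0" using vL[of N j0] n0 that by (auto simp: agree_def)
    from coeff_ev[OF this] show ?thesis
      by eventually_elim (auto simp: center_set_def p_def bautin_poly_hom)
  qed
  show "poly_eval fps_const (coords l y) F = 0"
    if F: "homogeneous_snd F" and van: "vanishes_on F blowup" for F
  proof -
    obtain d where d: "\<forall>m\<in>Poly_Mapping.keys F. weight_snd m = d"
      using F homogeneous_weight by blast
    have "fps_nth (poly_eval fps_const (coords l (bautin_gen l)) F) n = 0" for n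
    proof -
      let ?N = "max n n0"
      have "eventually (\<lambda>z. poly (FL F ?N) z = 0) cofinite"
        using generic[of ?N, simplified]
      proof eventually_elim
        case (elim z)
        then have "(p ?N z, proj_class (bautin (p ?N z))) \<in> blowup"
          using graph_subset_blowup unfolding graph_def by blast
        then show ?case unfolding FLp by (rule vanishes_onD[OF van])
      qed
      then have "coeff (FL F ?N) n = 0"
        using coeff_ev[of "FL F ?N" n] eventually_conj[of _ cofinite]
          eventually_False[of "cofinite::complex filter"]
        by (force simp: infinite_UNIV_char_0 elim: eventually_mono)
      then show ?thesis using FL[of ?N F] by (auto simp: agree_def)
    qed
    then have "poly_eval fps_const (coords l (bautin_gen l)) F = 0" by (simp add: fps_eq_iff)
    then show ?thesis using H unfolding v poly_eval_scale[OF d] by simp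
  qed
  have "\<exists>N0. \<forall>N\<ge>N0. eventually (\<lambda>z. (p N z, proj_class (bautin (p N z))) \<in> W) cofinite"
    if "openin zariski_C6P3 W" "(const_term l, proj_class (const_term y)) \<in> W" for W
    using openin_topology_generated_by[OF that(1)[unfolded zariski_C6P3_def]] that(2)
  proof induct
    case (Int W1 W2)
    then obtain N1 N2 where
      "\<forall>N\<ge>N1. eventually (\<lambda>z. (p N z, proj_class (bautin (p N z))) \<in> W1) cofinite"
      "\<forall>N\<ge>N2. eventually (\<lambda>z. (p N z, proj_class (bautin (p N z))) \<in> W2) cofinite" by blast
    then show ?case by (intro exI[of _ "max N1 N2"]) (auto intro: eventually_conj)
  next
    case (UN K)
    then obtain k N0 where k: "k \<in> K"
      "\<forall>N\<ge>N0. eventually (\<lambda>z. (p N z, proj_class (bautin (p N z))) \<in> k) cofinite" by blast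
    then show ?case by (intro exI[of _ N0] allI impI) (rule eventually_mono, blast, blast)
  next
    case (Basis W)
    then obtain F where F: "homogeneous_snd F" and W: "W = basic_open F" by blast
    obtain d where d: "\<forall>m\<in>Poly_Mapping.keys F. weight_snd m = d"
      using F homogeneous_weight by blast
    have "poly_eval id (coords (const_term l) (const_term y)) F \<noteq> 0"
      using Basis(2) basic_open_iff[OF F] unfolding W by blast
    moreover have "fps_nth (poly_eval fps_const (coords l y) F) 0 =
        poly_eval id (coords (const_term l) (const_term y)) F"
    proof (rule poly_eval_rel[where R = "\<lambda>f s. fps_nth f 0 = s"])
      show "fps_nth (coords l y i) 0 = coords (const_term l) (const_term y) i" for i
        by (cases i) (simp_all add: coords_def)
    qed auto
    ultimately have "poly_eval fps_const (coords l y) F \<noteq> 0" by auto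
    then have "poly_eval fps_const (coords l (bautin_gen l)) F \<noteq> 0"
      using H unfolding v poly_eval_scale[OF d] by simp
    then obtain n where n: "fps_nth (poly_eval fps_const (coords l (bautin_gen l)) F) n \<noteq> 0"
      by (auto simp: fps_eq_iff)
    show ?case
    proof (intro exI[of _ "max n n0"] allI impI)
      fix N assume N: "max n n0 \<le> N"
      have "coeff (FL F N) n \<noteq> 0" using FL[of N F] n N by (auto simp: agree_def)
      have "n0 \<le> N" using N by simp
      from coeff_ev[OF \<open>coeff (FL F N) n \<noteq> 0\<close>] generic[OF this]
      show "eventually (\<lambda>z. (p N z, proj_class (bautin (p N z))) \<in> W) cofinite"
      proof eventually_elim
        case (elim z)
        then have "unimodular (bautin (p N z))" by (auto simp: center_set_def unimodular_complex)
        then show ?case using elim unfolding W FLp by (subst basic_open_iff[OF F]) blast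
      qed
    qed
  qed simp
  note near = this
  show "(const_term l, proj_class (const_term y)) \<in> blowup"
    unfolding blowup_def in_closure_of
  proof (intro conjI allI impI)
    show "(const_term l, proj_class (const_term y)) \<in> topspace zariski_C6P3"
      unfolding topspace_C6P3 using u by (auto simp: unimodular_const_term)
    fix W assume "(const_term l, proj_class (const_term y)) \<in> W \<and> openin zariski_C6P3 W"
    then obtain N0 where N0: "\<forall>N\<ge>N0. eventually (\<lambda>z. (p N z, proj_class (bautin (p N z))) \<in> W) cofinite"
      using near by blast
    let ?N = "max N0 n0"
    have "eventually (\<lambda>z. (p ?N z, proj_class (bautin (p ?N z))) \<in> W \<and> p ?N z \<notin> center_set) cofinite"
      using N0 generic[of ?N] by (auto intro: eventually_conj)
    then obtain z where "(p ?N z, proj_class (bautin (p ?N z))) \<in> W" "p ?N z \<notin> center_set"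
      using eventually_happens[of _ "cofinite :: complex filter"] by (auto simp: infinite_UNIV_char_0)
    then show "\<exists>z. z \<in> {(l, proj_class (bautin l)) |l. l \<notin> center_set} \<and> z \<in> W" by blast
  qed
qed

lemma nondegenerate_arc:
  assumes u: "unimodular y" and H: "H \<noteq> 0" "fps_nth H 0 = 0" and v: "bautin_gen l = H *s y"
  shows "(l, proj_class y) \<in> arcs"
proof -
  have "bautin (const_term l) = 0"
    unfolding const_term_bautin[symmetric] v by (simp add: vec_eq_iff H)
  then show ?thesis
    using arcs_iff[OF u] nondegenerate_arc_in_blowup[OF u H(1) v] by (simp add: center_set_def)
qed

text \<open>Equations of the graph hold along every arc, including arcs inside the exceptional
  divisor; this is where syzygies of the generators enter.\<close>

lemma arc_equation:
  assumes "(l, proj_class y) \<in> arcs" "hpoly d e e'"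
    and "\<And>l. e l (bautin l) = 0"
  shows "e' l y = 0"
proof -
  obtain F where F: "\<forall>m\<in>Poly_Mapping.keys F. weight_snd m = d"
      "\<forall>l y. poly_eval id (coords l y) F = e l y" "\<forall>l y. poly_eval fps_const (coords l y) F = e' l y"
    using assms(2) unfolding hpoly_def by blast
  have h: "homogeneous_snd F" using F(1) homogeneous_weight by blast
  have "vanishes_on F blowup" by (rule vanishes_on_graph_blowup[OF h]) (simp add: F assms(3))
  then have "poly_eval fps_const (coords l y) F = 0"
    using assms(1) h arcs_iff[OF arc_unimodular[OF assms(1)]] by blast
  then show ?thesis by (simp add: F)
qed

text \<open>Constant arcs reduce statements about points of the exceptional divisor to statements
  about arcs.\<close>

lemma constant_arc:
  assumes "(l, proj_class y) \<in> exc_divisor"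
  shows "((\<chi> i. fps_const (l $ i)), proj_class (\<chi> j. fps_const (y $ j))) \<in> arcs"
proof -
  let ?l = "\<chi> i. fps_const (l $ i)" and ?y = "\<chi> j. fps_const (y $ j)"
  have c: "const_term ?l = l" "const_term ?y = y" by (simp_all add: vec_eq_iff)
  have b: "(l, proj_class y) \<in> blowup" "l \<in> center_set" using assms by (simp_all add: exc_divisor_def)
  then have "unimodular y" using blowup_cases unimodular_proj_class by (metis Pair_inject)
  then have u: "unimodular ?y" using unimodular_const_term[of ?y] by (simp add: c)
  have "poly_eval fps_const (coords ?l ?y) F = fps_const (poly_eval id (coords l y) F)" for F
  proof (rule poly_eval_rel[where R = "\<lambda>f s. f = fps_const s"])
    show "coords ?l ?y i = fps_const (coords l y i)" for i
      by (cases i) (simp_all add: coords_def)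
  qed auto
  then show ?thesis using arcs_iff[OF u] b c vanishes_onD by auto
qed

section \<open>The topology of the arc space\<close>

lemma jet_in_cone_image:
  assumes "a \<in> arcs"
  shows "jet k a \<in> (\<lambda>(l, y). jet k (l, proj_class y)) ` cone_jets k"
proof -
  obtain l y where a: "a = (l, proj_class y)" "unimodular y" using assms by (rule arc_cases)
  show ?thesis
    using imageI[OF trunc_in_cone_jets[OF a(2), of k l], of "\<lambda>(l, y). jet k (l, proj_class y)"]
    by (simp add: jet_trunc a)
qed

lemma topspace_arc_space [simp]: "topspace arc_space = arcs"
proof
  show "topspace arc_space \<subseteq> arcs" unfolding arc_space_def by auto
  have "jet 0 a \<in> topspace (zariski_jets 0)" if a: "a \<in> arcs" for a
  proof -
    let ?J = "\<lambda>(l, y). jet 0 (l, proj_class y)"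
    have top: "openin (zariski_jets 0) (?J ` cone_jets 0)"
      unfolding zariski_jets_def openin_quotient_topology
      using openin_topspace[of "zariski_on (cone_jets 0) (\<lambda>(l, y) (i, n). fps_nth (coords l y i) n)"]
      by (auto elim!: back_subst[of "openin _"])
    have "jet 0 a \<in> ?J ` cone_jets 0" using a by (rule jet_in_cone_image)
    then show ?thesis using openin_subset[OF top] by blast
  qed
  moreover have "openin arc_space {a \<in> arcs. jet 0 a \<in> topspace (zariski_jets 0)}"
    unfolding arc_space_def by (rule topology_generated_by_Basis) auto
  ultimately show "arcs \<subseteq> topspace arc_space"
    using openin_subset by blast
qed

lemma polyfun_eval:
  assumes "\<And>i. polyfun c (\<lambda>p. x p i)"
  shows "polyfun c (\<lambda>p. poly_eval id (x p) F)"
proof -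
  obtain X where X: "\<And>i p. poly_eval id (c p) (X i) = x p i"
    using assms unfolding polyfun_def by metis
  have "poly_eval id (c p) (poly_eval (\<lambda>a. Poly_Mapping.single 0 a) X F) = poly_eval id (x p) F" for p
    by (rule poly_eval_rel[where R = "\<lambda>G s. poly_eval id (c p) G = s"])
       (auto simp: X cplx.eval_add cplx.eval_mult cplx.eval_single simp flip: single_one)
  then show ?thesis unfolding polyfun_def by blast
qed

lemma hpoly_center_iff:
  assumes "hpoly d e e'"
  shows "(\<forall>z\<in>proj_class y. e l z \<noteq> 0) \<longleftrightarrow> e l y \<noteq> (0 :: complex)"
proof -
  obtain F where F: "\<forall>m\<in>Poly_Mapping.keys F. weight_snd m = d"
      "\<forall>l y. poly_eval id (coords l y) F = e l y"
    using assms unfolding hpoly_def by blast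
  have "e l (u *s y) = u ^ d * e l y" for u
    using poly_eval_scale[OF F(1), of id l u y] F(2) by simp
  then show ?thesis using self_in_proj_class[of y]
    by (auto simp: proj_class_def dvd_field_iff)
qed

text \<open>The centre of an arc depends continuously on the arc, already on its \<open>0\<close>-jet.\<close>

lemma open_arcs_center:
  assumes h: "hpoly d e e'"
  shows "openin arc_space {a \<in> arcs. \<forall>z\<in>snd (arc_center a). e (fst (arc_center a)) z \<noteq> 0}"
proof -
  let ?J = "\<lambda>(l, y). jet 0 (l, proj_class y)"
  let ?c = "\<lambda>(l, y) (i, n). fps_nth (coords l y i) n"
  define good where "good a \<longleftrightarrow> (\<forall>z\<in>snd (arc_center a). e (fst (arc_center a)) z \<noteq> 0)" for a
  have good: "good (l, proj_class y) \<longleftrightarrow> e (const_term l) (const_term y) \<noteq> 0" for l y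
    using hpoly_center_iff[OF h] by (simp add: good_def)
  have ct: "const_term (trunc k v) = const_term v" for k and v :: "complex fps ^ 'n"
    by (simp add: vec_eq_iff trunc_def)
  have center_jet: "arc_center (jet 0 a) = arc_center a" for a
    by (simp add: arc_center_def jet_def ct image_image)
  then have good_jet: "good (jet 0 a) \<longleftrightarrow> good a" for a by (simp add: good_def)
  let ?U = "{j \<in> ?J ` cone_jets 0. good j}"
  obtain F where F: "\<forall>l y. poly_eval id (coords l y) F = e l y"
    using h unfolding hpoly_def by blast
  have "polyfun ?c (\<lambda>ly. poly_eval id (\<lambda>i. ?c ly (i, 0)) F)"
    by (rule polyfun_eval) (rule polyfun_coord)
  moreover have "poly_eval id (\<lambda>i. ?c (l, y) (i, 0)) F = e (const_term l) (const_term y)" for l y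
  proof -
    have "(\<lambda>i. ?c (l, y) (i, 0)) = coords (const_term l) (const_term y)"
      by (rule ext) (simp add: coords_def split: sum.split)
    then show ?thesis by (simp only: F)
  qed
  then have "poly_eval id (\<lambda>i. ?c ly (i, 0)) F = e (const_term (fst ly)) (const_term (snd ly))" for ly
    by (cases ly) (simp only: fst_conv snd_conv)
  ultimately have "polyfun ?c (\<lambda>ly. e (const_term (fst ly)) (const_term (snd ly)))" by simp
  from zariski_open[OF this, of "cone_jets 0"]
  have "openin (zariski_on (cone_jets 0) ?c) {ly \<in> cone_jets 0. e (const_term (fst ly)) (const_term (snd ly)) \<noteq> 0}" .
  moreover have "{ly \<in> cone_jets 0. e (const_term (fst ly)) (const_term (snd ly)) \<noteq> 0} =
      {ly \<in> cone_jets 0. ?J ly \<in> ?U}"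
  proof -
    have U: "?J ly \<in> ?U \<longleftrightarrow> good (?J ly)" if "ly \<in> cone_jets 0" for ly using that by blast
    have "good (?J ly) \<longleftrightarrow> e (const_term (fst ly)) (const_term (snd ly)) \<noteq> 0" for ly
      by (cases ly) (simp add: good_jet good)
    with U show ?thesis by (intro Collect_cong conj_cong refl) simp
  qed
  ultimately have "openin (zariski_jets 0) ?U"
    unfolding zariski_jets_def openin_quotient_topology by auto
  then have "openin arc_space {a \<in> arcs. jet 0 a \<in> ?U}"
    unfolding arc_space_def by (intro topology_generated_by_Basis) blast
  moreover have "{a \<in> arcs. jet 0 a \<in> ?U} = {a \<in> arcs. good a}"
    using jet_in_cone_image[of _ 0] by (intro Collect_cong conj_cong refl) (simp add: good_jet)
  ultimately show ?thesis by (simp add: good_def)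
qed

lemma open_arcs_center_fst:
  assumes "hpoly 0 (\<lambda>l y. e l) e'"
  shows "openin arc_space {a \<in> arcs. e (fst (arc_center a)) \<noteq> 0}"
proof -
  have "snd (arc_center a) \<noteq> {}" if "a \<in> arcs" for a
    using arc_cases[OF that] self_in_proj_class by (metis arc_center_class empty_iff snd_conv)
  then have "{a \<in> arcs. \<forall>z\<in>snd (arc_center a). e (fst (arc_center a)) \<noteq> 0} =
      {a \<in> arcs. e (fst (arc_center a)) \<noteq> 0}" by blast
  then show ?thesis using open_arcs_center[OF assms] by simp
qed

definition arc_path :: "(complex \<Rightarrow> arc) \<Rightarrow> bool" where
  "arc_path \<gamma> \<longleftrightarrow> (\<exists>l y. (\<forall>i. fps_path (\<lambda>t. l t $ i)) \<and> (\<forall>j. fps_path (\<lambda>t. y t $ j)) \<and>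
     (\<forall>t. \<gamma> t = (l t, proj_class (y t))))"

text \<open>A polynomial path is a continuous map from the cofinite topology, in which the line is
  irreducible. Hence a set of arcs is irreducible when any two members are joined by a path.\<close>

lemma irreducible_by_paths:
  assumes S: "S \<subseteq> arcs" "S \<noteq> {}"
    and join: "\<And>\<alpha> \<beta>. \<alpha> \<in> S \<Longrightarrow> \<beta> \<in> S \<Longrightarrow>
      \<exists>\<gamma>. arc_path \<gamma> \<and> \<gamma> 0 = \<alpha> \<and> \<gamma> 1 = \<beta> \<and> eventually (\<lambda>t. \<gamma> t \<in> S) cofinite"
  shows "irreducible_in arc_space S"
  unfolding irreducible_in_def
proof (intro conjI allI impI)
  fix C D assume CD: "closedin arc_space C \<and> closedin arc_space D \<and> S \<subseteq> C \<union> D"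
  show "S \<subseteq> C \<or> S \<subseteq> D"
  proof (rule ccontr)
    assume "\<not> (S \<subseteq> C \<or> S \<subseteq> D)"
    then obtain \<alpha> \<beta> where ab: "\<alpha> \<in> S" "\<alpha> \<notin> C" "\<beta> \<in> S" "\<beta> \<notin> D" by blast
    from join[OF ab(1,3)] obtain \<gamma> where \<gamma>: "arc_path \<gamma>" "\<gamma> 0 = \<alpha>" "\<gamma> 1 = \<beta>"
      "eventually (\<lambda>t. \<gamma> t \<in> S) cofinite" by blast
    then obtain l y where
      l: "\<And>i. fps_path (\<lambda>t. l t $ i)" and y: "\<And>j. fps_path (\<lambda>t. y t $ j)" and
      \<gamma>': "\<And>t. \<gamma> t = (l t, proj_class (y t))" unfolding arc_path_def by blast
    have ends: "\<alpha> = (l 0, proj_class (y 0))" "\<beta> = (l 1, proj_class (y 1))" and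
      ev: "eventually (\<lambda>t. (l t, proj_class (y t)) \<in> S) cofinite"
      using \<gamma> \<gamma>' by simp_all
    have ev': "eventually (\<lambda>t. (l t, proj_class (y t)) \<in> arcs) cofinite"
      using ev by eventually_elim (use S in blast)
    have open': "openin arc_space (arcs - C)" "openin arc_space (arcs - D)"
      using CD by (metis closedin_def topspace_arc_space)+
    have "(l 0, proj_class (y 0)) \<in> arcs - C" "(l 1, proj_class (y 1)) \<in> arcs - D"
      using ab ends S by auto
    from arc_space_path[OF open'(1) this(1) l y ev'] arc_space_path[OF open'(2) this(2) l y ev'] ev
    have "eventually (\<lambda>t::complex. False) cofinite"
      by eventually_elim (use CD in blast)
    then show False by (simp add: infinite_UNIV_char_0)
  qed
qed (use S in simp_all)

lemma limit_in_closure: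
  assumes S: "S \<subseteq> arcs"
    and l: "\<And>i. fps_path (\<lambda>t. l t $ i)" and y: "\<And>j. fps_path (\<lambda>t. y t $ j)"
    and ev: "eventually (\<lambda>t. (l t, proj_class (y t)) \<in> S) cofinite"
    and u: "unimodular (y t0)"
  shows "(l t0, proj_class (y t0)) \<in> arc_space closure_of S"
  unfolding in_closure_of
proof (intro conjI allI impI)
  have ev': "eventually (\<lambda>t. (l t, proj_class (y t)) \<in> arcs) cofinite"
    using ev by eventually_elim (use S in blast)
  show "(l t0, proj_class (y t0)) \<in> topspace arc_space"
    using limit_arc[OF l y ev' u] by simp
  fix W assume "(l t0, proj_class (y t0)) \<in> W \<and> openin arc_space W"
  then have "eventually (\<lambda>t. (l t, proj_class (y t)) \<in> W) cofinite"
    using arc_space_path[of W l t0 y, OF _ _ l y ev'] by blast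
  with ev have "eventually (\<lambda>t. (l t, proj_class (y t)) \<in> S \<inter> W) cofinite"
    by eventually_elim blast
  then obtain t where "(l t, proj_class (y t)) \<in> S \<inter> W"
    using eventually_happens[of _ "cofinite :: complex filter"] by (auto simp: infinite_UNIV_char_0)
  then show "\<exists>z. z \<in> S \<and> z \<in> W" by blast
qed

lemma path_limit_in_closure:
  assumes "S \<subseteq> arcs" "arc_path \<gamma>" "eventually (\<lambda>t. \<gamma> t \<in> S) cofinite" "\<gamma> t0 \<in> arcs"
  shows "\<gamma> t0 \<in> arc_space closure_of S"
proof -
  obtain l y where ly: "\<And>i. fps_path (\<lambda>t. l t $ i)" "\<And>j. fps_path (\<lambda>t. y t $ j)"
    "\<And>t. \<gamma> t = (l t, proj_class (y t))" using assms(2) unfolding arc_path_def by blast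
  have "unimodular (y t0)" using assms(4) arc_unimodular by (simp add: ly(3))
  from limit_in_closure[OF assms(1) ly(1,2) _ this] assms(3) show ?thesis by (simp add: ly(3))
qed

text \<open>Arcs inside the exceptional divisor are reached as limits of nondegenerate ones.\<close>

lemma perturbed_arc:
  assumes l: "\<And>i. fps_path (\<lambda>t. l t $ i)" and y: "\<And>j. fps_path (\<lambda>t. y t $ j)"
    and v: "\<And>t. bautin_gen (l t) = H t *s y t" and H: "\<And>t. fps_nth (H t) 0 = 0"
    and nz: "eventually (\<lambda>t. H t \<noteq> 0) cofinite" and u: "unimodular (y t0)"
  shows "(l t0, proj_class (y t0)) \<in> arcs"
proof (rule limit_arc[OF l y _ u])
  show "eventually (\<lambda>t. (l t, proj_class (y t)) \<in> arcs) cofinite"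
    using unimodular_path[OF y u] nz by eventually_elim (rule nondegenerate_arc[OF _ _ H v])
qed

section \<open>Coordinates\<close>

lemma exhaust_6: fixes i :: 6 shows "i = 1 \<or> i = 2 \<or> i = 3 \<or> i = 4 \<or> i = 5 \<or> i = 6"
proof (induct i)
  case (of_int z)
  then have "0 \<le> z" "z < 6" by simp_all
  then have "z = 0 \<or> z = 1 \<or> z = 2 \<or> z = 3 \<or> z = 4 \<or> z = 5" by arith
  then show ?case by auto
qed

lemma forall_6: "(\<forall>i::6. P i) \<longleftrightarrow> P 1 \<and> P 2 \<and> P 3 \<and> P 4 \<and> P 5 \<and> P 6"
  by (metis exhaust_6)

text \<open>The equations of the components are simplest in \<open>x = \<lambda>\<^sub>3 - \<lambda>\<^sub>6\<close> in place of \<open>\<lambda>\<^sub>3\<close>.\<close>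

definition params :: "'r::comm_ring_1 \<Rightarrow> 'r \<Rightarrow> 'r \<Rightarrow> 'r \<Rightarrow> 'r \<Rightarrow> 'r \<Rightarrow> 'r ^ 6" where
  "params a b x d e c = vector [a, b, x + c, d, e, c]"

lemma params_nth [simp]:
  "params a b x d e c $ 1 = a" "params a b x d e c $ 2 = b" "params a b x d e c $ 3 = x + c"
  "params a b x d e c $ 4 = d" "params a b x d e c $ 5 = e" "params a b x d e c $ 6 = c"
  unfolding params_def vector_def by simp_all

lemma params_surj: "l = params (l $ 1) (l $ 2) (l $ 3 - l $ 6) (l $ 4) (l $ 5) (l $ 6)"
  unfolding vec_eq_iff forall_6 params_nth by simp

lemma vec4_surj: "(y :: 'a::zero ^ 4) = vector [y $ 1, y $ 2, y $ 3, y $ 4]"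
  unfolding vec_eq_iff forall_4 vector_4 by simp

lemma bautin_params:
  "bautin_gen (params a b x d e c) =
    vector [a, e * x, b * d * x * (d + 5 * x), b * d * x\<^sup>2 * (x * c - c\<^sup>2 - b\<^sup>2)]"
  unfolding bautin_gen_def params_nth
  by (simp add: vec_eq_iff forall_4) (simp add: algebra_simps power2_eq_square)

lemma const_term_params [simp]:
  "const_term (params a b x d e c) = params (fps_nth a 0) (fps_nth b 0) (fps_nth x 0)
    (fps_nth d 0) (fps_nth e 0) (fps_nth c 0)"
  unfolding vec_eq_iff forall_6 const_term_nth params_nth by simp

lemma const_term_vec4 [simp]:
  "const_term (vector [p, q, r, s] :: complex fps ^ 4) =
    vector [fps_nth p 0, fps_nth q 0, fps_nth r 0, fps_nth s 0]"
  unfolding vec_eq_iff forall_4 const_term_nth vector_4 by simp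

lemma params_path [intro, simp]:
  assumes "fps_path a" "fps_path b" "fps_path x" "fps_path d" "fps_path e" "fps_path c"
  shows "fps_path (\<lambda>t. params (a t) (b t) (x t) (d t) (e t) (c t) $ i)"
proof -
  have "\<forall>i. fps_path (\<lambda>t. params (a t) (b t) (x t) (d t) (e t) (c t) $ i)"
    unfolding forall_6 params_nth using assms by simp
  then show ?thesis ..
qed

lemma vec4_path [intro, simp]:
  assumes "fps_path p" "fps_path q" "fps_path r" "fps_path s"
  shows "fps_path (\<lambda>t. (vector [p t, q t, r t, s t] :: complex fps ^ 4) $ j)"
proof -
  have "\<forall>j. fps_path (\<lambda>t. (vector [p t, q t, r t, s t] :: complex fps ^ 4) $ j)"
    unfolding forall_4 vector_4 using assms by simp
  then show ?thesis ..
qed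

lemma unimodular_vec4:
  "unimodular (vector [p, q, r, s] :: complex fps ^ 4) \<longleftrightarrow>
    fps_nth p 0 \<noteq> 0 \<or> fps_nth q 0 \<noteq> 0 \<or> fps_nth r 0 \<noteq> 0 \<or> fps_nth s 0 \<noteq> 0"
proof -
  have "(\<exists>j::4. P j) \<longleftrightarrow> P 1 \<or> P 2 \<or> P 3 \<or> P 4" for P
    using forall_4[of "\<lambda>j. \<not> P j"] by blast
  then show ?thesis by (simp add: unimodular_fps)
qed

lemma params_in_I1: "params a b x d e c \<in> I1 \<longleftrightarrow> a = 0 \<and> x = 0"
  and params_in_I2: "params a b x d e c \<in> I2 \<longleftrightarrow> a = 0 \<and> b = 0 \<and> e = 0"
  and params_in_I3: "params a b x d e c \<in> I3 \<longleftrightarrow> a = 0 \<and> d = 0 \<and> e = 0"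
  and params_in_I4: "params a b x d e c \<in> I4 \<longleftrightarrow> a = 0 \<and> e = 0 \<and> d + 5 * x = 0 \<and> x * c - c\<^sup>2 - b\<^sup>2 = 0"
  by (simp_all add: I1_def I2_def I3_def I4_def algebra_simps power2_eq_square)

lemmas params_in_I = params_in_I1 params_in_I2 params_in_I3 params_in_I4

lemma center_set_components: "center_set = I1 \<union> I2 \<union> I3 \<union> I4"
proof (rule set_eqI)
  fix l :: "complex ^ 6"
  have "params a b x d e c \<in> center_set \<longleftrightarrow> params a b x d e c \<in> I1 \<union> I2 \<union> I3 \<union> I4" for a b x d e c
    unfolding center_set_def mem_Collect_eq Un_iff params_in_I bautin_gen_complex[symmetric] bautin_params forall_4
    by (auto simp: power2_eq_square)
  then show "l \<in> center_set \<longleftrightarrow> l \<in> I1 \<union> I2 \<union> I3 \<union> I4" using params_surj[of l] by metis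
qed

definition coord_arc where
  "coord_arc a b x d e c p q r s = (params a b x d e c, proj_class (vector [p, q, r, s] :: complex fps ^ 4))"

lemma coord_arc_path [intro, simp]:
  assumes "fps_path a" "fps_path b" "fps_path x" "fps_path d" "fps_path e" "fps_path c"
    and "fps_path p" "fps_path q" "fps_path r" "fps_path s"
  shows "arc_path (\<lambda>t. coord_arc (a t) (b t) (x t) (d t) (e t) (c t) (p t) (q t) (r t) (s t))"
  unfolding arc_path_def coord_arc_def
  by (rule exI, rule exI, intro conjI allI, rule params_path[OF assms(1-6)], rule vec4_path[OF assms(7-10)], rule refl)

lemma coord_arc_cases:
  assumes "\<alpha> \<in> arcs"
  obtains a b x d e c p q r s where "\<alpha> = coord_arc a b x d e c p q r s"
  using arc_cases[OF assms] params_surj vec4_surj unfolding coord_arc_def by metis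

lemma coord_arc_center [simp]:
  "fst (arc_center (coord_arc a b x d e c p q r s)) =
    params (fps_nth a 0) (fps_nth b 0) (fps_nth x 0) (fps_nth d 0) (fps_nth e 0) (fps_nth c 0)"
  "snd (arc_center (coord_arc a b x d e c p q r s)) =
    proj_class (vector [fps_nth p 0, fps_nth q 0, fps_nth r 0, fps_nth s 0])"
  by (simp_all add: coord_arc_def)

lemma coord_arc_unimodular:
  "coord_arc a b x d e c p q r s \<in> arcs \<Longrightarrow>
    fps_nth p 0 \<noteq> 0 \<or> fps_nth q 0 \<noteq> 0 \<or> fps_nth r 0 \<noteq> 0 \<or> fps_nth s 0 \<noteq> 0"
  unfolding coord_arc_def using arc_unimodular unimodular_vec4 by blast

lemma hpoly_bautin: "hpoly 0 (\<lambda>l y. bautin l $ j) (\<lambda>l y. bautin_gen l $ j)"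
proof -
  have m: "hpoly 0 e1 e1' \<Longrightarrow> hpoly 0 e2 e2' \<Longrightarrow> hpoly 0 (\<lambda>l y. e1 l y * e2 l y) (\<lambda>l y. e1' l y * e2' l y)"
    for e1 e1' e2 e2'
    using hpoly_mult by fastforce
  have "\<forall>j. hpoly 0 (\<lambda>l y. bautin l $ j) (\<lambda>l y. bautin_gen l $ j)"
    unfolding forall_4 bautin_def bautin_gen_def vector_4
    by (intro conjI m hpoly_fst hpoly_numeral hpoly_add hpoly_diff hpoly_power2)
  then show ?thesis ..
qed

lemma arc_minors:
  assumes "(l, proj_class y) \<in> arcs"
  shows "bautin_gen l $ i * y $ j = bautin_gen l $ j * y $ i"
proof -
  have "hpoly 1 (\<lambda>l y. bautin l $ i * y $ j - bautin l $ j * y $ i)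
     (\<lambda>l y. bautin_gen l $ i * y $ j - bautin_gen l $ j * y $ i)"
    by (intro hpoly_diff hpoly_mult[OF hpoly_bautin hpoly_snd]) simp_all
  from arc_equation[OF assms this] show ?thesis by simp
qed

text \<open>The first six relations say that \<open>y\<close> is proportional to the generators; the last three
  are the syzygies, which remain informative where the generators vanish.\<close>

lemma coord_arc_relations:
  assumes "coord_arc a b x d e c p q r s \<in> arcs"
  defines "f \<equiv> d + 5 * x" and "g \<equiv> x * c - c\<^sup>2 - b\<^sup>2"
  shows "a * q = e * x * p" "a * r = b * d * x * f * p" "a * s = b * d * x\<^sup>2 * g * p"
    "e * x * s = b * d * x\<^sup>2 * g * q"
    "e * x * r = b * d * x * f * q"
    "b * d * x * f * s = b * d * x\<^sup>2 * g * r"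
    "e * r = b * d * f * q" "e * s = b * d * x * g * q" "f * s = x * g * r"
proof -
  have arc: "(params a b x d e c, proj_class (vector [p, q, r, s] :: complex fps ^ 4)) \<in> arcs"
    using assms(1) by (simp add: coord_arc_def)
  note m = arc_minors[OF arc, unfolded bautin_params]
  show "a * q = e * x * p" "a * r = b * d * x * f * p" "a * s = b * d * x\<^sup>2 * g * p"
    "e * x * s = b * d * x\<^sup>2 * g * q" "e * x * r = b * d * x * f * q"
    "b * d * x * f * s = b * d * x\<^sup>2 * g * r"
    using m[of 1 2] m[of 1 3] m[of 1 4] m[of 2 4] m[of 2 3] m[of 3 4] by (simp_all add: f_def g_def)
  have mult0: "hpoly 0 e1 e1' \<Longrightarrow> hpoly 0 e2 e2' \<Longrightarrow> hpoly 0 (\<lambda>l y. e1 l y * e2 l y) (\<lambda>l y. e1' l y * e2' l y)"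
    and mult1: "hpoly 0 e1 e1' \<Longrightarrow> hpoly (Suc 0) e2 e2' \<Longrightarrow> hpoly (Suc 0) (\<lambda>l y. e1 l y * e2 l y) (\<lambda>l y. e1' l y * e2' l y)"
    for e1 e1' e2 e2'
    by (rule hpoly_mult, assumption, assumption, simp)+
  let ?X = "\<lambda>l. l $ 3 - l $ 6" and ?F = "\<lambda>l. l $ 4 + 5 * (l $ 3 - l $ 6)"
    and ?G = "\<lambda>l. (l $ 3 - l $ 6) * l $ 6 - (l $ 6)\<^sup>2 - (l $ 2)\<^sup>2"
  have eq: "hpoly (Suc 0) (\<lambda>l y. l $ 5 * y $ 3 - l $ 2 * l $ 4 * ?F l * y $ 2)
      (\<lambda>l y. l $ 5 * y $ 3 - l $ 2 * l $ 4 * ?F l * y $ 2)"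
    "hpoly (Suc 0) (\<lambda>l y. l $ 5 * y $ 4 - l $ 2 * l $ 4 * ?X l * ?G l * y $ 2)
      (\<lambda>l y. l $ 5 * y $ 4 - l $ 2 * l $ 4 * ?X l * ?G l * y $ 2)"
    "hpoly (Suc 0) (\<lambda>l y. ?F l * y $ 4 - ?X l * ?G l * y $ 3)
      (\<lambda>l y. ?F l * y $ 4 - ?X l * ?G l * y $ 3)"
    by (intro hpoly_diff hpoly_add mult1 mult0 hpoly_fst hpoly_snd hpoly_numeral hpoly_power2)+
  have "l $ 5 * bautin l $ 3 - l $ 2 * l $ 4 * ?F l * bautin l $ 2 = 0" for l :: "complex ^ 6"
    unfolding bautin_def vector_4 by algebra
  from arc_equation[OF arc eq(1) this] show "e * r = b * d * f * q" by (simp add: f_def)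
  have "l $ 5 * bautin l $ 4 - l $ 2 * l $ 4 * ?X l * ?G l * bautin l $ 2 = 0" for l :: "complex ^ 6"
    unfolding bautin_def vector_4 by algebra
  from arc_equation[OF arc eq(2) this] show "e * s = b * d * x * g * q" by (simp add: g_def)
  have "?F l * bautin l $ 4 - ?X l * ?G l * bautin l $ 3 = 0" for l :: "complex ^ 6"
    unfolding bautin_def vector_4 by algebra
  from arc_equation[OF arc eq(3) this] show "f * s = x * g * r" by (simp add: f_def g_def)
qed

section \<open>The open strata of the arc space\<close>

definition stratum :: "(complex ^ 6) set \<Rightarrow> arc set" where
  "stratum I = {a \<in> arcs. fst (arc_center a) \<in> I \<and> fst (arc_center a) \<notin> \<Union>({I1, I2, I3, I4} - {I})}"

lemma Arc_stratum: "Arc I = arc_space closure_of stratum I"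
  by (simp add: Arc_def stratum_def)

lemma I_distinct: "I1 \<noteq> I2" "I1 \<noteq> I3" "I1 \<noteq> I4" "I2 \<noteq> I3" "I2 \<noteq> I4" "I3 \<noteq> I4"
proof -
  show "I1 \<noteq> I2" "I1 \<noteq> I3" "I1 \<noteq> I4"
    using params_in_I[of 0 1 0 1 0 0] by auto
  show "I2 \<noteq> I3" "I2 \<noteq> I4" using params_in_I[of 0 0 1 1 0 0] by auto
  show "I3 \<noteq> I4" using params_in_I[of 0 1 1 0 0 0] by auto
qed

lemma stratum_iff:
  "a \<in> stratum I1 \<longleftrightarrow> a \<in> arcs \<and> fst (arc_center a) \<in> I1 \<and> fst (arc_center a) \<notin> I2 \<and>
     fst (arc_center a) \<notin> I3 \<and> fst (arc_center a) \<notin> I4"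
  "a \<in> stratum I2 \<longleftrightarrow> a \<in> arcs \<and> fst (arc_center a) \<in> I2 \<and> fst (arc_center a) \<notin> I1 \<and>
     fst (arc_center a) \<notin> I3 \<and> fst (arc_center a) \<notin> I4"
  "a \<in> stratum I3 \<longleftrightarrow> a \<in> arcs \<and> fst (arc_center a) \<in> I3 \<and> fst (arc_center a) \<notin> I1 \<and>
     fst (arc_center a) \<notin> I2 \<and> fst (arc_center a) \<notin> I4"
  "a \<in> stratum I4 \<longleftrightarrow> a \<in> arcs \<and> fst (arc_center a) \<in> I4 \<and> fst (arc_center a) \<notin> I1 \<and>
     fst (arc_center a) \<notin> I2 \<and> fst (arc_center a) \<notin> I3"
  using I_distinct I_distinct[symmetric] by (simp_all add: stratum_def insert_Diff_if)

lemma arc_center_in_components: "a \<in> arcs \<Longrightarrow> fst (arc_center a) \<in> I1 \<union> I2 \<union> I3 \<union> I4"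
  using center_set_components by (simp add: arcs_def exc_divisor_def)

lemma hpoly_mult0:
  "hpoly 0 e1 e1' \<Longrightarrow> hpoly 0 e2 e2' \<Longrightarrow> hpoly 0 (\<lambda>l y. e1 l y * e2 l y) (\<lambda>l y. e1' l y * e2' l y)"
  by (rule hpoly_mult, assumption, assumption, simp)

lemma hpoly_mult1:
  "hpoly 0 e1 e1' \<Longrightarrow> hpoly (Suc 0) e2 e2' \<Longrightarrow>
    hpoly (Suc 0) (\<lambda>l y. e1 l y * e2 l y) (\<lambda>l y. e1' l y * e2' l y)"
  by (rule hpoly_mult, assumption, assumption, simp)

lemma open_off_component:
  "openin arc_space {a \<in> arcs. fst (arc_center a) \<notin> I1}"
  "openin arc_space {a \<in> arcs. fst (arc_center a) \<notin> I2}"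
  "openin arc_space {a \<in> arcs. fst (arc_center a) \<notin> I3}"
  "openin arc_space {a \<in> arcs. fst (arc_center a) \<notin> I4}"
proof -
  have coord: "openin arc_space {a \<in> arcs. fst (arc_center a) $ i \<noteq> 0}" for i
    by (rule open_arcs_center_fst[OF hpoly_fst])
  have x: "openin arc_space {a \<in> arcs. fst (arc_center a) $ 3 - fst (arc_center a) $ 6 \<noteq> 0}"
    by (rule open_arcs_center_fst[OF hpoly_diff[OF hpoly_fst hpoly_fst]])
  have f: "openin arc_space {a \<in> arcs. fst (arc_center a) $ 4 + 5 * fst (arc_center a) $ 3 -
      5 * fst (arc_center a) $ 6 \<noteq> 0}"
    by (rule open_arcs_center_fst[OF hpoly_diff[OF hpoly_add[OF hpoly_fst hpoly_mult0] hpoly_mult0]])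
       (rule hpoly_numeral hpoly_fst)+
  have g: "openin arc_space {a \<in> arcs. fst (arc_center a) $ 3 * fst (arc_center a) $ 6 -
      2 * (fst (arc_center a) $ 6)\<^sup>2 - (fst (arc_center a) $ 2)\<^sup>2 \<noteq> 0}"
    by (rule open_arcs_center_fst[OF hpoly_diff[OF hpoly_diff[OF hpoly_mult0 hpoly_mult0] hpoly_power2]])
       (rule hpoly_numeral hpoly_fst hpoly_power2)+
  have un: "openin arc_space {a \<in> arcs. \<not> (P a \<and> Q a)}"
    if "openin arc_space {a \<in> arcs. \<not> P a}" "openin arc_space {a \<in> arcs. \<not> Q a}" for P Q
  proof -
    have "{a \<in> arcs. \<not> (P a \<and> Q a)} = {a \<in> arcs. \<not> P a} \<union> {a \<in> arcs. \<not> Q a}" by blast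
    then show ?thesis using openin_Un[OF that] by simp
  qed
  show "openin arc_space {a \<in> arcs. fst (arc_center a) \<notin> I1}"
    "openin arc_space {a \<in> arcs. fst (arc_center a) \<notin> I2}"
    "openin arc_space {a \<in> arcs. fst (arc_center a) \<notin> I3}"
    "openin arc_space {a \<in> arcs. fst (arc_center a) \<notin> I4}"
    unfolding I1_def I2_def I3_def I4_def mem_Collect_eq
    by (intro un coord x f g)+
qed

text \<open>The centre of an arc lies on some component, so lying on no component but \<open>I\<^sub>j\<close> is an
  open condition although \<open>I\<^sub>j\<close> is closed.\<close>

lemma open_stratum:
  "openin arc_space (stratum I1)" "openin arc_space (stratum I2)"
  "openin arc_space (stratum I3)" "openin arc_space (stratum I4)"
proof -
  have int: "openin arc_space {a \<in> arcs. P a \<and> Q a}"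
    if "openin arc_space {a \<in> arcs. P a}" "openin arc_space {a \<in> arcs. Q a}" for P Q
  proof -
    have "{a \<in> arcs. P a \<and> Q a} = {a \<in> arcs. P a} \<inter> {a \<in> arcs. Q a}" by blast
    then show ?thesis using openin_Int[OF that] by simp
  qed
  have
    "stratum I1 = {a \<in> arcs. fst (arc_center a) \<notin> I2 \<and> fst (arc_center a) \<notin> I3 \<and> fst (arc_center a) \<notin> I4}"
    "stratum I2 = {a \<in> arcs. fst (arc_center a) \<notin> I1 \<and> fst (arc_center a) \<notin> I3 \<and> fst (arc_center a) \<notin> I4}"
    "stratum I3 = {a \<in> arcs. fst (arc_center a) \<notin> I1 \<and> fst (arc_center a) \<notin> I2 \<and> fst (arc_center a) \<notin> I4}"
    "stratum I4 = {a \<in> arcs. fst (arc_center a) \<notin> I1 \<and> fst (arc_center a) \<notin> I2 \<and> fst (arc_center a) \<notin> I3}"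
    using arc_center_in_components stratum_iff by blast+
  then show "openin arc_space (stratum I1)" "openin arc_space (stratum I2)"
    "openin arc_space (stratum I3)" "openin arc_space (stratum I4)"
    by (simp_all only: int open_off_component)
qed

subsection \<open>Paths of power series\<close>

definition seg :: "complex fps \<Rightarrow> complex fps \<Rightarrow> complex \<Rightarrow> complex fps" where
  "seg u v t = u + fps_const t * (v - u)"

lemma seg_path [intro, simp]: "fps_path (seg u v)"
proof -
  have "fps_path (\<lambda>t. u + fps_const t * (v - u))" by simp
  then show ?thesis by (simp add: seg_def[abs_def])
qed

lemma seg_ends [simp]: "seg u v 0 = u" "seg u v 1 = v"
  by (simp_all add: seg_def)

lemma seg_const_0: "fps_nth u 0 = 0 \<Longrightarrow> fps_nth v 0 = 0 \<Longrightarrow> fps_nth (seg u v t) 0 = 0"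
  by (simp add: seg_def)

lemma eventually_const_nonzero:
  assumes "fps_path f" "fps_nth (f 0) 0 \<noteq> 0"
  shows "eventually (\<lambda>t. fps_nth (f t) 0 \<noteq> 0) cofinite"
  by (rule fps_path_nonzero[OF assms])

text \<open>On an arc inside the exceptional divisor the common factor \<open>h\<close> is zero. Adding
  \<open>t \<epsilon>\<close> to it makes the arc nondegenerate for almost all \<open>t\<close> and does not move the centre.\<close>

lemma shifted_nonzero: "eventually (\<lambda>t. h + fps_const t * fps_X \<noteq> (0 :: complex fps)) cofinite"
proof -
  have "poly_path (\<lambda>t. fps_nth h 1 + t)" by simp
  from poly_path_nonzero[OF this, of "1 - fps_nth h 1"]
  have "eventually (\<lambda>t. fps_nth h 1 + t \<noteq> 0) cofinite" by simp
  then show ?thesis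
  proof eventually_elim
    case (elim t)
    then have "fps_nth (h + fps_const t * fps_X) 1 \<noteq> 0" by simp
    then show ?case by (metis fps_zero_nth)
  qed
qed

lemma eventually_disj4_nonzero:
  assumes "fps_nth S 0 \<noteq> 0 \<or> fps_nth T 0 \<noteq> 0 \<or> fps_nth M 0 \<noteq> 0 \<or> fps_nth N 0 \<noteq> (0::complex)"
  shows "eventually (\<lambda>t. fps_nth (seg S S' t) 0 \<noteq> 0 \<or> fps_nth (seg T T' t) 0 \<noteq> 0 \<or>
    fps_nth (seg M M' t) 0 \<noteq> 0 \<or> fps_nth (seg N N' t) 0 \<noteq> 0) cofinite"
  using assms eventually_const_nonzero[of "seg S S'"] eventually_const_nonzero[of "seg T T'"]
    eventually_const_nonzero[of "seg M M'"] eventually_const_nonzero[of "seg N N'"]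
  by (auto elim: eventually_mono)

lemma nth_0_numeral_mult [simp]: "fps_nth (numeral n * f) 0 = numeral n * fps_nth (f :: complex fps) 0"
  by (simp add: numeral_fps_const)

lemma fps_unit_inverse: "fps_nth f 0 \<noteq> 0 \<Longrightarrow> \<exists>i. (f :: complex fps) * i = 1"
  by (rule exI[of _ "inverse f"]) (simp add: inverse_mult_eq_1')

lemma common_factor:
  fixes z w :: "complex fps ^ 4"
  assumes "unimodular w" "\<And>i j. z $ i * w $ j = z $ j * w $ i"
  obtains h where "\<And>i. z $ i = w $ i * h"
proof -
  obtain j where "fps_nth (w $ j) 0 \<noteq> 0" using assms(1) by (auto simp: unimodular_fps)
  then obtain k where k: "w $ j * k = 1" using fps_unit_inverse by blast
  have "z $ i = w $ i * (z $ j * k)" for i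
  proof -
    have "z $ i = z $ i * (w $ j * k)" by (simp only: k mult_1_right)
    also have "\<dots> = (z $ i * w $ j) * k" by (simp only: mult.assoc)
    also have "\<dots> = (z $ j * w $ i) * k" by (simp only: assms(2)[of i j])
    also have "\<dots> = w $ i * (z $ j * k)" by (simp only: mult_ac)
    finally show ?thesis .
  qed
  then show ?thesis using that by blast
qed

text \<open>A centre of codimension up to four, with local equations \<open>a\<close>, \<open>e\<close>, \<open>f\<close>, \<open>g\<close>: an arc of its
  blowup is given by homogeneous coordinates \<open>S\<close>, \<open>T\<close>, \<open>M\<close>, \<open>N\<close> and the factor \<open>h\<close>. Smaller
  codimension is obtained by padding with zeros.\<close>

lemma common_factor_vec4:
  fixes S T M N :: "complex fps"
  assumes u: "fps_nth S 0 \<noteq> 0 \<or> fps_nth T 0 \<noteq> 0 \<or> fps_nth M 0 \<noteq> 0 \<or> fps_nth N 0 \<noteq> 0"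
    and m: "a * T = e * S" "a * M = f * S" "a * N = g * S" "e * M = f * T" "e * N = g * T" "f * N = g * M"
    and z: "fps_nth a 0 = 0" "fps_nth e 0 = 0" "fps_nth f 0 = 0" "fps_nth g 0 = 0"
  obtains h where "a = S * h" "e = T * h" "f = M * h" "g = N * h" "fps_nth h 0 = 0"
proof -
  let ?w = "vector [S, T, M, N] :: complex fps ^ 4" and ?z = "vector [a, e, f, g] :: complex fps ^ 4"
  have w: "unimodular ?w" using u by (simp add: unimodular_vec4)
  have "\<forall>i j. ?z $ i * ?w $ j = ?z $ j * ?w $ i"
    unfolding forall_4 vector_4 using m by simp
  then obtain h where h: "\<And>i. ?z $ i = ?w $ i * h" using common_factor[OF w] by blast
  have *: "a = S * h" "e = T * h" "f = M * h" "g = N * h"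
    using h[of 1] h[of 2] h[of 3] h[of 4] by simp_all
  moreover have "fps_nth h 0 = 0" using u z unfolding * by auto
  ultimately show ?thesis by (rule that)
qed

subsection \<open>The arcs over \<open>I1\<close>\<close>

text \<open>Where \<open>e\<close> or \<open>bd\<close> is a unit the ideal is \<open>(a, x)\<close>; here \<open>[a:x] = [S:T]\<close> and \<open>y\<close> is the
  vector of generators divided by \<open>h\<close>.\<close>

definition chart1 where
  "chart1 S T h b d e c = coord_arc (S * h) b (T * h) d e c S (e * T) (b * d * (d + 5 * (T * h)) * T)
     (b * d * (T * h) * (T * h * c - c\<^sup>2 - b\<^sup>2) * T)"

definition cond1 :: "complex fps \<Rightarrow> complex fps \<Rightarrow> complex fps \<Rightarrow> complex fps \<Rightarrow> complex fps \<Rightarrow> complex fps \<Rightarrow> bool" where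
  "cond1 S T h b d e \<longleftrightarrow> fps_nth h 0 = 0 \<and> (fps_nth S 0 \<noteq> 0 \<or> fps_nth T 0 \<noteq> 0) \<and>
     (fps_nth e 0 \<noteq> 0 \<or> fps_nth b 0 \<noteq> 0 \<and> fps_nth d 0 \<noteq> 0)"

lemma chart1_stratum:
  assumes "cond1 S T h b d e" shows "chart1 S T h b d e c \<in> stratum I1"
proof -
  let ?H = "\<lambda>t. h + fps_const t * fps_X"
  let ?l = "\<lambda>t. params (S * ?H t) b (T * ?H t) d e c"
  let ?y = "\<lambda>t. vector [S, e * T, b * d * (d + 5 * (T * ?H t)) * T,
     b * d * (T * ?H t) * (T * ?H t * c - c\<^sup>2 - b\<^sup>2) * T] :: complex fps ^ 4"
  have "(?l 0, proj_class (?y 0)) \<in> arcs"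
  proof (rule perturbed_arc[where H = ?H])
    show "bautin_gen (?l t) = ?H t *s ?y t" for t
      unfolding bautin_params vec_eq_iff forall_4 vector_smult_component vector_4
      by (intro conjI; algebra)
    show "unimodular (?y 0)" using assms by (auto simp: unimodular_vec4 cond1_def)
  qed (use assms shifted_nonzero in \<open>auto simp: cond1_def\<close>)
  then have "chart1 S T h b d e c \<in> arcs" by (simp add: chart1_def coord_arc_def)
  then show ?thesis using assms by (auto simp: stratum_iff chart1_def params_in_I cond1_def)
qed

text \<open>The parameter \<open>T\<close> is \<open>q/e\<close> or \<open>r/(bdf)\<close>, depending on which denominator is a unit;
  by the syzygies either quotient also determines the other coordinates.\<close>

lemma stratum_I1_chart:
  assumes "\<alpha> \<in> stratum I1"
  shows "\<exists>S T h b d e c. cond1 S T h b d e \<and> \<alpha> = chart1 S T h b d e c"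
proof -
  have arc: "\<alpha> \<in> arcs" using assms by (simp add: stratum_iff)
  then obtain a b x d e c p q r s where \<alpha>: "\<alpha> = coord_arc a b x d e c p q r s" by (rule coord_arc_cases)
  note rel = coord_arc_relations[OF arc[unfolded \<alpha>]] and u = coord_arc_unimodular[OF arc[unfolded \<alpha>]]
  have c: "fps_nth a 0 = 0" "fps_nth x 0 = 0"
    "fps_nth e 0 \<noteq> 0 \<or> fps_nth b 0 \<noteq> 0 \<and> fps_nth d 0 \<noteq> 0"
    using assms by (auto simp: stratum_iff \<alpha> params_in_I)
  obtain T where T: "q = e * T" "r = b * d * (d + 5 * x) * T" "s = b * d * x * (x * c - c\<^sup>2 - b\<^sup>2) * T"
    "a * T = x * p"
  proof (cases "fps_nth e 0 = 0")
    case False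
    then obtain i where i: "e * i = 1" using fps_unit_inverse by blast
    show thesis
    proof (rule that[of "q * i"])
      show "q = e * (q * i)" using i by algebra
      show "r = b * d * (d + 5 * x) * (q * i)" using i rel(7) by algebra
      show "s = b * d * x * (x * c - c\<^sup>2 - b\<^sup>2) * (q * i)" using i rel(8) by algebra
      show "a * (q * i) = x * p" using i rel(1) by algebra
    qed
  next
    case True
    then have "fps_nth b 0 \<noteq> 0" "fps_nth d 0 \<noteq> 0" "fps_nth (d + 5 * x) 0 \<noteq> 0" using c by auto
    then obtain i j k where i: "b * i = 1" and j: "d * j = 1" and k: "(d + 5 * x) * k = 1"
      using fps_unit_inverse by metis
    show thesis
    proof (rule that[of "r * i * j * k"])
      show "q = e * (r * i * j * k)" using i j k rel(7) by algebra
      show "r = b * d * (d + 5 * x) * (r * i * j * k)" using i j k by algebra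
      show "s = b * d * x * (x * c - c\<^sup>2 - b\<^sup>2) * (r * i * j * k)" using i j k rel(9) by algebra
      show "a * (r * i * j * k) = x * p" using i j k rel(2) by algebra
    qed
  qed
  have uT: "fps_nth p 0 \<noteq> 0 \<or> fps_nth T 0 \<noteq> 0" using u unfolding T by auto
  obtain h where h: "a = p * h" "x = T * h" "fps_nth h 0 = 0"
    by (rule common_factor_vec4[of p T 0 0 a x 0 0]) (use uT T(4) c in auto)
  have "cond1 p T h b d e \<and> \<alpha> = chart1 p T h b d e c"
    using c uT h T by (simp add: cond1_def \<alpha> chart1_def)
  then show ?thesis by blast
qed

lemma irreducible_stratum_I1: "irreducible_in arc_space (stratum I1)"
proof (rule irreducible_by_paths)
  show "stratum I1 \<subseteq> arcs" by (auto simp: stratum_iff)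
  have "cond1 1 0 0 1 1 1" by (simp add: cond1_def)
  then show "stratum I1 \<noteq> {}" using chart1_stratum by blast
  fix \<alpha> \<beta> assume "\<alpha> \<in> stratum I1" "\<beta> \<in> stratum I1"
  then obtain S T h b d e c S' T' h' b' d' e' c' where
    \<alpha>: "cond1 S T h b d e" "\<alpha> = chart1 S T h b d e c" and
    \<beta>: "cond1 S' T' h' b' d' e'" "\<beta> = chart1 S' T' h' b' d' e' c'"
    using stratum_I1_chart by meson
  let ?\<gamma> = "\<lambda>t. chart1 (seg S S' t) (seg T T' t) (seg h h' t) (seg b b' t) (seg d d' t) (seg e e' t) (seg c c' t)"
  have "eventually (\<lambda>t. fps_nth (seg S S' t) 0 \<noteq> 0 \<or> fps_nth (seg T T' t) 0 \<noteq> 0) cofinite"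
    using \<alpha>(1) eventually_const_nonzero[of "seg S S'"] eventually_const_nonzero[of "seg T T'"]
    by (auto simp: cond1_def elim: eventually_mono)
  moreover have "eventually (\<lambda>t. fps_nth (seg e e' t) 0 \<noteq> 0 \<or>
      fps_nth (seg b b' t) 0 \<noteq> 0 \<and> fps_nth (seg d d' t) 0 \<noteq> 0) cofinite"
    using \<alpha>(1) eventually_const_nonzero[of "seg e e'"] eventually_const_nonzero[of "\<lambda>t. seg b b' t * seg d d' t"]
    by (auto simp: cond1_def elim: eventually_mono)
  ultimately have ev: "eventually (\<lambda>t. ?\<gamma> t \<in> stratum I1) cofinite"
    by eventually_elim
       (rule chart1_stratum, use \<alpha>(1) \<beta>(1) in \<open>simp add: cond1_def seg_const_0\<close>)
  show "\<exists>\<gamma>. arc_path \<gamma> \<and> \<gamma> 0 = \<alpha> \<and> \<gamma> 1 = \<beta> \<and> eventually (\<lambda>t. \<gamma> t \<in> stratum I1) cofinite"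
    by (rule exI[of _ ?\<gamma>]) (use ev \<alpha> \<beta> in \<open>simp add: chart1_def\<close>)
qed

subsection \<open>The arcs over \<open>I2\<close>\<close>

text \<open>Where \<open>x\<close>, \<open>d\<close> and one of \<open>f\<close>, \<open>g\<close> are units the ideal is \<open>(a, e, b)\<close>.\<close>

definition chart2 where
  "chart2 S T R h x d c = coord_arc (S * h) (R * h) x d (T * h) c S (x * T) (R * d * x * (d + 5 * x))
     (R * d * x\<^sup>2 * (x * c - c\<^sup>2 - (R * h)\<^sup>2))"

definition cond2 :: "complex fps \<Rightarrow> complex fps \<Rightarrow> complex fps \<Rightarrow> complex fps \<Rightarrow> complex fps \<Rightarrow> complex fps \<Rightarrow> complex fps \<Rightarrow> bool" where
  "cond2 S T R h x d c \<longleftrightarrow> fps_nth h 0 = 0 \<and>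
     (fps_nth S 0 \<noteq> 0 \<or> fps_nth T 0 \<noteq> 0 \<or> fps_nth R 0 \<noteq> 0) \<and>
     fps_nth x 0 \<noteq> 0 \<and> fps_nth d 0 \<noteq> 0 \<and>
     (fps_nth (d + 5 * x) 0 \<noteq> 0 \<or> fps_nth (x * c - c\<^sup>2) 0 \<noteq> 0)"

lemma chart2_stratum:
  assumes "cond2 S T R h x d c" shows "chart2 S T R h x d c \<in> stratum I2"
proof -
  let ?H = "\<lambda>t. h + fps_const t * fps_X"
  let ?l = "\<lambda>t. params (S * ?H t) (R * ?H t) x d (T * ?H t) c"
  let ?y = "\<lambda>t. vector [S, x * T, R * d * x * (d + 5 * x),
     R * d * x\<^sup>2 * (x * c - c\<^sup>2 - (R * ?H t)\<^sup>2)] :: complex fps ^ 4"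
  have "(?l 0, proj_class (?y 0)) \<in> arcs"
  proof (rule perturbed_arc[where H = ?H])
    show "bautin_gen (?l t) = ?H t *s ?y t" for t
      unfolding bautin_params vec_eq_iff forall_4 vector_smult_component vector_4
      by (intro conjI; algebra)
    show "unimodular (?y 0)" using assms by (auto simp: unimodular_vec4 cond2_def power2_eq_square)
  qed (use assms shifted_nonzero in \<open>auto simp: cond2_def\<close>)
  then have "chart2 S T R h x d c \<in> arcs" by (simp add: chart2_def coord_arc_def)
  then show ?thesis using assms by (auto simp: stratum_iff chart2_def params_in_I cond2_def power2_eq_square)
qed

text \<open>The parameter \<open>R\<close> is \<open>r/(dxf)\<close> or \<open>s/(dx\<^sup>2g)\<close>; the relation \<open>fs = xgr\<close> makes the two
  expressions agree.\<close>

lemma stratum_I2_chart: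
  assumes "\<alpha> \<in> stratum I2"
  shows "\<exists>S T R h x d c. cond2 S T R h x d c \<and> \<alpha> = chart2 S T R h x d c"
proof -
  have arc: "\<alpha> \<in> arcs" using assms by (simp add: stratum_iff)
  then obtain a b x d e c p q r s where \<alpha>: "\<alpha> = coord_arc a b x d e c p q r s" by (rule coord_arc_cases)
  note rel = coord_arc_relations[OF arc[unfolded \<alpha>]] and u = coord_arc_unimodular[OF arc[unfolded \<alpha>]]
  have z: "fps_nth a 0 = 0" "fps_nth b 0 = 0" "fps_nth e 0 = 0"
    and c: "fps_nth x 0 \<noteq> 0" "fps_nth d 0 \<noteq> 0"
    "fps_nth (d + 5 * x) 0 \<noteq> 0 \<or> fps_nth (x * c - c\<^sup>2) 0 \<noteq> 0"
    using assms by (auto simp: stratum_iff \<alpha> params_in_I power2_eq_square)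
  obtain i j where i: "x * i = 1" and j: "d * j = 1" using c fps_unit_inverse by metis
  obtain R where R: "r = R * d * x * (d + 5 * x)" "s = R * d * x\<^sup>2 * (x * c - c\<^sup>2 - b\<^sup>2)"
    "a * R = b * p" "e * R = b * (q * i)"
  proof (cases "fps_nth (d + 5 * x) 0 = 0")
    case False
    then obtain k where k: "(d + 5 * x) * k = 1" using fps_unit_inverse by blast
    show thesis
    proof (rule that[of "r * i * j * k"])
      show "r = r * i * j * k * d * x * (d + 5 * x)" using i j k by algebra
      show "s = r * i * j * k * d * x\<^sup>2 * (x * c - c\<^sup>2 - b\<^sup>2)" using i j k rel(9) by algebra
      show "a * (r * i * j * k) = b * p" using i j k rel(2) by algebra
      show "e * (r * i * j * k) = b * (q * i)" using i j k rel(7) by algebra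
    qed
  next
    case True
    then have "fps_nth (x * c - c\<^sup>2 - b\<^sup>2) 0 \<noteq> 0" using c z by (auto simp: power2_eq_square)
    then obtain k where k: "(x * c - c\<^sup>2 - b\<^sup>2) * k = 1" using fps_unit_inverse by blast
    show thesis
    proof (rule that[of "s * i * i * j * k"])
      show "r = s * i * i * j * k * d * x * (d + 5 * x)" using i j k rel(9) by algebra
      show "s = s * i * i * j * k * d * x\<^sup>2 * (x * c - c\<^sup>2 - b\<^sup>2)" using i j k by algebra
      show "a * (s * i * i * j * k) = b * p" using i j k rel(3) by algebra
      show "e * (s * i * i * j * k) = b * (q * i)" using i j k rel(8) by algebra
    qed
  qed
  have q: "q = x * (q * i)" using i by algebra
  have aT: "a * (q * i) = e * p" using i rel(1) by algebra
  have uT: "fps_nth p 0 \<noteq> 0 \<or> fps_nth (q * i) 0 \<noteq> 0 \<or> fps_nth R 0 \<noteq> 0"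
    using u q unfolding R by (metis fps_mult_nth_0 mult_zero_left mult_zero_right)
  obtain h where h: "a = p * h" "e = (q * i) * h" "b = R * h" "fps_nth h 0 = 0"
    by (rule common_factor_vec4[of p "q * i" R 0 a e b 0]) (use uT R aT z in auto)
  have "cond2 p (q * i) R h x d c" using c uT h(4) by (simp add: cond2_def)
  moreover have "\<alpha> = chart2 p (q * i) R h x d c"
    unfolding chart2_def \<alpha> h(1-3)[symmetric] R[symmetric] q[symmetric] ..
  ultimately show ?thesis by blast
qed

lemma irreducible_stratum_I2: "irreducible_in arc_space (stratum I2)"
proof (rule irreducible_by_paths)
  show "stratum I2 \<subseteq> arcs" by (auto simp: stratum_iff)
  have "cond2 1 0 0 0 1 1 0" by (simp add: cond2_def)
  then show "stratum I2 \<noteq> {}" using chart2_stratum by blast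
  fix \<alpha> \<beta> assume "\<alpha> \<in> stratum I2" "\<beta> \<in> stratum I2"
  then obtain S T R h x d c S' T' R' h' x' d' c' where
    \<alpha>: "cond2 S T R h x d c" "\<alpha> = chart2 S T R h x d c" and
    \<beta>: "cond2 S' T' R' h' x' d' c'" "\<beta> = chart2 S' T' R' h' x' d' c'"
    using stratum_I2_chart by meson
  let ?\<gamma> = "\<lambda>t. chart2 (seg S S' t) (seg T T' t) (seg R R' t) (seg h h' t) (seg x x' t) (seg d d' t) (seg c c' t)"
  have h0: "fps_nth (seg h h' t) 0 = 0" for t
    by (rule seg_const_0) (use \<alpha>(1) \<beta>(1) in \<open>simp_all only: cond2_def\<close>)
  have "eventually (\<lambda>t. fps_nth (seg S S' t) 0 \<noteq> 0 \<or> fps_nth (seg T T' t) 0 \<noteq> 0 \<or>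
      fps_nth (seg R R' t) 0 \<noteq> 0) cofinite"
    using \<alpha>(1) eventually_disj4_nonzero[of S T R 0 S' T' R' 0] by (simp add: cond2_def seg_def)
  moreover have "eventually (\<lambda>t. fps_nth (seg d d' t + 5 * seg x x' t) 0 \<noteq> 0 \<or>
      fps_nth (seg x x' t * seg c c' t - (seg c c' t)\<^sup>2) 0 \<noteq> 0) cofinite"
    using \<alpha>(1) eventually_const_nonzero[of "\<lambda>t. seg d d' t + 5 * seg x x' t"]
      eventually_const_nonzero[of "\<lambda>t. seg x x' t * seg c c' t - (seg c c' t)\<^sup>2"]
    unfolding cond2_def by (auto elim: eventually_mono)
  moreover have "eventually (\<lambda>t. fps_nth (seg x x' t) 0 \<noteq> 0) cofinite"
    "eventually (\<lambda>t. fps_nth (seg d d' t) 0 \<noteq> 0) cofinite"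
    using \<alpha>(1) by (auto simp: cond2_def intro: eventually_const_nonzero)
  ultimately have ev: "eventually (\<lambda>t. ?\<gamma> t \<in> stratum I2) cofinite"
    by eventually_elim
       (rule chart2_stratum, unfold cond2_def, intro conjI h0; assumption)
  show "\<exists>\<gamma>. arc_path \<gamma> \<and> \<gamma> 0 = \<alpha> \<and> \<gamma> 1 = \<beta> \<and> eventually (\<lambda>t. \<gamma> t \<in> stratum I2) cofinite"
    by (rule exI[of _ ?\<gamma>]) (use ev \<alpha> \<beta> in \<open>simp add: chart2_def\<close>)
qed

subsection \<open>The arcs over \<open>I3\<close>\<close>

text \<open>Where \<open>x\<close> and \<open>b\<close> are units and \<open>d\<close> vanishes at the centre, \<open>f\<close> is a unit and the ideal
  is \<open>(a, e, d)\<close>.\<close>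

definition chart3 where
  "chart3 S T R h b x c = coord_arc (S * h) b x (R * h) (T * h) c S (x * T) (b * R * x * (R * h + 5 * x))
     (b * R * x\<^sup>2 * (x * c - c\<^sup>2 - b\<^sup>2))"

definition cond3 :: "complex fps \<Rightarrow> complex fps \<Rightarrow> complex fps \<Rightarrow> complex fps \<Rightarrow> complex fps \<Rightarrow> complex fps \<Rightarrow> bool" where
  "cond3 S T R h b x \<longleftrightarrow> fps_nth h 0 = 0 \<and>
     (fps_nth S 0 \<noteq> 0 \<or> fps_nth T 0 \<noteq> 0 \<or> fps_nth R 0 \<noteq> 0) \<and>
     fps_nth b 0 \<noteq> 0 \<and> fps_nth x 0 \<noteq> 0"

lemma chart3_stratum:
  assumes "cond3 S T R h b x" shows "chart3 S T R h b x c \<in> stratum I3"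
proof -
  let ?H = "\<lambda>t. h + fps_const t * fps_X"
  let ?l = "\<lambda>t. params (S * ?H t) b x (R * ?H t) (T * ?H t) c"
  let ?y = "\<lambda>t. vector [S, x * T, b * R * x * (R * ?H t + 5 * x),
     b * R * x\<^sup>2 * (x * c - c\<^sup>2 - b\<^sup>2)] :: complex fps ^ 4"
  have "(?l 0, proj_class (?y 0)) \<in> arcs"
  proof (rule perturbed_arc[where H = ?H])
    show "bautin_gen (?l t) = ?H t *s ?y t" for t
      unfolding bautin_params vec_eq_iff forall_4 vector_smult_component vector_4
      by (intro conjI; algebra)
    show "unimodular (?y 0)" using assms by (auto simp: unimodular_vec4 cond3_def)
  qed (use assms shifted_nonzero in \<open>auto simp: cond3_def\<close>)
  then have "chart3 S T R h b x c \<in> arcs" by (simp add: chart3_def coord_arc_def)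
  then show ?thesis using assms by (auto simp: stratum_iff chart3_def params_in_I cond3_def)
qed

lemma stratum_I3_chart:
  assumes "\<alpha> \<in> stratum I3"
  shows "\<exists>S T R h b x c. cond3 S T R h b x \<and> \<alpha> = chart3 S T R h b x c"
proof -
  have arc: "\<alpha> \<in> arcs" using assms by (simp add: stratum_iff)
  then obtain a b x d e c p q r s where \<alpha>: "\<alpha> = coord_arc a b x d e c p q r s" by (rule coord_arc_cases)
  note rel = coord_arc_relations[OF arc[unfolded \<alpha>]] and u = coord_arc_unimodular[OF arc[unfolded \<alpha>]]
  have z: "fps_nth a 0 = 0" "fps_nth d 0 = 0" "fps_nth e 0 = 0"
    and c: "fps_nth x 0 \<noteq> 0" "fps_nth b 0 \<noteq> 0"
    using assms by (auto simp: stratum_iff \<alpha> params_in_I)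
  have "fps_nth (d + 5 * x) 0 \<noteq> 0" using z c by simp
  then obtain i j k where i: "x * i = 1" and j: "b * j = 1" and k: "(d + 5 * x) * k = 1"
    using c fps_unit_inverse by metis
  define T R where "T = q * i" and "R = r * i * j * k"
  have T: "q = x * T" "a * T = e * p" unfolding T_def using i rel(1) by algebra+
  have R: "r = b * R * x * (d + 5 * x)" unfolding R_def using i j k by algebra
  have R2: "s = b * R * x\<^sup>2 * (x * c - c\<^sup>2 - b\<^sup>2)" unfolding R_def using i j k rel(9) by algebra
  have aR: "a * R = d * p" unfolding R_def using i j k rel(2) by algebra
  have eR: "e * R = d * T" unfolding R_def T_def using i j k rel(7) by algebra
  have uT: "fps_nth p 0 \<noteq> 0 \<or> fps_nth T 0 \<noteq> 0 \<or> fps_nth R 0 \<noteq> 0"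
    using u unfolding T(1) R R2 by auto
  obtain h where h: "a = p * h" "e = T * h" "d = R * h" "fps_nth h 0 = 0"
    by (rule common_factor_vec4[of p T R 0 a e d 0]) (use uT aR eR T z in auto)
  have "cond3 p T R h b x" using c uT h(4) by (simp add: cond3_def)
  moreover have "\<alpha> = chart3 p T R h b x c"
    unfolding chart3_def \<alpha> h(1-3)[symmetric] R[symmetric] R2[symmetric] T(1)[symmetric] ..
  ultimately show ?thesis by blast
qed

lemma irreducible_stratum_I3: "irreducible_in arc_space (stratum I3)"
proof (rule irreducible_by_paths)
  show "stratum I3 \<subseteq> arcs" by (auto simp: stratum_iff)
  have "cond3 1 0 0 0 1 1" by (simp add: cond3_def)
  then show "stratum I3 \<noteq> {}" using chart3_stratum by blast
  fix \<alpha> \<beta> assume "\<alpha> \<in> stratum I3" "\<beta> \<in> stratum I3"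
  then obtain S T R h b x c S' T' R' h' b' x' c' where
    \<alpha>: "cond3 S T R h b x" "\<alpha> = chart3 S T R h b x c" and
    \<beta>: "cond3 S' T' R' h' b' x'" "\<beta> = chart3 S' T' R' h' b' x' c'"
    using stratum_I3_chart by meson
  let ?\<gamma> = "\<lambda>t. chart3 (seg S S' t) (seg T T' t) (seg R R' t) (seg h h' t) (seg b b' t) (seg x x' t) (seg c c' t)"
  have h0: "fps_nth (seg h h' t) 0 = 0" for t
    by (rule seg_const_0) (use \<alpha>(1) \<beta>(1) in \<open>simp_all only: cond3_def\<close>)
  have "eventually (\<lambda>t. fps_nth (seg S S' t) 0 \<noteq> 0 \<or> fps_nth (seg T T' t) 0 \<noteq> 0 \<or>
      fps_nth (seg R R' t) 0 \<noteq> 0) cofinite"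
    using \<alpha>(1) eventually_disj4_nonzero[of S T R 0 S' T' R' 0] by (simp add: cond3_def seg_def)
  moreover have "eventually (\<lambda>t. fps_nth (seg b b' t) 0 \<noteq> 0) cofinite"
    "eventually (\<lambda>t. fps_nth (seg x x' t) 0 \<noteq> 0) cofinite"
    using \<alpha>(1) by (auto simp: cond3_def intro: eventually_const_nonzero)
  ultimately have ev: "eventually (\<lambda>t. ?\<gamma> t \<in> stratum I3) cofinite"
    by eventually_elim
       (rule chart3_stratum, unfold cond3_def, intro conjI h0; assumption)
  show "\<exists>\<gamma>. arc_path \<gamma> \<and> \<gamma> 0 = \<alpha> \<and> \<gamma> 1 = \<beta> \<and> eventually (\<lambda>t. \<gamma> t \<in> stratum I3) cofinite"
    by (rule exI[of _ ?\<gamma>]) (use ev \<alpha> \<beta> in \<open>simp add: chart3_def\<close>)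
qed

subsection \<open>The arcs over \<open>I4\<close>\<close>

text \<open>Where \<open>b\<close>, \<open>x\<close> and \<open>d\<close> are units the ideal is \<open>(a, e, f, g)\<close>. The quadric cone
  \<open>xc = c\<^sup>2 + b\<^sup>2\<close> is parametrized by \<open>c\<close> and \<open>B = b / c\<close>, and \<open>g = c N h\<close>; with the factor \<open>c\<close>
  taken out of \<open>g\<close> the parametrization stays polynomial, as needed for paths.\<close>

definition chart4 where
  "chart4 S T M N h c B = (let x = N * h + c + c * B\<^sup>2; b = c * B; d = M * h - 5 * x in
     coord_arc (S * h) b x d (T * h) c S (x * T) (b * d * x * M) (b * d * x\<^sup>2 * (c * N)))"

definition cond4 :: "complex fps \<Rightarrow> complex fps \<Rightarrow> complex fps \<Rightarrow> complex fps \<Rightarrow> complex fps \<Rightarrow> complex fps \<Rightarrow> complex fps \<Rightarrow> bool" where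
  "cond4 S T M N h c B \<longleftrightarrow> fps_nth h 0 = 0 \<and>
     (fps_nth S 0 \<noteq> 0 \<or> fps_nth T 0 \<noteq> 0 \<or>
      fps_nth M 0 \<noteq> 0 \<or> fps_nth N 0 \<noteq> 0) \<and>
     fps_nth c 0 \<noteq> 0 \<and> fps_nth B 0 \<noteq> 0 \<and> fps_nth (c + c * B\<^sup>2) 0 \<noteq> 0"

lemma chart4_stratum:
  assumes "cond4 S T M N h c B" shows "chart4 S T M N h c B \<in> stratum I4"
proof -
  let ?H = "\<lambda>t. h + fps_const t * fps_X"
  define x d where "x = N * h + c + c * B\<^sup>2" and "d = M * h - 5 * x"
  have x0: "fps_nth x 0 = fps_nth c 0 + fps_nth c 0 * (fps_nth B 0)\<^sup>2"
    using assms by (simp add: x_def cond4_def power2_eq_square)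
  have d0: "fps_nth d 0 = - 5 * fps_nth x 0" using assms by (simp add: d_def cond4_def)
  have "fps_nth x 0 = fps_nth (c + c * B\<^sup>2) 0" using assms by (simp add: x_def cond4_def)
  then have x1: "fps_nth x 0 \<noteq> 0" using assms by (simp only: cond4_def) blast
  then have nz: "fps_nth x 0 \<noteq> 0" "fps_nth d 0 \<noteq> 0" "fps_nth c 0 \<noteq> 0" "fps_nth B 0 \<noteq> 0"
    using assms by (auto simp: d0 cond4_def)
  let ?x = "\<lambda>t. N * ?H t + c + c * B\<^sup>2"
  let ?d = "\<lambda>t. M * ?H t - 5 * ?x t"
  let ?l = "\<lambda>t. params (S * ?H t) (c * B) (?x t) (?d t) (T * ?H t) c"
  let ?y = "\<lambda>t. vector [S, ?x t * T, c * B * ?d t * ?x t * M,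
     c * B * ?d t * (?x t)\<^sup>2 * (c * N)] :: complex fps ^ 4"
  have "(?l 0, proj_class (?y 0)) \<in> arcs"
  proof (rule perturbed_arc[where H = ?H])
    show "bautin_gen (?l t) = ?H t *s ?y t" for t
      unfolding bautin_params vec_eq_iff forall_4 vector_smult_component vector_4
      by (intro conjI; algebra)
    have "unimodular (vector [S, x * T, c * B * d * x * M, c * B * d * x\<^sup>2 * (c * N)] :: complex fps ^ 4)"
      using assms nz by (auto simp: unimodular_vec4 cond4_def power2_eq_square)
    then show "unimodular (?y 0)" by (simp add: x_def d_def)
  qed (use assms shifted_nonzero in \<open>auto simp: cond4_def\<close>)
  then have eq: "chart4 S T M N h c B = coord_arc (S * h) (c * B) x d (T * h) c S (x * T) (c * B * d * x * M) (c * B * d * x\<^sup>2 * (c * N))"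
    "chart4 S T M N h c B \<in> arcs" by (simp_all add: chart4_def coord_arc_def Let_def x_def d_def)
  have "fps_nth x 0 * fps_nth c 0 - (fps_nth c 0)\<^sup>2 - (fps_nth (c * B) 0)\<^sup>2 = 0"
    unfolding x0 by (simp add: power2_eq_square algebra_simps)
  then show ?thesis using assms nz d0 eq(2)
    unfolding stratum_iff eq(1) coord_arc_center params_in_I by (auto simp: cond4_def)
qed

lemma stratum_I4_chart:
  assumes "\<alpha> \<in> stratum I4"
  shows "\<exists>S T M N h c B. cond4 S T M N h c B \<and> \<alpha> = chart4 S T M N h c B"
proof -
  have arc: "\<alpha> \<in> arcs" using assms by (simp add: stratum_iff)
  then obtain a b x d e c p q r s where \<alpha>: "\<alpha> = coord_arc a b x d e c p q r s" by (rule coord_arc_cases)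
  note rel = coord_arc_relations[OF arc[unfolded \<alpha>]] and u = coord_arc_unimodular[OF arc[unfolded \<alpha>]]
  have z: "fps_nth a 0 = 0" "fps_nth e 0 = 0" "fps_nth (d + 5 * x) 0 = 0"
      "fps_nth (x * c - c\<^sup>2 - b\<^sup>2) 0 = 0"
    and n: "fps_nth x 0 \<noteq> 0" "fps_nth b 0 \<noteq> 0" "fps_nth d 0 \<noteq> 0"
    using assms by (auto simp: stratum_iff \<alpha> params_in_I power2_eq_square)
  have c: "fps_nth c 0 \<noteq> 0" using z(4) n(2) by (auto simp: power2_eq_square)
  obtain i j k m where i: "x * i = 1" and j: "b * j = 1" and k: "d * k = 1" and m: "c * m = 1"
    using n c fps_unit_inverse by metis
  define T M N B where "T = q * i" and "M = r * i * j * k" and "N = s * i * i * j * k * m" and "B = b * m"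
  have y: "q = x * T" "r = b * d * x * M" "s = b * d * x\<^sup>2 * (c * N)" "b = c * B"
    unfolding T_def M_def N_def B_def using i j k m by algebra+
  have m1: "a * T = e * p" unfolding T_def using i rel(1) by algebra
  have m2: "a * M = (d + 5 * x) * p" unfolding M_def using i j k rel(2) by algebra
  have m3: "a * (c * N) = (x * c - c\<^sup>2 - b\<^sup>2) * p" unfolding N_def using i j k m rel(3) by algebra
  have m4: "e * M = (d + 5 * x) * T" unfolding M_def T_def using i j k rel(7) by algebra
  have m5: "e * (c * N) = (x * c - c\<^sup>2 - b\<^sup>2) * T" unfolding N_def T_def using i j k m rel(8) by algebra
  have m6: "(d + 5 * x) * (c * N) = (x * c - c\<^sup>2 - b\<^sup>2) * M"
    unfolding N_def M_def using i j k m rel(9) by algebra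
  have uT: "fps_nth p 0 \<noteq> 0 \<or> fps_nth T 0 \<noteq> 0 \<or> fps_nth M 0 \<noteq> 0 \<or> fps_nth N 0 \<noteq> 0"
    using u unfolding y by auto
  then have uT': "fps_nth p 0 \<noteq> 0 \<or> fps_nth T 0 \<noteq> 0 \<or> fps_nth M 0 \<noteq> 0 \<or> fps_nth (c * N) 0 \<noteq> 0"
    using c by simp
  obtain h where h: "a = p * h" "e = T * h" "d + 5 * x = M * h" "x * c - c\<^sup>2 - b\<^sup>2 = c * N * h"
    "fps_nth h 0 = 0"
    by (rule common_factor_vec4[OF uT' m1 m2 m3 m4 m5 m6 z])
  have x: "N * h + c + c * B\<^sup>2 = x"
    using m h(4) unfolding B_def by algebra
  have d: "M * h - 5 * x = d" using h(3) by algebra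
  have "fps_nth (c + c * B\<^sup>2) 0 = fps_nth x 0" unfolding x[symmetric] using h(5) by simp
  moreover have "fps_nth B 0 \<noteq> 0" using n(2) unfolding y(4) by auto
  ultimately have "cond4 p T M N h c B" using n c uT h(5) by (simp only: cond4_def) simp
  moreover have "\<alpha> = chart4 p T M N h c B"
    unfolding chart4_def Let_def x d y(1-3)[symmetric] y(4)[symmetric] \<alpha> h(1,2)[symmetric] ..
  ultimately show ?thesis by blast
qed

lemma irreducible_stratum_I4: "irreducible_in arc_space (stratum I4)"
proof (rule irreducible_by_paths)
  show "stratum I4 \<subseteq> arcs" by (auto simp: stratum_iff)
  have "cond4 1 0 0 0 0 1 1" by (simp add: cond4_def)
  then show "stratum I4 \<noteq> {}" using chart4_stratum by blast
  fix \<alpha> \<beta> assume "\<alpha> \<in> stratum I4" "\<beta> \<in> stratum I4"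
  then obtain S T M N h c B S' T' M' N' h' c' B' where
    \<alpha>: "cond4 S T M N h c B" "\<alpha> = chart4 S T M N h c B" and
    \<beta>: "cond4 S' T' M' N' h' c' B'" "\<beta> = chart4 S' T' M' N' h' c' B'"
    using stratum_I4_chart by meson
  let ?\<gamma> = "\<lambda>t. chart4 (seg S S' t) (seg T T' t) (seg M M' t) (seg N N' t) (seg h h' t) (seg c c' t) (seg B B' t)"
  have h0: "fps_nth (seg h h' t) 0 = 0" for t
    by (rule seg_const_0) (use \<alpha>(1) \<beta>(1) in \<open>simp_all only: cond4_def\<close>)
  have "eventually (\<lambda>t. fps_nth (seg S S' t) 0 \<noteq> 0 \<or> fps_nth (seg T T' t) 0 \<noteq> 0 \<or>
      fps_nth (seg M M' t) 0 \<noteq> 0 \<or> fps_nth (seg N N' t) 0 \<noteq> 0) cofinite"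
    using \<alpha>(1) eventually_disj4_nonzero[of S T M N S' T' M' N'] by (simp only: cond4_def)
  moreover have "eventually (\<lambda>t. fps_nth (seg c c' t + seg c c' t * (seg B B' t)\<^sup>2) 0 \<noteq> 0) cofinite"
    using \<alpha>(1) eventually_const_nonzero[of "\<lambda>t. seg c c' t + seg c c' t * (seg B B' t)\<^sup>2"]
    unfolding cond4_def by auto
  moreover have "eventually (\<lambda>t. fps_nth (seg c c' t) 0 \<noteq> 0) cofinite"
    "eventually (\<lambda>t. fps_nth (seg B B' t) 0 \<noteq> 0) cofinite"
    using \<alpha>(1) by (auto simp: cond4_def intro: eventually_const_nonzero)
  ultimately have ev: "eventually (\<lambda>t. ?\<gamma> t \<in> stratum I4) cofinite"
    by eventually_elim
       (rule chart4_stratum, unfold cond4_def, intro conjI h0; assumption)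
  show "\<exists>\<gamma>. arc_path \<gamma> \<and> \<gamma> 0 = \<alpha> \<and> \<gamma> 1 = \<beta> \<and> eventually (\<lambda>t. \<gamma> t \<in> stratum I4) cofinite"
    by (rule exI[of _ ?\<gamma>]) (use ev \<alpha> \<beta> in \<open>simp add: chart4_def Let_def\<close>)
qed

subsection \<open>The arcs over \<open>I1 \<inter> I3\<close>\<close>

text \<open>The conditions keep the centre off the other components of the exceptional divisor:
  that over \<open>I2\<close> by \<open>b \<noteq> 0\<close>, over \<open>I4\<close> by \<open>g \<noteq> 0\<close>, over \<open>I1\<close> by \<open>s \<noteq> 0\<close>, and over \<open>I3\<close>, whose
  component has the equation \<open>5s = gr\<close>, by \<open>5s \<noteq> gr\<close>. They force the centre over \<open>I1 \<inter> I3\<close>.\<close>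

definition stratum13 :: "arc set" where
  "stratum13 = {\<alpha> \<in> arcs. let l = fst (arc_center \<alpha>); g = l$3 * l$6 - 2 * (l$6)\<^sup>2 - (l$2)\<^sup>2 in
     l$2 \<noteq> 0 \<and> g \<noteq> 0 \<and> (\<forall>z\<in>snd (arc_center \<alpha>). z$4 \<noteq> 0 \<and> 5 * z$4 - g * z$3 \<noteq> 0)}"

lemma open_stratum13: "openin arc_space stratum13"
proof -
  let ?g = "\<lambda>l. l$3 * l$6 - 2 * (l$6)\<^sup>2 - (l$2)\<^sup>2"
  have g: "hpoly 0 (\<lambda>l y. ?g l) (\<lambda>l y. ?g l)"
    by (intro hpoly_diff hpoly_mult0 hpoly_numeral hpoly_fst hpoly_power2)
  have "openin arc_space {a \<in> arcs. fst (arc_center a) $ 2 \<noteq> 0}"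
    by (rule open_arcs_center_fst[OF hpoly_fst])
  moreover have "openin arc_space {a \<in> arcs. ?g (fst (arc_center a)) \<noteq> 0}"
    by (rule open_arcs_center_fst[OF g])
  moreover have "openin arc_space {a \<in> arcs. \<forall>z\<in>snd (arc_center a). z$4 \<noteq> 0}"
    by (rule open_arcs_center[OF hpoly_snd])
  moreover have "openin arc_space {a \<in> arcs. \<forall>z\<in>snd (arc_center a). 5 * z$4 - ?g (fst (arc_center a)) * z$3 \<noteq> 0}"
    by (rule open_arcs_center[OF hpoly_diff[OF hpoly_mult1[OF hpoly_numeral hpoly_snd] hpoly_mult1[OF g hpoly_snd]]])
  ultimately have "openin arc_space ({a \<in> arcs. fst (arc_center a) $ 2 \<noteq> 0} \<inter>
    {a \<in> arcs. ?g (fst (arc_center a)) \<noteq> 0} \<inter> {a \<in> arcs. \<forall>z\<in>snd (arc_center a). z$4 \<noteq> 0} \<inter>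
    {a \<in> arcs. \<forall>z\<in>snd (arc_center a). 5 * z$4 - ?g (fst (arc_center a)) * z$3 \<noteq> 0})"
    by (intro openin_Int)
  moreover have "stratum13 = {a \<in> arcs. fst (arc_center a) $ 2 \<noteq> 0} \<inter>
    {a \<in> arcs. ?g (fst (arc_center a)) \<noteq> 0} \<inter> {a \<in> arcs. \<forall>z\<in>snd (arc_center a). z$4 \<noteq> 0} \<inter>
    {a \<in> arcs. \<forall>z\<in>snd (arc_center a). 5 * z$4 - ?g (fst (arc_center a)) * z$3 \<noteq> 0}"
    unfolding stratum13_def Let_def by blast
  ultimately show ?thesis by simp
qed

lemma coord_arc_stratum13:
  fixes x c b :: "complex fps"
  defines "g \<equiv> x * c - c\<^sup>2 - b\<^sup>2"
  shows "coord_arc a b x d e c p q r s \<in> stratum13 \<longleftrightarrow> coord_arc a b x d e c p q r s \<in> arcs \<and>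
    fps_nth b 0 \<noteq> 0 \<and> fps_nth g 0 \<noteq> 0 \<and> fps_nth s 0 \<noteq> 0 \<and> fps_nth (5 * s - g * r) 0 \<noteq> 0"
proof -
  have h: "hpoly (Suc 0) (\<lambda>l y. 5 * y$4 - fps_nth g 0 * y$3) (\<lambda>l y. 5 * y$4 - fps_const (fps_nth g 0) * y$3)"
    by (intro hpoly_diff hpoly_mult1 hpoly_numeral hpoly_snd hpoly_const)
  have g0: "(fps_nth x 0 + fps_nth c 0) * fps_nth c 0 - 2 * (fps_nth c 0)\<^sup>2 - (fps_nth b 0)\<^sup>2 = fps_nth g 0"
    by (simp add: g_def power2_eq_square algebra_simps)
  have g0': "(fps_nth x 0 + fps_nth c 0) * fps_nth c 0 - 2 * (fps_nth c 0)\<^sup>2 \<noteq> (fps_nth b 0)\<^sup>2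
      \<longleftrightarrow> fps_nth g 0 \<noteq> 0"
    unfolding g0[symmetric] by simp
  show ?thesis
    using hpoly_center_iff[OF hpoly_snd[of 4]] hpoly_center_iff[OF h]
    by (simp add: stratum13_def Let_def g0 g0' ball_conj_distrib)
qed

lemma coord_arc_scale:
  assumes "fps_nth u 0 \<noteq> 0"
  shows "coord_arc a b x d e c (u * p) (u * q) (u * r) (u * s) = coord_arc a b x d e c p q r s"
proof -
  have "(vector [u * p, u * q, u * r, u * s] :: complex fps ^ 4) = u *s vector [p, q, r, s]"
    by (simp add: vec_eq_iff forall_4)
  moreover have "u dvd 1" using assms by (simp only: fps_dvd_1_iff) simp
  ultimately show ?thesis by (simp only: coord_arc_def proj_class_eqI)
qed

text \<open>With \<open>s = 1\<close> the syzygies read \<open>f = xgR\<close>, \<open>e = bdxgQ\<close> and \<open>a = bdx\<^sup>2gP\<close>; the first gives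
  \<open>d = x(Rg - 5)\<close>. The condition that \<open>x\<close> vanish at the centre is built in by \<open>x = \<epsilon> \<xi>\<close>.\<close>

definition chart13 where
  "chart13 \<xi> b c P Q R = (let x = fps_X * \<xi>; g = x * c - c\<^sup>2 - b\<^sup>2; K = R * g - 5 in
     coord_arc (P * b * K * g * x ^ 3) b x (x * K) (Q * b * K * g * x ^ 2) c P Q R 1)"

definition cond13 :: "complex fps \<Rightarrow> complex fps \<Rightarrow> complex fps \<Rightarrow> bool" where
  "cond13 b c R \<longleftrightarrow> fps_nth b 0 \<noteq> 0 \<and> fps_nth (c\<^sup>2 + b\<^sup>2) 0 \<noteq> 0 \<and>
     fps_nth (R * (c\<^sup>2 + b\<^sup>2) + 5) 0 \<noteq> 0"

lemma chart13_stratum: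
  assumes "cond13 b c R" shows "chart13 \<xi> b c P Q R \<in> stratum13"
proof -
  let ?x = "\<lambda>t. fps_X * (\<xi> + fps_const t * fps_X)"
  let ?g = "\<lambda>t. ?x t * c - c\<^sup>2 - b\<^sup>2"
  let ?K = "\<lambda>t. R * ?g t - 5"
  let ?l = "\<lambda>t. params (P * b * ?K t * ?g t * ?x t ^ 3) b (?x t) (?x t * ?K t) (Q * b * ?K t * ?g t * ?x t ^ 2) c"
  let ?y = "\<lambda>t::complex. vector [P, Q, R, 1] :: complex fps ^ 4"
  let ?H = "\<lambda>t. b * ?K t * ?g t * ?x t ^ 3"
  have g: "fps_nth (?g t) 0 = - fps_nth (c\<^sup>2 + b\<^sup>2) 0"
    and K: "fps_nth (?K t) 0 = - fps_nth (R * (c\<^sup>2 + b\<^sup>2) + 5) 0" for t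
    by (simp_all add: algebra_simps numeral_fps_const)
  have g0: "fps_nth (?g t) 0 \<noteq> 0" and K0: "fps_nth (?K t) 0 \<noteq> 0" for t
    using assms unfolding g K cond13_def neg_equal_0_iff_equal by blast+
  have b0: "fps_nth b 0 \<noteq> 0" using assms by (simp add: cond13_def)
  have "(?l 0, proj_class (?y 0)) \<in> arcs"
  proof (rule perturbed_arc[where H = ?H])
    show "bautin_gen (?l t) = ?H t *s ?y t" for t
      unfolding bautin_params vec_eq_iff forall_4 vector_smult_component vector_4
      by (intro conjI; algebra)
    show "unimodular (?y 0)" by (simp add: unimodular_vec4)
    show "eventually (\<lambda>t. ?H t \<noteq> 0) cofinite"
      using shifted_nonzero[of \<xi>]
    proof eventually_elim
      case (elim t)
      have "b \<noteq> 0" "?g t \<noteq> 0" "?K t \<noteq> 0" using b0 g0[of t] K0[of t] by (metis fps_zero_nth)+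
      with elim show ?case by simp
    qed
  qed (use assms in \<open>auto intro!: fps_path_mult fps_path_diff fps_path_power fps_path_add simp: power2_eq_square\<close>)
  then have "chart13 \<xi> b c P Q R \<in> arcs" by (simp add: chart13_def coord_arc_def Let_def)
  moreover have "5 * 1 - ?g 0 * R = - ?K 0" by simp
  then have "fps_nth (5 * 1 - ?g 0 * R) 0 \<noteq> 0"
    using K0[of 0] by (simp only: fps_neg_nth neg_equal_0_iff_equal) blast
  ultimately show ?thesis
    using g0[of 0] b0 unfolding chart13_def Let_def coord_arc_stratum13 by simp
qed

lemma fps_factor_X: "(\<forall>n<k. fps_nth f n = 0) \<Longrightarrow> f = fps_X ^ k * fps_shift k (f :: complex fps)"
  by (rule fps_ext) (simp add: fps_X_power_mult_nth)

lemma stratum13_chart: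
  assumes "\<alpha> \<in> stratum13"
  shows "\<exists>\<xi> b c P Q R. cond13 b c R \<and> \<alpha> = chart13 \<xi> b c P Q R"
proof -
  have arc: "\<alpha> \<in> arcs" using assms by (simp add: stratum13_def)
  then obtain a b x d e c p q r s where \<alpha>: "\<alpha> = coord_arc a b x d e c p q r s" by (rule coord_arc_cases)
  define g where "g = x * c - c\<^sup>2 - b\<^sup>2"
  note rel = coord_arc_relations[OF arc[unfolded \<alpha>], folded g_def]
  have nz: "fps_nth b 0 \<noteq> 0" "fps_nth g 0 \<noteq> 0" "fps_nth s 0 \<noteq> 0" "fps_nth (5 * s - g * r) 0 \<noteq> 0"
    using assms unfolding \<alpha> coord_arc_stratum13 g_def by blast+
  obtain i where i: "s * i = 1" using nz(3) fps_unit_inverse by blast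
  have s: "p = s * (p * i)" "q = s * (q * i)" "r = s * (r * i)" "s = s * 1" using i by (algebra, algebra, algebra, simp)
  have \<alpha>': "\<alpha> = coord_arc a b x d e c (p * i) (q * i) (r * i) 1"
    unfolding \<alpha> using coord_arc_scale[OF nz(3), of a b x d e c "p * i" "q * i" "r * i" 1] s by metis
  define K where "K = r * i * g - 5"
  have d: "d = x * K" unfolding K_def using i rel(9) by algebra
  have e: "e = (q * i) * b * K * g * x ^ 2" using i d rel(8) by algebra
  have a: "a = (p * i) * b * K * g * x ^ 3" using i d rel(3) by algebra
  have "fps_nth K 0 \<noteq> 0"
  proof -
    have "5 * s - g * r = - (s * K)" unfolding K_def using i by algebra
    then show ?thesis using nz(4) by auto
  qed
  have x0: "fps_nth x 0 = 0"
    using arc_center_in_components[OF arc] nz \<open>fps_nth K 0 \<noteq> 0\<close>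
    unfolding \<alpha> Un_iff coord_arc_center params_in_I d by (auto simp: g_def power2_eq_square)
  define \<xi> where "\<xi> = fps_shift 1 x"
  have \<xi>: "fps_X * \<xi> = x" unfolding \<xi>_def using x0 fps_factor_X[of 1 x] by simp
  have "fps_nth (c\<^sup>2 + b\<^sup>2) 0 = - fps_nth g 0" using x0 by (simp add: g_def)
  moreover have "fps_nth (r * i * (c\<^sup>2 + b\<^sup>2) + 5) 0 = - fps_nth K 0"
    unfolding K_def g_def using x0 by (simp add: algebra_simps)
  ultimately have "cond13 b c (r * i)" using nz \<open>fps_nth K 0 \<noteq> 0\<close> by (simp only: cond13_def) simp
  moreover have "\<alpha> = chart13 \<xi> b c (p * i) (q * i) (r * i)"
    unfolding chart13_def Let_def \<xi> g_def[symmetric] K_def[symmetric] d[symmetric] e[symmetric] a[symmetric]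
    by (rule \<alpha>')
  ultimately show ?thesis by blast
qed

lemma chart13_path [intro, simp]:
  assumes "fps_path \<xi>" "fps_path b" "fps_path c" "fps_path P" "fps_path Q" "fps_path R"
  shows "arc_path (\<lambda>t. chart13 (\<xi> t) (b t) (c t) (P t) (Q t) (R t))"
  unfolding chart13_def Let_def using assms
  by (intro coord_arc_path fps_path_mult fps_path_diff fps_path_power fps_path_const)

lemma eventually_cond13:
  assumes "fps_path b" "fps_path c" "fps_path R" "cond13 (b z) (c z) (R z)"
  shows "eventually (\<lambda>t. cond13 (b t) (c t) (R t)) cofinite"
proof -
  have "eventually (\<lambda>t. fps_nth (b t) 0 \<noteq> 0) cofinite"
    "eventually (\<lambda>t. fps_nth ((c t)\<^sup>2 + (b t)\<^sup>2) 0 \<noteq> 0) cofinite"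
    "eventually (\<lambda>t. fps_nth (R t * ((c t)\<^sup>2 + (b t)\<^sup>2) + 5) 0 \<noteq> 0) cofinite"
    using assms(4) unfolding cond13_def
    by (intro fps_path_nonzero[of _ z] fps_path_add fps_path_mult fps_path_power fps_path_const assms(1-3); blast)+
  then show ?thesis unfolding cond13_def by eventually_elim blast
qed

lemma irreducible_stratum13: "irreducible_in arc_space stratum13"
proof (rule irreducible_by_paths)
  show "stratum13 \<subseteq> arcs" by (auto simp: stratum13_def)
  have "cond13 1 0 0" by (simp add: cond13_def numeral_fps_const)
  then show "stratum13 \<noteq> {}" using chart13_stratum by blast
  fix \<alpha> \<beta> assume "\<alpha> \<in> stratum13" "\<beta> \<in> stratum13"
  then obtain \<xi> b c P Q R \<xi>' b' c' P' Q' R' where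
    \<alpha>: "cond13 b c R" "\<alpha> = chart13 \<xi> b c P Q R" and
    \<beta>: "cond13 b' c' R'" "\<beta> = chart13 \<xi>' b' c' P' Q' R'"
    using stratum13_chart by meson
  let ?\<gamma> = "\<lambda>t. chart13 (seg \<xi> \<xi>' t) (seg b b' t) (seg c c' t) (seg P P' t) (seg Q Q' t) (seg R R' t)"
  have "eventually (\<lambda>t. cond13 (seg b b' t) (seg c c' t) (seg R R' t)) cofinite"
    by (rule eventually_cond13[where z = 0]) (use \<alpha> in simp_all)
  then have "eventually (\<lambda>t. ?\<gamma> t \<in> stratum13) cofinite"
    by eventually_elim (rule chart13_stratum)
  then show "\<exists>\<gamma>. arc_path \<gamma> \<and> \<gamma> 0 = \<alpha> \<and> \<gamma> 1 = \<beta> \<and> eventually (\<lambda>t. \<gamma> t \<in> stratum13) cofinite"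
    by (intro exI[of _ ?\<gamma>]) (use \<alpha> \<beta> in simp)
qed

lemma stratum13_center:
  assumes "\<alpha> \<in> stratum13"
  shows "fst (arc_center \<alpha>) \<in> I1" "fst (arc_center \<alpha>) \<in> I3"
proof -
  obtain \<xi> b c P Q R where "\<alpha> = chart13 \<xi> b c P Q R" using stratum13_chart[OF assms] by blast
  then show "fst (arc_center \<alpha>) \<in> I1" "fst (arc_center \<alpha>) \<in> I3"
    by (simp_all add: chart13_def Let_def params_in_I power2_eq_square power3_eq_cube)
qed

subsection \<open>The family\<close>

lemma family13_coord_arc:
  "coord_arc a b x d e c p q r s \<in> family13 G \<longleftrightarrow> coord_arc a b x d e c p q r s \<in> arcs \<and>
     fps_nth b 0 \<noteq> 0 \<and> (\<forall>n<3. fps_nth a n = 0) \<and> (\<forall>n<2. fps_nth e n = 0) \<and>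
     fps_nth x 0 = 0 \<and> fps_nth d 0 = 0 \<and>
     vector [fps_nth a 3, fps_nth e 2, fps_nth x 1, fps_nth d 1] \<in> G"
proof -
  have *: "fst (coord_arc a b x d e c p q r s) = params a b x d e c" by (simp add: coord_arc_def)
  have "(\<forall>n<1. P n) \<longleftrightarrow> P 0" for P :: "nat \<Rightarrow> bool" by auto
  then show ?thesis
    unfolding family13_def mem_Collect_eq Let_def * const_term_params Int_iff params_in_I params_nth
    by auto
qed

lemma family13_arcs: "family13 G \<subseteq> arcs"
  by (auto simp: family13_def)

abbreviation "coeff_space \<equiv> zariski_on UNIV (\<lambda>(c :: complex ^ 4) i. c $ i)"

text \<open>Join a given arc to the arc with \<open>b = 1\<close>, \<open>c = 0\<close> whose leading coefficients are \<open>w\<close>.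
  Arcs of the chart have the orders of vanishing required in the family, so almost all arcs of the
  path belong to it.\<close>

lemma stratum13_in_closure_family:
  assumes G: "openin coeff_space G" "w \<in> G" "w $ 3 \<noteq> 0" "w $ 4 \<noteq> 0"
  shows "stratum13 \<subseteq> arc_space closure_of (family13 G)"
proof
  fix \<alpha> assume st: "\<alpha> \<in> stratum13"
  then obtain \<xi> b c P Q R where \<alpha>: "cond13 b c R" "\<alpha> = chart13 \<xi> b c P Q R"
    using stratum13_chart by blast
  \<comment> \<open>Solved from the leading coefficients at \<open>g = -1\<close>: \<open>w\<^sub>4 = (- R - 5) w\<^sub>3\<close>,
    \<open>w\<^sub>2 = - Q w\<^sub>4 w\<^sub>3\<close>, \<open>w\<^sub>1 = - P w\<^sub>4 w\<^sub>3\<^sup>2\<close>.\<close>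
  define \<xi>' P' Q' R' where "\<xi>' = w$3" and "P' = - w$1 / (w$4 * (w$3)\<^sup>2)" and "Q' = - w$2 / (w$4 * w$3)"
    and "R' = - 5 - w$4 / w$3"
  have K': "- R' - 5 = w$4 / w$3" by (simp add: R'_def)
  define \<Xi> B C PP QQ RR where "\<Xi> = seg \<xi> (fps_const \<xi>')" and "B = seg b 1" and "C = seg c 0"
    and "PP = seg P (fps_const P')" and "QQ = seg Q (fps_const Q')" and "RR = seg R (fps_const R')"
  have paths [simp]: "fps_path \<Xi>" "fps_path B" "fps_path C" "fps_path PP" "fps_path QQ" "fps_path RR"
    by (simp_all add: \<Xi>_def B_def C_def PP_def QQ_def RR_def)
  have paths' [simp]: "fps_path (\<lambda>t. \<Xi> t)" "fps_path (\<lambda>t. B t)" "fps_path (\<lambda>t. C t)" "fps_path (\<lambda>t. PP t)"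
    "fps_path (\<lambda>t. QQ t)" "fps_path (\<lambda>t. RR t)" by simp_all
  let ?\<gamma> = "\<lambda>t. chart13 (\<Xi> t) (B t) (C t) (PP t) (QQ t) (RR t)"
  have start: "?\<gamma> 0 = \<alpha>" by (simp add: \<alpha> \<Xi>_def B_def C_def PP_def QQ_def RR_def)
  define g K where "g t = fps_X * \<Xi> t * C t - (C t)\<^sup>2 - (B t)\<^sup>2" and "K t = RR t * g t - 5" for t
  define A E where "A t = PP t * B t * K t * g t * (\<Xi> t) ^ 3" and "E t = QQ t * B t * K t * g t * (\<Xi> t) ^ 2" for t
  have gK [simp]: "fps_path g" "fps_path K" unfolding g_def K_def
    by (intro fps_path_mult fps_path_diff fps_path_power fps_path_const paths')+
  then have AE: "fps_path A" "fps_path E" "fps_path (\<lambda>t. \<Xi> t * K t)" unfolding A_def E_def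
    by (intro fps_path_mult fps_path_diff fps_path_power fps_path_const paths' gK)+
  have \<gamma>: "?\<gamma> t = coord_arc (fps_X ^ 3 * A t) (B t) (fps_X * \<Xi> t) (fps_X * (\<Xi> t * K t)) (fps_X ^ 2 * E t)
      (C t) (PP t) (QQ t) (RR t) 1" for t
    unfolding chart13_def Let_def g_def[symmetric] K_def[symmetric] A_def E_def
    by (simp add: power_mult_distrib mult_ac)
  let ?w = "\<lambda>t. vector [fps_nth (A t) 0, fps_nth (E t) 0, fps_nth (\<Xi> t) 0, fps_nth (\<Xi> t * K t) 0] :: complex ^ 4"
  have g1: "g 1 = -1" and K1: "K 1 = fps_const (w$4 / w$3)"
    unfolding g_def K_def by (simp_all add: \<Xi>_def B_def C_def RR_def numeral_fps_const flip: K')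
  have w1: "?w 1 = w"
    unfolding vec_eq_iff forall_4 vector_4
    using G(3,4) unfolding A_def E_def K1 g1
    by (simp add: \<Xi>_def B_def PP_def QQ_def P'_def Q'_def \<xi>'_def power2_eq_square power3_eq_cube)
  have "eventually (\<lambda>t. ?w t \<in> G) cofinite"
  proof (rule zariski_path[OF G(1)])
    show "?w 1 \<in> G" using G(2) w1 by simp
    have "\<forall>i. poly_path (\<lambda>t. ?w t $ i)"
      unfolding forall_4 vector_4 using AE paths' by (intro conjI fps_pathD)
    then show "poly_path (\<lambda>t. ?w t $ i)" for i ..
  qed simp
  moreover have "eventually (\<lambda>t. cond13 (B t) (C t) (RR t)) cofinite"
    by (rule eventually_cond13[where z = 0]) (use \<alpha>(1) in \<open>simp_all add: B_def C_def RR_def\<close>)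
  ultimately have ev: "eventually (\<lambda>t. ?\<gamma> t \<in> family13 G) cofinite"
  proof eventually_elim
    case (elim t)
    have "?\<gamma> t \<in> arcs" using chart13_stratum[OF elim(2)] by (simp add: stratum13_def)
    moreover have "fps_nth (B t) 0 \<noteq> 0" using elim(2) by (simp add: cond13_def)
    ultimately show ?case
      unfolding \<gamma> family13_coord_arc using elim(1) by (simp add: fps_X_power_mult_nth)
  qed
  have "\<alpha> \<in> arcs" using st by (simp add: stratum13_def)
  then show "\<alpha> \<in> arc_space closure_of (family13 G)"
    using path_limit_in_closure[OF family13_arcs chart13_path ev, of 0] start by simp
qed

text \<open>An arc of the family has \<open>v = \<epsilon>\<^sup>3 Y\<close>, where the third entry of \<open>Y\<close> is a unit, so its
  class is that of \<open>Y\<close>. It may be centred over \<open>g = 0\<close>; moving \<open>c\<close> leads away from there.\<close>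

lemma family_in_closure_stratum13:
  assumes G: "\<And>w. w \<in> G \<Longrightarrow> w $ 3 \<noteq> 0 \<and> w $ 4 \<noteq> 0 \<and> w $ 4 + 5 * w $ 3 \<noteq> 0"
  shows "family13 G \<subseteq> arc_space closure_of stratum13"
proof
  fix \<alpha> assume fam: "\<alpha> \<in> family13 G"
  then have arc: "\<alpha> \<in> arcs" using family13_arcs by blast
  then obtain a b x d e c p q r s where \<alpha>: "\<alpha> = coord_arc a b x d e c p q r s" by (rule coord_arc_cases)
  note f = fam[unfolded \<alpha> family13_coord_arc]
  note rel = coord_arc_relations[OF arc[unfolded \<alpha>]] and u = coord_arc_unimodular[OF arc[unfolded \<alpha>]]
  define a' e' \<xi> \<delta> where "a' = fps_shift 3 a" and "e' = fps_shift 2 e" and "\<xi> = fps_shift 1 x" and "\<delta> = fps_shift 1 d"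
  have a: "a = fps_X ^ 3 * a'" and e: "e = fps_X ^ 2 * e'" and x: "x = fps_X * \<xi>" and d: "d = fps_X * \<delta>"
    using f fps_factor_X[of 3 a] fps_factor_X[of 2 e] fps_factor_X[of 1 x] fps_factor_X[of 1 d]
    by (simp_all add: a'_def e'_def \<xi>_def \<delta>_def)
  have nz: "fps_nth \<xi> 0 \<noteq> 0" "fps_nth \<delta> 0 \<noteq> 0" "fps_nth \<delta> 0 + 5 * fps_nth \<xi> 0 \<noteq> 0" "fps_nth b 0 \<noteq> 0"
    using G[of "vector [fps_nth a 3, fps_nth e 2, fps_nth x 1, fps_nth d 1]"] f
    by (simp_all add: \<xi>_def \<delta>_def)
  define y3 where "y3 = b * \<delta> * \<xi> * (\<delta> + 5 * \<xi>)"
  have y3: "fps_nth y3 0 \<noteq> 0" using nz by (simp add: y3_def)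
  then obtain k where k: "y3 * k = 1" using fps_unit_inverse by blast
  have X: "(fps_X :: complex fps) \<noteq> 0" by simp
  let ?g = "\<lambda>c. x * c - c\<^sup>2 - b\<^sup>2"
  have y: "a' * r = y3 * p" "e' * \<xi> * r = y3 * q" "y3 * s = b * \<delta> * \<xi>\<^sup>2 * ?g c * r"
  proof -
    have "fps_X ^ 3 * (a' * r) = fps_X ^ 3 * (y3 * p)" using rel(2) unfolding a y3_def x d by algebra
    then show "a' * r = y3 * p" by simp
    have "fps_X ^ 3 * (e' * \<xi> * r) = fps_X ^ 3 * (y3 * q)" using rel(5) unfolding e y3_def x d by algebra
    then show "e' * \<xi> * r = y3 * q" by simp
    have "fps_X ^ 3 * (y3 * s) = fps_X ^ 3 * (b * \<delta> * \<xi>\<^sup>2 * ?g c * r)" using rel(6) unfolding y3_def x d by algebra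
    then show "y3 * s = b * \<delta> * \<xi>\<^sup>2 * ?g c * r" by simp
  qed
  define v where "v = r * k"
  have v: "p = v * a'" "q = v * (e' * \<xi>)" "r = v * y3" "s = v * (b * \<delta> * \<xi>\<^sup>2 * ?g c)"
    unfolding v_def using k y by algebra+
  have "fps_nth v 0 \<noteq> 0" using u unfolding v by auto
  then have \<alpha>': "\<alpha> = coord_arc a b x d e c a' (e' * \<xi>) y3 (b * \<delta> * \<xi>\<^sup>2 * ?g c)"
    unfolding \<alpha> using coord_arc_scale v by metis
  let ?c = "\<lambda>t. c + fps_const t"
  let ?\<gamma> = "\<lambda>t. coord_arc a b x d e (?c t) a' (e' * \<xi>) y3 (b * \<delta> * \<xi>\<^sup>2 * ?g (?c t))"
  have path: "arc_path ?\<gamma>"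
    by (intro coord_arc_path fps_path_mult fps_path_diff fps_path_power fps_path_add fps_path_const fps_path_fps_const poly_path_id)
  have x0: "fps_nth x 0 = 0" using f by blast
  have "fps_path (\<lambda>t. ?g (?c t))"
    by (intro fps_path_mult fps_path_diff fps_path_power fps_path_add fps_path_const fps_path_fps_const poly_path_id)
  moreover have "fps_nth (?g (?c (- fps_nth c 0))) 0 \<noteq> 0" using nz x0 by (simp add: power2_eq_square)
  ultimately have "eventually (\<lambda>t. fps_nth (?g (?c t)) 0 \<noteq> 0) cofinite"
    by (rule fps_path_nonzero)
  then have "eventually (\<lambda>t. ?\<gamma> t \<in> stratum13) cofinite"
  proof eventually_elim
    case (elim t)
    define g where "g = ?g (?c t)"
    have g: "fps_nth g 0 \<noteq> 0" using elim by (simp add: g_def)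
    have "(params a b x d e (?c t), proj_class (vector [a', e' * \<xi>, y3, b * \<delta> * \<xi>\<^sup>2 * g] :: complex fps ^ 4)) \<in> arcs"
    proof (rule nondegenerate_arc)
      show "bautin_gen (params a b x d e (?c t)) = fps_X ^ 3 *s vector [a', e' * \<xi>, y3, b * \<delta> * \<xi>\<^sup>2 * g]"
        unfolding bautin_params vec_eq_iff forall_4 vector_smult_component vector_4 g_def a e y3_def x d
        by (intro conjI; (rule refl | algebra))
      show "unimodular (vector [a', e' * \<xi>, y3, b * \<delta> * \<xi>\<^sup>2 * g] :: complex fps ^ 4)"
        using y3 by (simp add: unimodular_vec4)
    qed simp_all
    then have arc: "?\<gamma> t \<in> arcs" by (simp add: coord_arc_def g_def)
    have "5 * (b * \<delta> * \<xi>\<^sup>2 * g) - g * y3 = - (b * \<delta>\<^sup>2 * \<xi> * g)" unfolding y3_def by algebra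
    then have "fps_nth (5 * (b * \<delta> * \<xi>\<^sup>2 * g) - g * y3) 0 \<noteq> 0"
      using nz g by (simp add: power2_eq_square)
    with arc nz g show ?case unfolding coord_arc_stratum13 g_def by (simp add: power2_eq_square)
  qed
  moreover have "?\<gamma> 0 \<in> arcs" using arc \<alpha>' by simp
  moreover have "stratum13 \<subseteq> arcs" by (auto simp: stratum13_def)
  ultimately have "?\<gamma> 0 \<in> arc_space closure_of stratum13"
    using path_limit_in_closure[OF _ path, of stratum13 0] by blast
  then show "\<alpha> \<in> arc_space closure_of stratum13" using \<alpha>' by simp
qed

section \<open>The components cover the exceptional divisor\<close>

definition const_arc where
  "const_arc a b x d e c p q r s = coord_arc (fps_const a) (fps_const b) (fps_const x) (fps_const d) (fps_const e)
     (fps_const c) (fps_const p) (fps_const q) (fps_const r) (fps_const s)"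

lemma const_arc_center [simp]:
  "arc_center (const_arc a b x d e c p q r s) = (params a b x d e c, proj_class (vector [p, q, r, s]))"
  by (rule prod_eqI) (simp_all add: const_arc_def)

lemma const_arc_path [intro, simp]:
  assumes "poly_path a" "poly_path b" "poly_path x" "poly_path d" "poly_path e" "poly_path c"
    and "poly_path p" "poly_path q" "poly_path r" "poly_path s"
  shows "arc_path (\<lambda>t. const_arc (a t) (b t) (x t) (d t) (e t) (c t) (p t) (q t) (r t) (s t))"
  unfolding const_arc_def by (intro coord_arc_path fps_path_fps_const assms)

lemma exc_divisor_const_arc:
  assumes "z \<in> exc_divisor"
  obtains a b x d e c p q r s where "const_arc a b x d e c p q r s \<in> arcs"
    "arc_center (const_arc a b x d e c p q r s) = z"
proof -
  have "z \<in> blowup" using assms by (simp add: exc_divisor_def)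
  then obtain l y where z: "z = (l, proj_class y)" by (rule blowup_cases)
  obtain a b x d e c where l: "l = params a b x d e c" using params_surj by blast
  obtain p q r s where y: "y = vector [p, q, r, s]" using vec4_surj by blast
  have k: "(\<chi> i. fps_const (params a b x d e c $ i)) =
      params (fps_const a) (fps_const b) (fps_const x) (fps_const d) (fps_const e) (fps_const c)"
    unfolding vec_eq_iff forall_6 by simp
  have v: "(\<chi> i. fps_const ((vector [p, q, r, s] :: complex ^ 4) $ i)) =
      vector [fps_const p, fps_const q, fps_const r, fps_const s]"
    unfolding vec_eq_iff forall_4 by simp
  have "const_arc a b x d e c p q r s \<in> arcs"
    using constant_arc[of l y] assms unfolding z l y k v const_arc_def coord_arc_def by blast
  then show thesis by (rule that) (simp add: z l y)
qed

lemma const_arc_unimodular: "const_arc a b x d e c p q r s \<in> arcs \<Longrightarrow> p \<noteq> 0 \<or> q \<noteq> 0 \<or> r \<noteq> 0 \<or> s \<noteq> 0"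
  unfolding const_arc_def by (drule coord_arc_unimodular) simp

lemma const_arc_relations:
  assumes "const_arc a b x d e c p q r s \<in> arcs"
  shows "e * r = b * d * (d + 5 * x) * q" "e * s = b * d * x * (x * c - c\<^sup>2 - b\<^sup>2) * q"
    "(d + 5 * x) * s = x * (x * c - c\<^sup>2 - b\<^sup>2) * r"
  using coord_arc_relations(7-9)[OF assms[unfolded const_arc_def], THEN arg_cong[where f = "\<lambda>f. fps_nth f 0"]]
  by (simp_all add: power2_eq_square)

lemma const_power: "fps_const x ^ n = fps_const (x ^ n :: complex)"
  by (induct n) simp_all

lemmas fps_const_simps = numeral_fps_const const_power

text \<open>The next four lemmas give the generic points of the components of the exceptional
  divisor over \<open>I1\<close>, \<open>I3\<close>, \<open>I4\<close> and \<open>I1 \<inter> I3\<close>, as arcs with \<open>h = 0\<close> or \<open>\<xi> = 0\<close>.\<close>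

lemma const_arc_stratum1:
  assumes "b \<noteq> 0" "d \<noteq> 0" "e * r = b * d\<^sup>2 * q" "p \<noteq> 0 \<or> q \<noteq> 0 \<or> r \<noteq> 0"
  shows "const_arc 0 b 0 d e c p q r 0 \<in> stratum I1"
proof -
  define T where "T = r / (b * d\<^sup>2)"
  have T: "e * T = q" "b * d * d * T = r" using assms by (simp_all add: T_def power2_eq_square field_simps)
  have "cond1 (fps_const p) (fps_const T) 0 (fps_const b) (fps_const d) (fps_const e)"
    using assms T by (auto simp: cond1_def)
  from chart1_stratum[OF this, of "fps_const c"] show ?thesis
    using T by (simp add: chart1_def const_arc_def)
qed

lemma const_arc_stratum3:
  assumes "b \<noteq> 0" "x \<noteq> 0" "5 * s = (x * c - c\<^sup>2 - b\<^sup>2) * r" "p \<noteq> 0 \<or> q \<noteq> 0 \<or> r \<noteq> 0"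
  shows "const_arc 0 b x 0 0 c p q r s \<in> stratum I3"
proof -
  define T R where "T = q / x" and "R = r / (5 * b * x\<^sup>2)"
  have y: "x * T = q" "b * R * x * (5 * x) = r" "b * R * x\<^sup>2 * (x * c - c\<^sup>2 - b\<^sup>2) = s"
    using assms by (simp_all add: T_def R_def power2_eq_square field_simps)
  have "cond3 (fps_const p) (fps_const T) (fps_const R) 0 (fps_const b) (fps_const x)"
    using assms by (auto simp: cond3_def T_def R_def)
  from chart3_stratum[OF this, of "fps_const c"] show ?thesis
    using y by (simp add: chart3_def const_arc_def fps_const_simps)
qed

lemma const_arc_stratum4:
  assumes "b \<noteq> 0" "x \<noteq> 0" "x * c = c\<^sup>2 + b\<^sup>2" "p \<noteq> 0 \<or> q \<noteq> 0 \<or> r \<noteq> 0 \<or> s \<noteq> 0"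
  shows "const_arc 0 b x (- 5 * x) 0 c p q r s \<in> stratum I4"
proof -
  have c: "c \<noteq> 0" using assms by auto
  define T M N B where "T = q / x" and "M = r / (b * (- 5 * x) * x)" and
    "N = s / (b * (- 5 * x) * x\<^sup>2 * c)" and "B = b / c"
  have x: "c + c * B\<^sup>2 = x" and b: "c * B = b"
    using assms c by (simp_all add: B_def power2_eq_square field_simps)
  have y: "x * T = q" "b * (- 5 * x) * x * M = r" "b * (- 5 * x) * x\<^sup>2 * (c * N) = s"
    using assms c by (simp_all add: T_def M_def N_def)
  have fx: "fps_const c + fps_const c * (fps_const B)\<^sup>2 = fps_const x" by (simp add: fps_const_simps x)
  have "cond4 (fps_const p) (fps_const T) (fps_const M) (fps_const N) 0 (fps_const c) (fps_const B)"
    unfolding cond4_def fx using assms c by (auto simp: T_def M_def N_def B_def)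
  from chart4_stratum[OF this]
  have "chart4 (fps_const p) (fps_const T) (fps_const M) (fps_const N) 0 (fps_const c) (fps_const B) \<in> stratum I4" .
  moreover have "chart4 (fps_const p) (fps_const T) (fps_const M) (fps_const N) 0 (fps_const c) (fps_const B) =
      const_arc 0 b x (- 5 * x) 0 c p q r s"
    unfolding chart4_def Let_def const_arc_def mult_zero_right add_0 fx
    using y b by (simp add: fps_const_simps)
  ultimately show ?thesis by simp
qed

lemma const_arc_stratum13:
  assumes "b \<noteq> 0" "c\<^sup>2 + b\<^sup>2 \<noteq> 0" "s \<noteq> 0" "5 * s + (c\<^sup>2 + b\<^sup>2) * r \<noteq> 0"
  shows "const_arc 0 b 0 0 0 c p q r s \<in> stratum13"
proof -
  have "r / s * (c\<^sup>2 + b\<^sup>2) + 5 \<noteq> 0" using assms(3,4) by (simp add: field_simps)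
  then have "cond13 (fps_const b) (fps_const c) (fps_const (r / s))"
    using assms(1,2) by (simp add: cond13_def fps_const_simps)
  from chart13_stratum[OF this, of 0 "fps_const (p / s)" "fps_const (q / s)"]
  have "coord_arc 0 (fps_const b) 0 0 0 (fps_const c) (fps_const (p / s)) (fps_const (q / s)) (fps_const (r / s)) 1
      \<in> stratum13" by (simp add: chart13_def)
  moreover have "coord_arc 0 (fps_const b) 0 0 0 (fps_const c) (fps_const s * fps_const (p / s))
      (fps_const s * fps_const (q / s)) (fps_const s * fps_const (r / s)) (fps_const s * 1) =
      coord_arc 0 (fps_const b) 0 0 0 (fps_const c) (fps_const (p / s)) (fps_const (q / s)) (fps_const (r / s)) 1"
    by (rule coord_arc_scale) (use assms in simp)
  ultimately show ?thesis using assms(3) by (simp add: const_arc_def)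
qed

lemma strata_arcs: "stratum I \<subseteq> arcs" "stratum13 \<subseteq> arcs"
  by (auto simp: stratum_def stratum13_def)

lemma eventually_nonzero: "eventually (\<lambda>t::complex. t \<noteq> 0) cofinite"
  by (simp add: eventually_cofinite)

text \<open>If \<open>x \<noteq> 0\<close>, the centre is off \<open>I1\<close>; it lies in the stratum of \<open>I2\<close>, or it lies over \<open>I3\<close> or
  \<open>I4\<close> and is a limit of points there with \<open>b \<noteq> 0\<close>. If \<open>x = 0\<close>, the syzygies become \<open>er = bd\<^sup>2q\<close> and \<open>es = ds = 0\<close>:
  for \<open>s = 0\<close> the point is a limit of points over the generic part of \<open>I1\<close>, and \<open>s \<noteq> 0\<close> forces
  \<open>d = e = 0\<close>, the fifth component.\<close>

lemma const_arc_in_closure: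
  assumes arc: "const_arc a b x d e c p q r s \<in> arcs"
  defines "\<alpha> \<equiv> const_arc a b x d e c p q r s"
  shows "(\<exists>I\<in>{I1, I2, I3, I4}. \<alpha> \<in> arc_space closure_of stratum I) \<or> \<alpha> \<in> arc_space closure_of stratum13"
proof -
  note rel = const_arc_relations[OF arc] and u = const_arc_unimodular[OF arc]
  define f g where "f = d + 5 * x" and "g = x * c - c\<^sup>2 - b\<^sup>2"
  have mem: "stratum I \<subseteq> arc_space closure_of stratum I" for I
    by (rule closure_of_subset) (simp add: strata_arcs)
  have center: "params a b x d e c \<in> I1 \<or> params a b x d e c \<in> I2 \<or> params a b x d e c \<in> I3 \<or> params a b x d e c \<in> I4"
    using arc_center_in_components[OF arc] by simp
  then have a: "a = 0" by (auto simp: params_in_I)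
  have st: "\<alpha> \<in> stratum I1 \<longleftrightarrow> params a b x d e c \<in> I1 \<and> params a b x d e c \<notin> I2 \<and> params a b x d e c \<notin> I3 \<and> params a b x d e c \<notin> I4"
    "\<alpha> \<in> stratum I2 \<longleftrightarrow> params a b x d e c \<in> I2 \<and> params a b x d e c \<notin> I1 \<and> params a b x d e c \<notin> I3 \<and> params a b x d e c \<notin> I4"
    "\<alpha> \<in> stratum I3 \<longleftrightarrow> params a b x d e c \<in> I3 \<and> params a b x d e c \<notin> I1 \<and> params a b x d e c \<notin> I2 \<and> params a b x d e c \<notin> I4"
    "\<alpha> \<in> stratum I4 \<longleftrightarrow> params a b x d e c \<in> I4 \<and> params a b x d e c \<notin> I1 \<and> params a b x d e c \<notin> I2 \<and> params a b x d e c \<notin> I3"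
    using arc by (simp_all add: stratum_iff \<alpha>_def)
  show ?thesis
  proof (cases "x = 0")
    case x: False
    consider (I4) "e = 0" "f = 0" "g = 0" | (I3) "d = 0" "e = 0" | (I2) "\<alpha> \<in> stratum I2"
      using center a x st(2) by (auto simp: params_in_I f_def g_def)
    then show ?thesis
    proof cases
      case I2
      then show ?thesis using mem by blast
    next
      case I3
      have s: "5 * s = g * r" using rel(3) x I3 by (simp add: g_def)
      show ?thesis
      proof (cases "b = 0")
        case False
        then have "\<alpha> \<in> stratum I3" using a x I3 by (simp add: st params_in_I)
        then show ?thesis using mem by blast
      next
        case True
        let ?\<gamma> = "\<lambda>t. const_arc 0 t x 0 0 c p q r ((x * c - c\<^sup>2 - t\<^sup>2) * (r / 5))"
        have pqr: "p \<noteq> 0 \<or> q \<noteq> 0 \<or> r \<noteq> 0" using u s by auto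
        have "eventually (\<lambda>t. ?\<gamma> t \<in> stratum I3) cofinite"
          using eventually_nonzero by eventually_elim (rule const_arc_stratum3, use x pqr in simp_all)
        moreover have "arc_path ?\<gamma>"
          by (intro const_arc_path poly_path_mult poly_path_diff poly_path_power poly_path_const poly_path_id)
        moreover have "(x * c - c\<^sup>2 - 0\<^sup>2) * (r / 5) = s"
          using s True by (simp add: g_def divide_eq_eq mult.commute)
        then have "?\<gamma> 0 = \<alpha>" unfolding \<alpha>_def a I3 True by (rule arg_cong)
        ultimately have "\<alpha> \<in> arc_space closure_of stratum I3"
          using path_limit_in_closure[OF strata_arcs(1), of ?\<gamma> I3 0] arc by (simp add: \<alpha>_def)
        then show ?thesis by blast
      qed
    next
      case I4
      then have d: "d = - 5 * x" by (simp add: f_def add_eq_0_iff)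
      show ?thesis
      proof (cases "b = 0")
        case False
        then have "\<alpha> \<in> stratum I4" using a x I4 d by (simp add: st params_in_I f_def g_def)
        then show ?thesis using mem by blast
      next
        case b: True
        \<comment> \<open>For \<open>b = 0\<close> the equation \<open>g = 0\<close> reads \<open>c(x - c) = 0\<close>; the path on the cone
          \<open>X C = C\<^sup>2 + t\<^sup>2\<close> starts on one of these two lines.\<close>
        have "\<exists>X C. poly_path X \<and> poly_path C \<and> X 0 = x \<and> C 0 = c \<and> (\<forall>t. X t * C t = (C t)\<^sup>2 + t\<^sup>2)"
        proof (cases "c = 0")
          case True
          show ?thesis
            by (rule exI[of _ "\<lambda>t. x + t\<^sup>2 * (1 / x)"], rule exI[of _ "\<lambda>t. t\<^sup>2 * (1 / x)"],
                intro conjI poly_path_add poly_path_mult poly_path_power poly_path_const poly_path_id)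
               (use x True in \<open>simp_all add: power2_eq_square field_simps\<close>)
        next
          case False
          then have "x = c" using I4 b by (simp add: g_def power2_eq_square)
          show ?thesis
            by (rule exI[of _ "\<lambda>t. x + t\<^sup>2 * (1 / c)"], rule exI[of _ "\<lambda>t. c"],
                intro conjI poly_path_add poly_path_mult poly_path_power poly_path_const poly_path_id)
               (use False \<open>x = c\<close> in \<open>simp_all add: power2_eq_square field_simps\<close>)
        qed
        then obtain X C where XC: "poly_path X" "poly_path C" "X 0 = x" "C 0 = c"
          "\<And>t. X t * C t = (C t)\<^sup>2 + t\<^sup>2" by blast
        let ?\<gamma> = "\<lambda>t. const_arc 0 t (X t) (- 5 * X t) 0 (C t) p q r s"
        have "eventually (\<lambda>t. X t \<noteq> 0) cofinite"
          using poly_path_nonzero[OF XC(1), of 0] XC(3) x by simp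
        with eventually_nonzero have "eventually (\<lambda>t. ?\<gamma> t \<in> stratum I4) cofinite"
          by eventually_elim (rule const_arc_stratum4, use XC(5) u in simp_all)
        moreover have "arc_path ?\<gamma>" using XC(1,2) by (intro const_arc_path poly_path_mult) simp_all
        moreover have "?\<gamma> 0 = \<alpha>" by (simp add: \<alpha>_def a I4 d b XC(3,4))
        ultimately have "\<alpha> \<in> arc_space closure_of stratum I4"
          using path_limit_in_closure[OF strata_arcs(1), of ?\<gamma> I4 0] arc by (simp add: \<alpha>_def)
        then show ?thesis by blast
      qed
    qed
  next
    case x: True
    show ?thesis
    proof (cases "s = 0")
      case s: True
      show ?thesis
      proof (cases "e \<noteq> 0 \<or> b \<noteq> 0 \<and> d \<noteq> 0")
        case True
        then have "\<alpha> \<in> stratum I1" using a x by (auto simp: st params_in_I)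
        then show ?thesis using mem by blast
      next
        case False
        then have e: "e = 0" and bd: "b = 0 \<or> d = 0" by auto
        \<comment> \<open>Path on \<open>er = bd\<^sup>2q\<close>. For \<open>r = 0\<close> the coordinate \<open>r\<close> is replaced by \<open>t\<close>, and the
          squares in \<open>b + t\<^sup>2\<close>, \<open>d + t\<^sup>2\<close> make \<open>bd\<^sup>2 / t\<close> a polynomial vanishing at 0.\<close>
        have "\<exists>B D E R. poly_path B \<and> poly_path D \<and> poly_path E \<and> poly_path R \<and>
            B 0 = b \<and> D 0 = d \<and> E 0 = 0 \<and> R 0 = r \<and>
            eventually (\<lambda>t. B t \<noteq> 0) cofinite \<and> eventually (\<lambda>t. D t \<noteq> 0) cofinite \<and>
            (\<forall>t. E t * R t = B t * (D t)\<^sup>2 * q)"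
        proof -
          have ev: "eventually (\<lambda>t. w + t\<^sup>2 \<noteq> 0) cofinite" for w :: complex
          proof -
            obtain z where z: "w + z\<^sup>2 \<noteq> 0" using that[of 0] that[of 1] by (cases "w = 0") auto
            show ?thesis using poly_path_nonzero[of "\<lambda>t. w + t\<^sup>2" z] z by simp
          qed
          consider "r \<noteq> 0" | "r = 0" "b = 0" | "r = 0" "d = 0" using bd by blast
          then show ?thesis
          proof cases
            case 1
            show ?thesis
              by (rule exI[of _ "\<lambda>t. b + t\<^sup>2"], rule exI[of _ "\<lambda>t. d + t\<^sup>2"],
                  rule exI[of _ "\<lambda>t. (b + t\<^sup>2) * (d + t\<^sup>2)\<^sup>2 * (q / r)"], rule exI[of _ "\<lambda>t. r"])
                 (use 1 bd ev in auto)
          next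
            case 2
            show ?thesis
              by (rule exI[of _ "\<lambda>t. b + t\<^sup>2"], rule exI[of _ "\<lambda>t. d + t\<^sup>2"],
                  rule exI[of _ "\<lambda>t. t * (d + t\<^sup>2)\<^sup>2 * q"], rule exI[of _ "\<lambda>t. t"])
                 (use 2 ev[of b] ev[of d] in \<open>simp add: power2_eq_square\<close>)
          next
            case 3
            show ?thesis
              by (rule exI[of _ "\<lambda>t. b + t\<^sup>2"], rule exI[of _ "\<lambda>t. d + t\<^sup>2"],
                  rule exI[of _ "\<lambda>t. (b + t\<^sup>2) * t ^ 3 * q"], rule exI[of _ "\<lambda>t. t"])
                 (use 3 ev[of b] ev[of d] in \<open>simp add: power2_eq_square power3_eq_cube\<close>)
          qed
        qed
        then obtain B D E R where path: "poly_path B" "poly_path D" "poly_path E" "poly_path R" and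
          0: "B 0 = b" "D 0 = d" "E 0 = 0" "R 0 = r" and
          ev: "eventually (\<lambda>t. B t \<noteq> 0) cofinite" "eventually (\<lambda>t. D t \<noteq> 0) cofinite" and
          eq: "\<And>t. E t * R t = B t * (D t)\<^sup>2 * q" by blast
        let ?\<gamma> = "\<lambda>t. const_arc 0 (B t) 0 (D t) (E t) c p q (R t) 0"
        have "eventually (\<lambda>t. p \<noteq> 0 \<or> q \<noteq> 0 \<or> R t \<noteq> 0) cofinite"
          using u s poly_path_nonzero[OF path(4), of 0] 0(4) by (auto elim: eventually_mono)
        with ev have "eventually (\<lambda>t. ?\<gamma> t \<in> stratum I1) cofinite"
          by eventually_elim (rule const_arc_stratum1, use eq in simp_all)
        moreover have "arc_path ?\<gamma>" using path by (intro const_arc_path) simp_all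
        moreover have "?\<gamma> 0 = \<alpha>" by (simp add: \<alpha>_def a x e s 0)
        ultimately have "\<alpha> \<in> arc_space closure_of stratum I1"
          using path_limit_in_closure[OF strata_arcs(1), of ?\<gamma> I1 0] arc by (simp add: \<alpha>_def)
        then show ?thesis by blast
      qed
    next
      case s: False
      then have de: "d = 0" "e = 0" using rel x by simp_all
      let ?\<gamma> = "\<lambda>t. const_arc 0 (b + t) 0 0 0 c p q r s"
      have "eventually (\<lambda>t. b + t \<noteq> 0) cofinite"
        using poly_path_nonzero[of "\<lambda>t. b + t" "1 - b"] by simp
      moreover have "eventually (\<lambda>t. c\<^sup>2 + (b + t)\<^sup>2 \<noteq> 0) cofinite"
      proof -
        obtain z where z: "c\<^sup>2 + (b + z)\<^sup>2 \<noteq> 0"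
          using that[of "1 - b"] that[of "- b"] by (cases "c = 0") auto
        show ?thesis using poly_path_nonzero[of "\<lambda>t. c\<^sup>2 + (b + t)\<^sup>2" z] z by simp
      qed
      \<comment> \<open>At \<open>t = \<i> c - b\<close> the second summand vanishes.\<close>
      moreover have "eventually (\<lambda>t. 5 * s + (c\<^sup>2 + (b + t)\<^sup>2) * r \<noteq> 0) cofinite"
        using poly_path_nonzero[of "\<lambda>t. 5 * s + (c\<^sup>2 + (b + t)\<^sup>2) * r" "\<i> * c - b"] s
        by (simp add: power_mult_distrib)
      ultimately have "eventually (\<lambda>t. ?\<gamma> t \<in> stratum13) cofinite"
        by eventually_elim (rule const_arc_stratum13, use s in simp_all)
      moreover have "arc_path ?\<gamma>" by simp
      moreover have "?\<gamma> 0 = \<alpha>" by (simp add: \<alpha>_def a x de)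
      ultimately have "\<alpha> \<in> arc_space closure_of stratum13"
        using path_limit_in_closure[OF strata_arcs(2), of ?\<gamma> 0] arc by (simp add: \<alpha>_def)
      then show ?thesis by blast
    qed
  qed
qed

section \<open>Essential sets of components\<close>

text \<open>A set in \<open>\<O>\<close> is open and disjoint from the others, hence disjoint from their closures.
  Being a union of fibres of the centre map it contains all arcs centred at its own centres, so no
  other closure covers these.\<close>

lemma essential_strata:
  assumes O: "\<And>S. S \<in> \<O> \<Longrightarrow> openin arc_space S \<and> irreducible_in arc_space S"
    and disj: "\<And>S T. S \<in> \<O> \<Longrightarrow> T \<in> \<O> \<Longrightarrow> S \<noteq> T \<Longrightarrow> S \<inter> T = {}"
    and sat: "\<And>S \<alpha> \<beta>. S \<in> \<O> \<Longrightarrow> \<alpha> \<in> S \<Longrightarrow> \<beta> \<in> arcs \<Longrightarrow> arc_center \<beta> = arc_center \<alpha> \<Longrightarrow> \<beta> \<in> S"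
    and cov: "exc_divisor \<subseteq> (\<Union>S\<in>\<O>. arc_center ` (arc_space closure_of S))"
  shows "essential ((closure_of) arc_space ` \<O>)" and "inj_on ((closure_of) arc_space) \<O>"
proof -
  have cl: "arc_space closure_of S \<subseteq> arcs" for S
    using closure_of_subset_topspace[of arc_space S] by simp
  have sub: "S \<subseteq> arcs \<and> S \<noteq> {} \<and> S \<subseteq> arc_space closure_of S" if "S \<in> \<O>" for S
    using O[OF that] closure_of_subset[of S arc_space] by (simp add: irreducible_in_def)
  have disj': "S \<inter> arc_space closure_of T = {}" if "S \<in> \<O>" "T \<in> \<O>" "S \<noteq> T" for S T
    using openin_Int_closure_of_eq_empty[of arc_space S T] disj[OF that] O[OF that(1)] by blast
  show inj: "inj_on ((closure_of) arc_space) \<O>"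
  proof (rule inj_onI, rule ccontr)
    fix S T assume "S \<in> \<O>" "T \<in> \<O>" "arc_space closure_of S = arc_space closure_of T" "S \<noteq> T"
    then show False using disj'[of S T] sub[of S] by auto
  qed
  show "essential ((closure_of) arc_space ` \<O>)"
    unfolding essential_def
  proof (intro conjI allI impI)
    show "(closure_of) arc_space ` \<O> \<subseteq> irreducible_components_of arc_space"
      using O open_irreducible_component by blast
    have "arc_center \<alpha> \<in> exc_divisor" if "\<alpha> \<in> arc_space closure_of S" for \<alpha> S
      using that cl[of S] by (auto simp only: arcs_def)
    then have "(\<Union>S\<in>\<O>. arc_center ` (arc_space closure_of S)) \<subseteq> exc_divisor"
      by (intro UN_least image_subsetI)
    then show "covers_exc ((closure_of) arc_space ` \<O>)"
      unfolding covers_exc_def image_image using cov by (intro equalityI) simp_all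
    fix M' assume M': "M' \<subset> (closure_of) arc_space ` \<O>"
    then obtain S where S: "S \<in> \<O>" "arc_space closure_of S \<notin> M'" by blast
    then obtain \<alpha> where \<alpha>: "\<alpha> \<in> S" using sub by blast
    show "\<not> covers_exc M'"
    proof
      assume "covers_exc M'"
      moreover have "arc_center \<alpha> \<in> exc_divisor" using \<alpha> sub[OF S(1)] by (auto simp: arcs_def)
      ultimately have "arc_center \<alpha> \<in> (\<Union>A\<in>M'. arc_center ` A)" unfolding covers_exc_def by simp
      then obtain A \<beta> where A: "A \<in> M'" "\<beta> \<in> A" "arc_center \<beta> = arc_center \<alpha>"
        by (elim UN_E imageE) simp
      then obtain T where T: "T \<in> \<O>" "A = arc_space closure_of T" using M' by blast
      have "\<beta> \<in> S" using sat[OF S(1) \<alpha>, of \<beta>] A T cl by blast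
      moreover have "T \<noteq> S" using A(1) T(2) S(2) by blast
      ultimately show False using disj'[OF S(1) T(1)] A(2) T(2) by blast
    qed
  qed
qed

text \<open>The family and the stratum are contained in each other's closures as soon as the
  leading coefficients of \<open>x\<close>, \<open>d\<close> and \<open>f\<close> are nonzero.\<close>

lemma closure_stratum13_family: "closure_general_family13 (arc_space closure_of stratum13)"
proof -
  let ?G0 = "{w :: complex ^ 4. w $ 3 \<noteq> 0 \<and> w $ 4 \<noteq> 0 \<and> w $ 4 + 5 * w $ 3 \<noteq> 0}"
  let ?c = "\<lambda>(c :: complex ^ 4) i. c $ i"
  have "polyfun ?c (\<lambda>w. w $ 4 + 5 * w $ 3)"
    by (intro polyfun_add polyfun_mult polyfun_const polyfun_coord[of ?c])
  from zariski_open[OF this, of UNIV] zariski_open[OF polyfun_coord[of ?c 3], of UNIV]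
    zariski_open[OF polyfun_coord[of ?c 4], of UNIV]
  have "openin coeff_space ({w \<in> UNIV. w $ 3 \<noteq> 0} \<inter> {w \<in> UNIV. w $ 4 \<noteq> 0} \<inter>
      {w \<in> UNIV. w $ 4 + 5 * w $ 3 \<noteq> 0})"
    by (intro openin_Int)
  moreover have "{w \<in> UNIV. w $ 3 \<noteq> 0} \<inter> {w \<in> UNIV. w $ 4 \<noteq> 0} \<inter>
      {w \<in> UNIV. w $ 4 + 5 * w $ 3 \<noteq> 0} = ?G0" by blast
  ultimately have "openin coeff_space ?G0" by simp
  moreover have "vector [0, 0, 1, 1] \<in> ?G0" by simp
  then have "?G0 \<noteq> {}" by blast
  moreover have "arc_space closure_of stratum13 = arc_space closure_of (family13 G)"
    if G: "openin coeff_space G" "G \<noteq> {}" "G \<subseteq> ?G0" for G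
  proof
    obtain w where w: "w \<in> G" using G(2) by blast
    have w': "w \<in> ?G0" using w G(3) by blast
    then have "stratum13 \<subseteq> arc_space closure_of (family13 G)"
      using stratum13_in_closure_family[OF G(1) w] by blast
    then show "arc_space closure_of stratum13 \<subseteq> arc_space closure_of (family13 G)"
      by (simp add: closure_of_minimal)
    have "family13 G \<subseteq> arc_space closure_of stratum13"
      using family_in_closure_stratum13[of G] G(3) by blast
    then show "arc_space closure_of (family13 G) \<subseteq> arc_space closure_of stratum13"
      by (simp add: closure_of_minimal)
  qed
  ultimately show ?thesis unfolding closure_general_family13_def Let_def by blast
qed

theorem mainTheorem4:
  shows "\<exists>Arc13. closure_general_family13 Arc13 \<and>
           essential {Arc I1, Arc I2, Arc I3, Arc I4, Arc13} \<and>
           card {Arc I1, Arc I2, Arc I3, Arc I4, Arc13} = 5"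
proof -
  let ?\<O> = "{stratum I1, stratum I2, stratum I3, stratum I4, stratum13}"
  have irr: "irreducible_in arc_space S" if "S \<in> ?\<O>" for S
    using that irreducible_stratum_I1 irreducible_stratum_I2 irreducible_stratum_I3
      irreducible_stratum_I4 irreducible_stratum13 by blast
  have d: "stratum I1 \<inter> stratum I2 = {}" "stratum I1 \<inter> stratum I3 = {}" "stratum I1 \<inter> stratum I4 = {}"
    "stratum I1 \<inter> stratum13 = {}" "stratum I2 \<inter> stratum I3 = {}" "stratum I2 \<inter> stratum I4 = {}"
    "stratum I2 \<inter> stratum13 = {}" "stratum I3 \<inter> stratum I4 = {}" "stratum I3 \<inter> stratum13 = {}"
    "stratum I4 \<inter> stratum13 = {}"
    using stratum13_center by (auto simp: stratum_iff)
  have ne: "S \<noteq> {}" if "S \<in> ?\<O>" for S using irr[OF that] by (simp add: irreducible_in_def)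
  have card: "card ?\<O> = 5"
  proof -
    have "stratum I1 \<noteq> stratum I2" "stratum I1 \<noteq> stratum I3" "stratum I1 \<noteq> stratum I4"
      "stratum I1 \<noteq> stratum13" "stratum I2 \<noteq> stratum I3" "stratum I2 \<noteq> stratum I4"
      "stratum I2 \<noteq> stratum13" "stratum I3 \<noteq> stratum I4" "stratum I3 \<noteq> stratum13" "stratum I4 \<noteq> stratum13"
      using d ne by auto
    then show ?thesis by simp
  qed
  have "openin arc_space S" if "S \<in> ?\<O>" for S
    using that open_stratum open_stratum13 by blast
  then have opn: "openin arc_space S \<and> irreducible_in arc_space S" if "S \<in> ?\<O>" for S
    using irr that by simp
  have disj: "S \<inter> T = {}" if "S \<in> ?\<O>" "T \<in> ?\<O>" "S \<noteq> T" for S T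
    using that d by (elim insertE emptyE) (simp_all add: Int_commute)
  have sat: "\<beta> \<in> S" if "S \<in> ?\<O>" "\<alpha> \<in> S" "\<beta> \<in> arcs" "arc_center \<beta> = arc_center \<alpha>" for S \<alpha> \<beta>
  proof -
    have "S = stratum13 \<or> (\<exists>I. S = stratum I)" using that(1) by blast
    then show ?thesis using that(2-4)
      by (elim disjE exE) (simp_all only: stratum_def stratum13_def mem_Collect_eq simp_thms)
  qed
  have cov: "exc_divisor \<subseteq> (\<Union>S\<in>?\<O>. arc_center ` (arc_space closure_of S))"
  proof
    fix z assume "z \<in> exc_divisor"
    then obtain a b x d e c p q r s where z: "const_arc a b x d e c p q r s \<in> arcs"
      "arc_center (const_arc a b x d e c p q r s) = z" by (rule exc_divisor_const_arc)
    have "\<exists>S\<in>?\<O>. const_arc a b x d e c p q r s \<in> arc_space closure_of S"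
      using const_arc_in_closure[OF z(1)] by (simp only: bex_simps) blast
    then obtain S where S: "S \<in> ?\<O>" "const_arc a b x d e c p q r s \<in> arc_space closure_of S" ..
    show "z \<in> (\<Union>S\<in>?\<O>. arc_center ` (arc_space closure_of S))"
      unfolding z(2)[symmetric] by (rule UN_I[OF S(1)]) (rule imageI[OF S(2)])
  qed
  note ess = essential_strata(1)[OF opn disj sat cov]
    and inj = essential_strata(2)[OF opn disj sat cov]
  have eq: "{Arc I1, Arc I2, Arc I3, Arc I4, arc_space closure_of stratum13} = (closure_of) arc_space ` ?\<O>"
    by (simp add: Arc_stratum)
  show ?thesis
  proof (intro exI conjI)
    show "closure_general_family13 (arc_space closure_of stratum13)" by (rule closure_stratum13_family)
    show "essential {Arc I1, Arc I2, Arc I3, Arc I4, arc_space closure_of stratum13}"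
      unfolding eq by (rule ess)
    show "card {Arc I1, Arc I2, Arc I3, Arc I4, arc_space closure_of stratum13} = 5"
      unfolding eq by (rule trans[OF card_image[OF inj] card])
  qed
qed

end
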